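(* Let $N\ge1$, $s\in(0,1)$, let $f$ be a locally Lipschitz function such that $f(t)$ is non-increasing for nonnegative and small values of $t$, and let $u$ be a nonnegative bounded weak solution, not identically zero, of $(-\Delta)^s u=f(u)$ in $\mathbb{R}^N$ satisfying $u(x)\to0$ as $|x|\to+\infty$. Then $u$ is radially symmetric and radially decreasing with respect to a point of $\mathbb{R}^N$.
   Context: The fractional Laplacian is $(-\Delta)^s u(x)=c_{N,s}\,\mathrm{P.V.}\int_{\mathbb{R}^N}\frac{u(x)-u(y)}{|x-y|^{N+2s}}\,dy$, with $c_{N,s}>0$ a normalization constant. Set $\mathcal{E}(u,v)=\frac{c_{N,s}}{2}\int_{\mathbb{R}^{2N}}\frac{(u(x)-u(y))(v(x)-v(y))}{|x-y|^{N+2s}}\,dx\,dy$, and let $\mathcal{D}^s(\mathbb{R}^N)$ be the completion of $\mathcal{C}^\infty_c(\mathbb{R}^N)$ with respect to the norm induced by $\mathcal{E}$. A weak solution of $(-\Delta)^s u=f(u)$ in $\mathbb{R}^N$ is a function $u\in\mathcal{D}^s(\mathbb{R}^N)$ with $\mathcal{E}(u,\varphi)=\int_{\mathbb{R}^N} f(u)\varphi\,dx$ for every $\varphi\in\mathcal{C}_c^\infty(\mathbb{R}^N)$; $u$ is identified with its continuous representative. "$f(t)$ is non-increasing for nonnegative and small values of $t$" means that there is $t_0>0$ such that $f$ is non-increasing on $[0,t_0]$. "Radially decreasing with respect to a point $x_0$" means that $u$ is a strictly decreasing function of $|x-x_0|$. *)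

theory Defs
  imports "HOL-Analysis.Analysis"
begin

primrec C_k :: "nat \<Rightarrow> ('a::euclidean_space \<Rightarrow> real) \<Rightarrow> bool" where
  "C_k 0 f \<longleftrightarrow> continuous_on UNIV f"
| "C_k (Suc k) f \<longleftrightarrow> (\<forall>x. f differentiable (at x)) \<and>
     (\<forall>b\<in>Basis. C_k k (\<lambda>x. frechet_derivative f (at x) b))"

definition test_functions :: "('a::euclidean_space \<Rightarrow> real) set" where
  "test_functions = {\<phi>. (\<forall>k. C_k k \<phi>) \<and> compact (closure {x. \<phi> x \<noteq> 0})}"

text \<open>
  The parameter \<open>c\<close> is the normalization constant $c_{N,s}$. On the diagonal the integrand
  is \<open>0\<close> by the convention \<open>x / 0 = 0\<close>; the diagonal is a null set.
\<close>

definition energy_form ::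
    "real \<Rightarrow> real \<Rightarrow> ('a::euclidean_space \<Rightarrow> real) \<Rightarrow> ('a \<Rightarrow> real) \<Rightarrow> real" where
  "energy_form c s u v = c / 2 *
     (\<integral>(x, y). (u x - u y) * (v x - v y) / norm (x - y) powr (real DIM('a) + 2 * s)
        \<partial>(lborel \<Otimes>\<^sub>M lborel))"

definition energy_norm :: "real \<Rightarrow> real \<Rightarrow> ('a::euclidean_space \<Rightarrow> real) \<Rightarrow> real" where
  "energy_norm c s u = sqrt (energy_form c s u u)"

text \<open>
  The completion of the test functions, realized as a space of functions: \<open>u\<close> represents an
  element of the completion if it is the almost everywhere limit of a Cauchy sequence of test
  functions for the energy norm. For $N > 2s$ such a sequence converges in $L^{2N/(N-2s)}$ by the
  Sobolev inequality, so the almost everywhere limit is unique and every element of the completion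
  arises from some sequence of this kind. For $N \le 2s$ the elements of the completion are
  functions modulo additive constants, and the definition describes all their representatives;
  the energy form does not see the constant, and a condition such as \<open>u x \<longrightarrow> 0\<close> at infinity
  selects the representative.
\<close>

definition D_space :: "real \<Rightarrow> real \<Rightarrow> ('a::euclidean_space \<Rightarrow> real) set" where
  "D_space c s = {u. u \<in> borel_measurable borel \<and>
     (\<exists>\<phi>. (\<forall>n::nat. \<phi> n \<in> test_functions) \<and>
        (\<forall>e>0. \<exists>M. \<forall>m\<ge>M. \<forall>n\<ge>M. energy_norm c s (\<lambda>x. \<phi> m x - \<phi> n x) < e) \<and>
        (AE x in lborel. (\<lambda>n. \<phi> n x) \<longlonglongrightarrow> u x))}"

definition weak_solution ::
    "real \<Rightarrow> real \<Rightarrow> (real \<Rightarrow> real) \<Rightarrow> ('a::euclidean_space \<Rightarrow> real) \<Rightarrow> bool" where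
  "weak_solution c s f u \<longleftrightarrow> u \<in> D_space c s \<and>
     (\<forall>\<phi>\<in>test_functions. energy_form c s u \<phi> = (\<integral>x. f (u x) * \<phi> x \<partial>lborel))"

definition radially_decreasing_about :: "'a::euclidean_space \<Rightarrow> ('a \<Rightarrow> real) \<Rightarrow> bool" where
  "radially_decreasing_about x0 u \<longleftrightarrow>
     (\<exists>g::real \<Rightarrow> real. strict_antimono_on {0..} g \<and> (\<forall>x. u x = g (norm (x - x0))))"

end

theory Submission
  imports Defs
begin

text \<open>
  The proof runs the method of moving planes directly on the weak formulation. Let \<open>e\<close> be a unit vector, let
  \<open>x'\<close> be the mirror image of \<open>x\<close> in the hyperplane \<open>x \<bullet> e = l\<close>, and let \<open>w x = u x - u x'\<close> be the gap. To be
  shown is that \<open>w < 0\<close> in the half-space \<open>x \<bullet> e > l\<close> for all levels \<open>l\<close> above some \<open>l0\<close>, with symmetry at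
  \<open>l0\<close>.

  Since \<open>w\<close> is odd under the reflection, the energy of \<open>w\<close> against a function supported in the half-space
  folds onto that half-space, where the kernel at \<open>x - y\<close> exceeds the kernel at \<open>x - y'\<close>. Tested with the excess
  \<open>max 0 (w - \<epsilon>)\<close> in the half-space, the folded energy density is pointwise nonnegative
  (\<open>energy_excess_lower_bound\<close>). The excess has compact support in the open half-space, because \<open>w\<close> vanishes at
  infinity and on the hyperplane. The weak equation may be tested with it after mollification
  (\<open>weak_solution_test_continuous\<close>). Two maximum principles follow.

  In narrow regions (\<open>gap_nonpos_narrow\<close>): on a strip of width \<open>\<delta>\<close> along the hyperplane the reflected kernel
  alone yields a zero-order term with a coefficient of order \<open>\<delta> powr (- 2 * s)\<close>, which beats the
  Lipschitz constant of \<open>f\<close> for small \<open>\<delta>\<close>, while at points where \<open>u\<close> is small the monotonicity of \<open>f\<close> gives the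
  nonlinear term the right sign. So \<open>w \<le> 0\<close> as soon as every point of the half-space with \<open>w > 0\<close> lies in
  the strip or has a small value of \<open>u\<close>.

  The strong maximum principle (\<open>gap_strict\<close>): if \<open>w \<le> 0\<close> in the half-space and \<open>w\<close> vanishes at one of its
  points, then \<open>w = 0\<close>. Otherwise the values of \<open>w\<close> near a point where it is negative act through the difference
  of the kernels, and this is stronger than a small bump at the point of contact. The bump is a truncated
  paraboloid, whose second differences have the one-sided bound that makes its energy against the excess at
  most a constant times the integral of the excess (\<open>energy_form_semiconvex\<close>).

  The plane starts far out, where \<open>u\<close> is small in the whole half-space, and moves until the gap vanishes
  identically (\<open>symmetry_plane\<close>). A maximum point of \<open>u\<close> lies on the symmetry plane of every direction, and
  this gives radial symmetry (\<open>radially_decreasing\<close>).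
\<close>

section \<open>The kernel of the fractional Laplacian\<close>

definition kern :: "real \<Rightarrow> 'a::euclidean_space \<Rightarrow> real" where
  "kern s h = 1 / norm h powr (real DIM('a) + 2 * s)"

lemma kern_nonneg [simp]: "0 \<le> kern s h"
  by (simp add: kern_def)

lemma kern_zero [simp]: "kern s 0 = 0"
  by (simp add: kern_def)

lemma kern_minus [simp]: "kern s (- h) = kern s h"
  by (simp add: kern_def)

lemma kern_mono:
  fixes x y :: "'a::euclidean_space"
  assumes "0 < s" "x \<noteq> 0" "norm x \<le> norm y"
  shows "kern s y \<le> kern s x"
  using assms unfolding kern_def by (intro divide_left_mono powr_mono2 mult_pos_pos) auto

lemma kern_measurable [measurable]: "kern s \<in> borel_measurable borel"
  unfolding kern_def by measurable

lemma ennreal_suminf_finite: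
  fixes a :: "nat \<Rightarrow> real"
  assumes "summable a" "\<And>k. 0 \<le> a k"
  shows "(\<Sum>k. ennreal (a k)) < \<infinity>"
  using assms by (simp add: suminf_ennreal2)

text \<open>
  On the shell \<open>2^k \<le> |h| < 2^(k+1)\<close> the kernel is at most its value on the inner sphere. Together with the
  next lemma this bounds the integrand in \<open>nn_integral_kern\<close> by a series of multiples of indicators of
  balls.
\<close>

lemma kern_dyadic_far:
  fixes h :: "'a::euclidean_space"
  assumes "0 < s" "1 < norm h"
  obtains k :: nat where "kern s h \<le> 2 powr (- (real k * (real DIM('a) + 2 * s)))"
    "norm h \<le> 2 powr (real k + 1)"
proof -
  define p where "p = real DIM('a) + 2 * s"
  have p: "p > 0" using assms by (simp add: p_def add_nonneg_pos)
  \<comment> \<open>the shell that contains \<open>h\<close>\<close>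
  define k where "k = nat \<lfloor>log 2 (norm h)\<rfloor>"
  have "0 \<le> log 2 (norm h)" using assms by (subst zero_le_log_cancel_iff) auto
  hence k: "real k \<le> log 2 (norm h)" "log 2 (norm h) < real k + 1"
    unfolding k_def by linarith+
  have lo: "2 powr real k \<le> norm h"
    using k(1) assms by (subst (asm) le_log_iff) auto
  have hi: "norm h \<le> 2 powr (real k + 1)"
    using k(2) assms by (subst (asm) log_less_iff) auto
  have h: "h \<noteq> 0" using assms by auto
  have "(2 powr real k) powr p \<le> norm h powr p"
    by (intro powr_mono2) (use lo p in auto)
  hence "kern s h \<le> 1 / (2 powr real k) powr p"
    unfolding kern_def p_def[symmetric] using h by (intro divide_left_mono mult_pos_pos) auto
  also have "\<dots> = 2 powr (- (real k * p))"
    by (simp add: powr_powr powr_minus_divide)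
  finally show ?thesis using that hi p_def by blast
qed

lemma kern_dyadic_near:
  fixes h :: "'a::euclidean_space"
  assumes "0 < s" "0 < norm h" "norm h \<le> 1"
  obtains k :: nat where
    "(norm h)\<^sup>2 * kern s h \<le> 2 powr (- 2 * real k) * 2 powr ((real k + 1) * (real DIM('a) + 2 * s))"
    "norm h \<le> 2 powr (- real k)"
proof -
  define p where "p = real DIM('a) + 2 * s"
  have p: "p > 0" using assms by (simp add: p_def add_nonneg_pos)
  define k where "k = nat \<lfloor>- log 2 (norm h)\<rfloor>"
  have "log 2 (norm h) \<le> 0" using assms by (subst log_le_zero_cancel_iff) auto
  hence k: "log 2 (norm h) \<le> - real k" "- (real k + 1) < log 2 (norm h)"
    unfolding k_def by linarith+
  have hi: "norm h \<le> 2 powr (- real k)"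
    using k(1) assms by (subst (asm) log_le_iff) auto
  have lo: "2 powr (- (real k + 1)) \<le> norm h"
    using k(2) assms by (subst (asm) less_log_iff) auto
  have "(2 powr (- (real k + 1))) powr p \<le> norm h powr p"
    by (intro powr_mono2) (use lo p in auto)
  hence "kern s h \<le> 1 / (2 powr (- (real k + 1))) powr p"
    unfolding kern_def p_def[symmetric] using assms by (intro divide_left_mono) auto
  also have "(2 powr (- (real k + 1))) powr p = 2 powr (- ((real k + 1) * p))"
    by (simp only: powr_powr mult_minus_left)
  also have "1 / \<dots> = 2 powr ((real k + 1) * p)"
    by (simp only: powr_minus_divide) simp
  finally have 1: "kern s h \<le> 2 powr ((real k + 1) * p)" .
  have "(norm h)\<^sup>2 \<le> (2 powr (- real k))\<^sup>2"
    using hi by (intro power_mono) auto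
  also have "\<dots> = 2 powr (- 2 * real k)"
    by (simp add: power2_eq_square powr_add[symmetric])
  finally have "(norm h)\<^sup>2 * kern s h \<le> 2 powr (- 2 * real k) * 2 powr ((real k + 1) * p)"
    using 1 by (intro mult_mono) auto
  thus ?thesis using that hi p_def by blast
qed

text \<open>
  With \<open>N = DIM('a)\<close>, the dyadic shells contribute \<open>2 powr (- 2 * s * k)\<close> far from the origin, because
  volume grows like \<open>|h|^N\<close> and the kernel decays like \<open>|h|^(-N-2s)\<close>, and \<open>2 powr ((2 * s - 2) * k)\<close> near the
  origin, because of the factor \<open>|h|\<^sup>2\<close>. Both geometric series converge precisely because \<open>0 < s < 1\<close>.
\<close>

lemma nn_integral_kern:
  assumes s: "0 < s" "s < 1"
  shows "(\<integral>\<^sup>+ h. ennreal (min 1 ((norm (h::'a::euclidean_space))\<^sup>2) * kern s h) \<partial>lborel) < \<infinity>"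
proof -
  define n where "n = real DIM('a)"
  define p where "p = n + 2 * s"
  define V where "V = unit_ball_vol n"
  have V: "V \<ge> 0" unfolding V_def n_def by simp
  define a where "a k = 2 powr (- (real k * p))" for k :: nat
  define b where "b k = 2 powr (- 2 * real k) * 2 powr ((real k + 1) * p)" for k :: nat
  define A :: "nat \<Rightarrow> 'a set" where "A k = cball 0 (2 powr (real k + 1))" for k
  define B :: "nat \<Rightarrow> 'a set" where "B k = cball 0 (2 powr (- real k))" for k
  define g where "g k h = ennreal (a k) * indicator (A k) h + ennreal (b k) * indicator (B k) h" for k h
  have [measurable]: "A k \<in> sets borel" "B k \<in> sets borel" for k
    by (auto simp: A_def B_def)
  have bound: "ennreal (min 1 ((norm h)\<^sup>2) * kern s h) \<le> (\<Sum>k. g k h)" for h :: 'a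
  proof -
    have le: "g k h \<le> (\<Sum>k. g k h)" for k
      using sum_le_suminf[of "\<lambda>k. g k h" "{k}"] by simp
    consider "h = 0" | "1 < norm h" | "0 < norm h" "norm h \<le> 1" by fastforce
    thus ?thesis
    proof cases
      case 1 thus ?thesis by simp
    next
      case 2
      from kern_dyadic_far[OF s(1) 2] obtain k where k: "kern s h \<le> a k" "norm h \<le> 2 powr (real k + 1)"
        unfolding a_def p_def n_def by blast
      have "min 1 ((norm h)\<^sup>2) * kern s h \<le> 1 * kern s h"
        by (intro mult_right_mono) auto
      hence "ennreal (min 1 ((norm h)\<^sup>2) * kern s h) \<le> ennreal (a k)"
        using k by (intro ennreal_leI) simp
      also have "\<dots> \<le> g k h" using k by (simp add: g_def A_def)
      finally show ?thesis using le order_trans by blast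
    next
      case 3
      from kern_dyadic_near[OF s(1) 3] obtain k where k: "(norm h)\<^sup>2 * kern s h \<le> b k" "norm h \<le> 2 powr (- real k)"
        unfolding b_def p_def n_def by blast
      have "min 1 ((norm h)\<^sup>2) * kern s h \<le> (norm h)\<^sup>2 * kern s h"
        by (intro mult_right_mono) auto
      hence "ennreal (min 1 ((norm h)\<^sup>2) * kern s h) \<le> ennreal (b k)"
        using k by (intro ennreal_leI) simp
      also have "\<dots> \<le> g k h" using k by (simp add: g_def B_def)
      finally show ?thesis using le order_trans by blast
    qed
  qed
  have emb: "emeasure lborel (cball (0::'a) r) = ennreal (V * r powr n)" if "r > 0" for r
    using that emeasure_cball[of r "0::'a"] by (simp add: V_def n_def powr_realpow)
  have gk: "(\<integral>\<^sup>+ h. g k h \<partial>lborel) = ennreal (V * 2 powr n * (2 powr (- 2 * s)) ^ k + V * 2 powr p * (2 powr (2 * s - 2)) ^ k)" for k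
  proof -
    have "(\<integral>\<^sup>+ h. g k h \<partial>lborel) = ennreal (a k) * emeasure lborel (A k) + ennreal (b k) * emeasure lborel (B k)"
      unfolding g_def by (subst nn_integral_add) (simp_all add: nn_integral_cmult_indicator)
    also have "\<dots> = ennreal (a k * (V * (2 powr (real k + 1)) powr n)) + ennreal (b k * (V * (2 powr (- real k)) powr n))"
      using V unfolding A_def B_def by (subst (1 2) emb) (auto simp: ennreal_mult' a_def b_def)
    also have "a k * (V * (2 powr (real k + 1)) powr n) = V * 2 powr n * (2 powr (- 2 * s)) ^ k"
      unfolding a_def p_def
      by (simp add: powr_powr powr_realpow[symmetric] powr_add[symmetric] algebra_simps)
    also have "b k * (V * (2 powr (- real k)) powr n) = V * 2 powr p * (2 powr (2 * s - 2)) ^ k"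
      unfolding b_def p_def
      by (simp add: powr_powr powr_realpow[symmetric] powr_add[symmetric] algebra_simps)
    finally show ?thesis using V by (simp add: ennreal_plus[symmetric] del: ennreal_plus)
  qed
  have "(\<integral>\<^sup>+ h. ennreal (min 1 ((norm (h::'a))\<^sup>2) * kern s h) \<partial>lborel) \<le> (\<integral>\<^sup>+ h. (\<Sum>k. g k h) \<partial>lborel)"
    by (intro nn_integral_mono bound)
  also have "\<dots> = (\<Sum>k. \<integral>\<^sup>+ h. g k h \<partial>lborel)"
    by (intro nn_integral_suminf) (simp add: g_def)
  also have "\<dots> < \<infinity>"
    unfolding gk
  proof (rule ennreal_suminf_finite)
    have 1: "(2::real) powr (- 2 * s) < 1" "(2::real) powr (2 * s - 2) < 1"
      using s by (auto simp: powr_less_one)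
    show "summable (\<lambda>k. V * 2 powr n * (2 powr (- 2 * s)) ^ k + V * 2 powr p * (2 powr (2 * s - 2)) ^ k)"
      using 1 by (intro summable_add summable_mult summable_geometric) auto
  qed (use V in auto)
  finally show ?thesis .
qed

lemma kern_integrable:
  assumes s: "0 < s" "s < 1"
  shows "integrable lborel (\<lambda>h::'a::euclidean_space. min 1 ((norm h)\<^sup>2) * kern s h)"
  by (rule integrableI_bounded) (use nn_integral_kern[OF s] in \<open>auto simp: abs_mult\<close>)

section \<open>Translations and point reflections\<close>

lemma lborel_distr_translate: "distr lborel borel (\<lambda>x::'a::euclidean_space. a + x) = lborel"
  by (rule lborel_distr_plus)

lemma lborel_distr_point_reflect: "distr lborel borel (\<lambda>x::'a::euclidean_space. a - x) = lborel"
  using lborel_affine[of "-1" a] by (simp add: density_1)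

lemma nn_integral_translate:
  fixes f :: "'a::euclidean_space \<Rightarrow> ennreal"
  assumes [measurable]: "f \<in> borel_measurable borel"
  shows "(\<integral>\<^sup>+ x. f (a + x) \<partial>lborel) = (\<integral>\<^sup>+ x. f x \<partial>lborel)"
    and "(\<integral>\<^sup>+ x. f (x + a) \<partial>lborel) = (\<integral>\<^sup>+ x. f x \<partial>lborel)"
    and "(\<integral>\<^sup>+ x. f (a - x) \<partial>lborel) = (\<integral>\<^sup>+ x. f x \<partial>lborel)"
    and "(\<integral>\<^sup>+ x. f (x - a) \<partial>lborel) = (\<integral>\<^sup>+ x. f x \<partial>lborel)"
proof -
  have *: "(\<integral>\<^sup>+ x. f (a + x) \<partial>lborel) = (\<integral>\<^sup>+ x. f x \<partial>lborel)" for a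
    by (subst lborel_distr_translate[of a, symmetric], subst nn_integral_distr) auto
  show "(\<integral>\<^sup>+ x. f (a + x) \<partial>lborel) = (\<integral>\<^sup>+ x. f x \<partial>lborel)"
    and "(\<integral>\<^sup>+ x. f (x + a) \<partial>lborel) = (\<integral>\<^sup>+ x. f x \<partial>lborel)"
    and "(\<integral>\<^sup>+ x. f (x - a) \<partial>lborel) = (\<integral>\<^sup>+ x. f x \<partial>lborel)"
    using *[of a] *[of "-a"] by (simp_all add: add.commute)
  show "(\<integral>\<^sup>+ x. f (a - x) \<partial>lborel) = (\<integral>\<^sup>+ x. f x \<partial>lborel)"
    by (subst (2) lborel_distr_point_reflect[of a, symmetric], subst nn_integral_distr) auto
qed

lemma integrable_translate:
  fixes f :: "'a::euclidean_space \<Rightarrow> real"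
  shows "integrable lborel f \<Longrightarrow> integrable lborel (\<lambda>x. f (x + a))"
    and "integrable lborel f \<Longrightarrow> integrable lborel (\<lambda>x. f (a - x))"
proof -
  have *: "integrable lborel (f \<circ> T)" if "distr lborel borel T = (lborel :: 'a measure)" "T \<in> borel_measurable borel" "integrable lborel f" for T
    using integrable_distr[of T lborel borel f] that by (simp add: o_def)
  show "integrable lborel f \<Longrightarrow> integrable lborel (\<lambda>x. f (x + a))"
    using *[OF lborel_distr_translate[of a]] by (simp add: o_def add.commute)
  show "integrable lborel f \<Longrightarrow> integrable lborel (\<lambda>x. f (a - x))"
    using *[OF lborel_distr_point_reflect[of a]] by (simp add: o_def)
qed

lemma integral_translate:
  fixes f :: "'a::euclidean_space \<Rightarrow> real"
  assumes [measurable]: "f \<in> borel_measurable borel"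
  shows "(\<integral>x. f (x + a) \<partial>lborel) = (\<integral>x. f x \<partial>lborel)"
    and "(\<integral>x. f (a - x) \<partial>lborel) = (\<integral>x. f x \<partial>lborel)"
proof -
  show "(\<integral>x. f (x + a) \<partial>lborel) = (\<integral>x. f x \<partial>lborel)"
    by (subst (2) lborel_distr_translate[of a, symmetric], subst integral_distr) (auto simp: add.commute)
  show "(\<integral>x. f (a - x) \<partial>lborel) = (\<integral>x. f x \<partial>lborel)"
    by (subst (2) lborel_distr_point_reflect[of a, symmetric], subst integral_distr) auto
qed

section \<open>Functions of finite energy\<close>

abbreviation lborel2 :: "('a::euclidean_space \<times> 'a) measure" where
  "lborel2 \<equiv> lborel \<Otimes>\<^sub>M lborel"

text \<open>
  With the square root of the kernel split off, the energy form becomes the inner product of difference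
  quotients in \<open>L\<^sup>2\<close> of the product space, and finite energy means that the quotient is square integrable.
\<close>

definition dq :: "real \<Rightarrow> ('a::euclidean_space \<Rightarrow> real) \<Rightarrow> 'a \<times> 'a \<Rightarrow> real" where
  "dq s u z = (u (fst z) - u (snd z)) * sqrt (kern s (fst z - snd z))"

lemma dq_mult: "dq s u z * dq s v z = (u (fst z) - u (snd z)) * (v (fst z) - v (snd z)) * kern s (fst z - snd z)"
proof -
  have "sqrt (kern s (fst z - snd z)) * sqrt (kern s (fst z - snd z)) = kern s (fst z - snd z)" by simp
  hence "a * sqrt (kern s (fst z - snd z)) * (b * sqrt (kern s (fst z - snd z))) = a * b * kern s (fst z - snd z)" for a b
    by (metis (no_types, opaque_lifting) mult.assoc mult.commute)
  thus ?thesis unfolding dq_def .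
qed

lemma dq_power2: "(dq s u z)\<^sup>2 = (u (fst z) - u (snd z))\<^sup>2 * kern s (fst z - snd z)"
  by (simp add: dq_def power_mult_distrib)

lemma dq_diff: "dq s (\<lambda>x. u x - v x) z = dq s u z - dq s v z"
  and dq_add: "dq s (\<lambda>x. u x + v x) z = dq s u z + dq s v z"
  and dq_cmult: "dq s (\<lambda>x. a * u x) z = a * dq s u z"
  by (simp_all add: dq_def algebra_simps)

lemma dq_measurable [measurable (raw)]:
  fixes u :: "'a::euclidean_space \<Rightarrow> real"
  assumes [measurable]: "u \<in> borel_measurable borel"
  shows "dq s u \<in> borel_measurable lborel2"
  unfolding dq_def[abs_def] by measurable

lemma energy_form_dq:
  "energy_form c s u v = c / 2 * (\<integral>z. dq s u z * dq s v z \<partial>lborel2)"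
  unfolding energy_form_def dq_mult kern_def by (simp add: case_prod_beta')

definition finite_energy :: "real \<Rightarrow> ('a::euclidean_space \<Rightarrow> real) \<Rightarrow> bool" where
  "finite_energy s u \<longleftrightarrow> u \<in> borel_measurable borel \<and>
     integrable lborel2 (\<lambda>z. (dq s u z)\<^sup>2)"

lemma finite_energy_measurable [measurable_dest]:
  "finite_energy s u \<Longrightarrow> u \<in> borel_measurable borel"
  by (simp add: finite_energy_def)

lemma integrable_mult_L2:
  fixes f g :: "'b \<Rightarrow> real"
  assumes [measurable]: "f \<in> borel_measurable M" "g \<in> borel_measurable M"
    and "integrable M (\<lambda>x. (f x)\<^sup>2)" "integrable M (\<lambda>x. (g x)\<^sup>2)"
  shows "integrable M (\<lambda>x. f x * g x)"
proof (rule Bochner_Integration.integrable_bound)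
  show "integrable M (\<lambda>x. (f x)\<^sup>2 + (g x)\<^sup>2)" using assms by simp
  have "\<bar>a * b\<bar> \<le> a\<^sup>2 + b\<^sup>2" for a b :: real
    using sum_squares_bound[of "\<bar>a\<bar>" "\<bar>b\<bar>"] zero_le_power2[of a] zero_le_power2[of b] unfolding abs_mult power2_abs by linarith
  thus "AE x in M. norm (f x * g x) \<le> norm ((f x)\<^sup>2 + (g x)\<^sup>2)" by simp
qed simp

lemma finite_energy_integrable_mult:
  assumes "finite_energy s u" "finite_energy s v"
  shows "integrable lborel2 (\<lambda>z. dq s u z * dq s v z)"
  using assms by (intro integrable_mult_L2) (auto simp: finite_energy_def)

lemma finite_energy_nnI:
  assumes [measurable]: "u \<in> borel_measurable borel"
    and "(\<integral>\<^sup>+ z. ennreal ((dq s u z)\<^sup>2) \<partial>lborel2) < \<infinity>"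
  shows "finite_energy s u"
  unfolding finite_energy_def using assms by (auto intro!: integrableI_bounded)

lemma finite_energy_nnD:
  assumes "finite_energy s u"
  shows "(\<integral>\<^sup>+ z. ennreal ((dq s u z)\<^sup>2) \<partial>lborel2) = ennreal (\<integral>z. (dq s u z)\<^sup>2 \<partial>lborel2)"
  using assms unfolding finite_energy_def by (intro nn_integral_eq_integral) auto

lemma finite_energy_cmult: "finite_energy s u \<Longrightarrow> finite_energy s (\<lambda>x. a * u x)"
  unfolding finite_energy_def dq_cmult by (auto simp: power_mult_distrib)

lemma finite_energy_add:
  assumes "finite_energy s u" "finite_energy s v"
  shows "finite_energy s (\<lambda>x. u x + v x)"
  using finite_energy_integrable_mult[OF assms] assms
  unfolding finite_energy_def dq_add power2_sum by (auto simp: mult.assoc)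

lemma finite_energy_diff:
  assumes "finite_energy s u" "finite_energy s v"
  shows "finite_energy s (\<lambda>x. u x - v x)"
  using finite_energy_add[OF assms(1) finite_energy_cmult[OF assms(2), of "-1"]] by simp

lemma energy_form_diff_left:
  assumes "finite_energy s u" "finite_energy s v" "finite_energy s w"
  shows "energy_form c s (\<lambda>x. u x - v x) w = energy_form c s u w - energy_form c s v w"
  using assms[THEN finite_energy_integrable_mult, OF assms(3)]
  unfolding energy_form_dq dq_diff by (simp add: algebra_simps)

lemma energy_form_add_left:
  assumes "finite_energy s u" "finite_energy s v" "finite_energy s w"
  shows "energy_form c s (\<lambda>x. u x + v x) w = energy_form c s u w + energy_form c s v w"
  using assms[THEN finite_energy_integrable_mult, OF assms(3)]
  unfolding energy_form_dq dq_add by (simp add: algebra_simps)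

lemma energy_form_cmult_left:
  "energy_form c s (\<lambda>x. a * u x) w = a * energy_form c s u w"
  unfolding energy_form_dq dq_cmult by (simp add: mult.assoc)

text \<open>
  The majorant behind \<open>finite_energy_compare\<close>: it dominates both Lipschitz differences near the
  diagonal and bounded differences away from it, provided one of the two points lies in a bounded set.
\<close>

lemma nn_integral_kern_strip:
  fixes B :: "'a::euclidean_space set"
  assumes s: "0 < s" "s < 1" and B [measurable]: "B \<in> sets borel" and bB: "bounded B"
  shows "(\<integral>\<^sup>+ z. ennreal (min 1 ((norm (fst z - snd z))\<^sup>2) * kern s (fst z - snd z)) *
            (indicator B (fst z) + indicator B (snd z)) \<partial>lborel2) < \<infinity>"
proof -
  define k where "k h = ennreal (min 1 ((norm h)\<^sup>2) * kern s h)" for h :: 'a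
  have [measurable]: "k \<in> borel_measurable borel" unfolding k_def by measurable
  define J where "J = (\<integral>\<^sup>+ h. k h \<partial>lborel)"
  have J: "J < \<infinity>" unfolding J_def k_def by (rule nn_integral_kern[OF s])
  have Bfin: "emeasure lborel B < \<infinity>" using bB by (rule emeasure_bounded_finite)
  have 1: "(\<integral>\<^sup>+ z. k (fst z - snd z) * indicator B (fst z) \<partial>lborel2) = J * emeasure lborel B"
  proof -
    have "(\<integral>\<^sup>+ z. k (fst z - snd z) * indicator B (fst z) \<partial>lborel2)
      = (\<integral>\<^sup>+ x. \<integral>\<^sup>+ y. k (x - y) * indicator B x \<partial>lborel \<partial>lborel)"
      by (subst lborel.nn_integral_fst[symmetric]) auto
    also have "\<dots> = (\<integral>\<^sup>+ x. J * indicator B x \<partial>lborel)"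
      by (simp add: nn_integral_multc nn_integral_translate J_def)
    finally show ?thesis by (simp add: nn_integral_cmult_indicator)
  qed
  have 2: "(\<integral>\<^sup>+ z. k (fst z - snd z) * indicator B (snd z) \<partial>lborel2) = J * emeasure lborel B"
  proof -
    have "(\<integral>\<^sup>+ z. k (fst z - snd z) * indicator B (snd z) \<partial>lborel2)
      = (\<integral>\<^sup>+ y. \<integral>\<^sup>+ x. k (x - y) * indicator B y \<partial>lborel \<partial>lborel)"
      by (subst lborel_pair.nn_integral_snd[symmetric]) auto
    also have "\<dots> = (\<integral>\<^sup>+ x. J * indicator B x \<partial>lborel)"
      by (simp add: nn_integral_multc nn_integral_translate J_def)
    finally show ?thesis by (simp add: nn_integral_cmult_indicator)
  qed
  have "(\<integral>\<^sup>+ z. k (fst z - snd z) * (indicator B (fst z) + indicator B (snd z)) \<partial>lborel2)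
    = J * emeasure lborel B + J * emeasure lborel B"
    unfolding distrib_left by (subst nn_integral_add) (simp_all add: 1 2)
  also have "\<dots> < \<infinity>" using J Bfin by (simp add: ennreal_mult_less_top)
  finally show ?thesis unfolding k_def .
qed

text \<open>
  For \<open>v = 0\<close> this applies to compactly supported Lipschitz functions; for the excess of an odd function
  over a half-space, \<open>v\<close> is the odd function itself.
\<close>

lemma finite_energy_compare:
  fixes u v :: "'a::euclidean_space \<Rightarrow> real"
  assumes s: "0 < s" "s < 1" and u [measurable]: "u \<in> borel_measurable borel"
    and v: "finite_energy s v" and "bounded B" "B \<in> sets borel" and C: "0 \<le> C"
    and le: "\<And>x y. (u x - u y)\<^sup>2 \<le> (v x - v y)\<^sup>2 + C * min 1 ((norm (x - y))\<^sup>2) * (indicator B x + indicator B y)"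
  shows "finite_energy s u"
proof (rule finite_energy_nnI[OF u])
  note [measurable] = v \<open>B \<in> sets borel\<close>
  have "(dq s u z)\<^sup>2 \<le> (dq s v z)\<^sup>2 + C * (min 1 ((norm (fst z - snd z))\<^sup>2) * kern s (fst z - snd z) * (indicator B (fst z) + indicator B (snd z)))" for z
    using mult_right_mono[OF le[of "fst z" "snd z"], of "kern s (fst z - snd z)"]
    unfolding dq_power2 by (simp add: algebra_simps)
  hence "ennreal ((dq s u z)\<^sup>2) \<le> ennreal ((dq s v z)\<^sup>2 + C * (min 1 ((norm (fst z - snd z))\<^sup>2) * kern s (fst z - snd z) * (indicator B (fst z) + indicator B (snd z))))" for z
    by (rule ennreal_leI)
  also have "\<dots> z = ennreal ((dq s v z)\<^sup>2) + ennreal C * (ennreal (min 1 ((norm (fst z - snd z))\<^sup>2) * kern s (fst z - snd z)) *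
            (indicator B (fst z) + indicator B (snd z)))" for z
    using C by (auto simp: ennreal_mult' ennreal_plus indicator_def)
  finally have "(\<integral>\<^sup>+ z. ennreal ((dq s u z)\<^sup>2) \<partial>lborel2) \<le> 
    (\<integral>\<^sup>+ z. ennreal ((dq s v z)\<^sup>2) + ennreal C * (ennreal (min 1 ((norm (fst z - snd z))\<^sup>2) * kern s (fst z - snd z)) *
            (indicator B (fst z) + indicator B (snd z))) \<partial>lborel2)"
    by (rule nn_integral_mono)
  also have "\<dots> = (\<integral>\<^sup>+ z. ennreal ((dq s v z)\<^sup>2) \<partial>lborel2) + ennreal C * 
     (\<integral>\<^sup>+ z. ennreal (min 1 ((norm (fst z - snd z))\<^sup>2) * kern s (fst z - snd z)) *
            (indicator B (fst z) + indicator B (snd z)) \<partial>lborel2)"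
    by (subst nn_integral_add, simp, measurable, subst nn_integral_cmult) auto
  also have "\<dots> < \<infinity>"
    using nn_integral_kern_strip[OF s \<open>B \<in> sets borel\<close> \<open>bounded B\<close>] finite_energy_nnD[OF v]
    by (simp add: ennreal_mult_less_top)
  finally show "(\<integral>\<^sup>+ z. ennreal ((dq s u z)\<^sup>2) \<partial>lborel2) < \<infinity>" .
qed

lemma finite_energy_zero: "finite_energy s (\<lambda>_. 0)"
  by (auto intro: finite_energy_nnI simp: dq_def)

text \<open>
  The partial derivatives are continuous, hence bounded on the ball; their sum bounds the operator norm of
  the derivative, and the mean value inequality applies because a ball is convex.
\<close>

lemma C_1_lipschitz_on_ball:
  fixes \<phi> :: "'a::euclidean_space \<Rightarrow> real"
  assumes "C_k 1 \<phi>"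
  obtains L where "L \<ge> 0" "\<And>x y. x \<in> cball 0 R \<Longrightarrow> y \<in> cball 0 R \<Longrightarrow> \<bar>\<phi> x - \<phi> y\<bar> \<le> L * norm (x - y)"
proof -
  have d: "\<And>x. \<phi> differentiable (at x)"
    and c: "\<And>b. b \<in> Basis \<Longrightarrow> continuous_on UNIV (\<lambda>x. frechet_derivative \<phi> (at x) b)"
    using assms by auto
  have "\<exists>M. \<forall>x\<in>cball 0 R. \<bar>frechet_derivative \<phi> (at x) b\<bar> \<le> M" if "b \<in> Basis" for b
  proof -
    have "compact ((\<lambda>x. frechet_derivative \<phi> (at x) b) ` cball 0 R)"
      using c[OF that] by (intro compact_continuous_image) (auto intro: continuous_on_subset)
    from compact_imp_bounded[OF this] show ?thesis
      unfolding bounded_iff by auto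
  qed
  then obtain M where M: "\<And>b x. b \<in> Basis \<Longrightarrow> x \<in> cball 0 R \<Longrightarrow> \<bar>frechet_derivative \<phi> (at x) b\<bar> \<le> M b"
    by metis
  define L where "L = (\<Sum>b\<in>(Basis::'a set). \<bar>M b\<bar>)"
  have on: "onorm (frechet_derivative \<phi> (at x)) \<le> L" if x: "x \<in> cball 0 R" for x
  proof (rule onorm_bound)
    show "L \<ge> 0" by (auto simp: L_def intro: sum_nonneg)
    fix h :: 'a
    interpret D: linear "frechet_derivative \<phi> (at x)" by (rule linear_frechet_derivative[OF d])
    have "frechet_derivative \<phi> (at x) h = frechet_derivative \<phi> (at x) (\<Sum>b\<in>Basis. (h \<bullet> b) *\<^sub>R b)"
      by (simp add: euclidean_representation)
    also have "\<dots> = (\<Sum>b\<in>Basis. (h \<bullet> b) * frechet_derivative \<phi> (at x) b)"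
      by (simp add: D.sum D.scaleR)
    finally have "norm (frechet_derivative \<phi> (at x) h) \<le> (\<Sum>b\<in>Basis. \<bar>(h \<bullet> b) * frechet_derivative \<phi> (at x) b\<bar>)"
      by simp
    also have "\<dots> \<le> (\<Sum>b\<in>Basis. norm h * \<bar>M b\<bar>)"
      unfolding abs_mult using M[OF _ x] Basis_le_norm[of _ h]
      by (intro sum_mono mult_mono) (auto intro: order_trans[OF _ abs_ge_self])
    finally show "norm (frechet_derivative \<phi> (at x) h) \<le> L * norm h"
      by (simp add: L_def sum_distrib_left[symmetric] mult.commute)
  qed
  show ?thesis
  proof (rule that[of L])
    show "L \<ge> 0" by (auto simp: L_def intro: sum_nonneg)
    fix x y :: 'a assume "x \<in> cball 0 R" "y \<in> cball 0 R"
    thus "\<bar>\<phi> x - \<phi> y\<bar> \<le> L * norm (x - y)"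
      using differentiable_bound[of "cball 0 R" \<phi> "\<lambda>x. frechet_derivative \<phi> (at x)" L x y] on d
      by (auto simp: frechet_derivative_works intro: has_derivative_at_withinI)
  qed
qed

lemma finite_energy_lipschitz:
  fixes \<phi> :: "'a::euclidean_space \<Rightarrow> real"
  assumes s: "0 < s" "s < 1" and "continuous_on UNIV \<phi>"
    and supp: "{x. \<phi> x \<noteq> 0} \<subseteq> cball 0 R" and bd: "\<And>x. \<bar>\<phi> x\<bar> \<le> M"
    and lip: "\<And>x y. x \<in> cball 0 (R + 1) \<Longrightarrow> y \<in> cball 0 (R + 1) \<Longrightarrow> \<bar>\<phi> x - \<phi> y\<bar> \<le> L * norm (x - y)"
  shows "finite_energy s \<phi>"
proof (rule finite_energy_compare[OF s _ finite_energy_zero, of _ "cball 0 R" "L\<^sup>2 + (2 * M)\<^sup>2"])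
  show "\<phi> \<in> borel_measurable borel" using assms by (intro borel_measurable_continuous_onI)
  fix x y :: 'a
  have M: "0 \<le> M" using bd[of 0] by simp
  show "(\<phi> x - \<phi> y)\<^sup>2 \<le> (0 - 0)\<^sup>2 + (L\<^sup>2 + (2 * M)\<^sup>2) * min 1 ((norm (x - y))\<^sup>2) * (indicator (cball 0 R) x + indicator (cball 0 R) y)"
  proof (cases "x \<in> cball 0 R \<or> y \<in> cball 0 R")
    case False
    hence "\<phi> x = 0" "\<phi> y = 0" using supp by auto
    thus ?thesis using False by simp
  next
    case True
    have *: "(\<phi> x - \<phi> y)\<^sup>2 \<le> (L\<^sup>2 + (2 * M)\<^sup>2) * min 1 ((norm (x - y))\<^sup>2)"
    proof (cases "norm (x - y) \<le> 1")
      case T: True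
      have "norm x \<le> norm y + norm (x - y)" "norm y \<le> norm x + norm (x - y)"
        using norm_triangle_sub norm_triangle_sub[of y x] by (auto simp: norm_minus_commute)
      hence "x \<in> cball 0 (R + 1)" "y \<in> cball 0 (R + 1)" using True T by auto
      from power_mono[OF lip[OF this], of 2] have "(\<phi> x - \<phi> y)\<^sup>2 \<le> L\<^sup>2 * (norm (x - y))\<^sup>2"
        by (simp add: power_mult_distrib)
      also have "\<dots> \<le> (L\<^sup>2 + (2 * M)\<^sup>2) * (norm (x - y))\<^sup>2" by (intro mult_right_mono) auto
      finally have "(\<phi> x - \<phi> y)\<^sup>2 \<le> (L\<^sup>2 + (2 * M)\<^sup>2) * (norm (x - y))\<^sup>2" .
      moreover have "min 1 ((norm (x - y))\<^sup>2) = (norm (x - y))\<^sup>2"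
        using T by (intro min_absorb2) (simp add: power_le_one)
      ultimately show ?thesis by simp
    next
      case F: False
      have "\<bar>\<phi> x - \<phi> y\<bar> \<le> 2 * M" using bd[of x] bd[of y] by linarith
      from power_mono[OF this, of 2] have "(\<phi> x - \<phi> y)\<^sup>2 \<le> (2 * M)\<^sup>2" by simp
      hence "(\<phi> x - \<phi> y)\<^sup>2 \<le> (L\<^sup>2 + (2 * M)\<^sup>2) * 1"
        unfolding mult_1_right by (intro add_increasing zero_le_power2)
      moreover have "min 1 ((norm (x - y))\<^sup>2) = 1" using F by (simp add: min_def)
      ultimately show ?thesis by simp
    qed
    also have "\<dots> \<le> (L\<^sup>2 + (2 * M)\<^sup>2) * min 1 ((norm (x - y))\<^sup>2) * (indicator (cball 0 R) x + indicator (cball 0 R) y)"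
    proof -
      have "(1::real) \<le> indicator (cball 0 R) x + indicator (cball 0 R) y" using True by (auto simp: indicator_def)
      thus ?thesis using mult_left_mono[of 1 "indicator (cball 0 R) x + indicator (cball 0 R) y" "(L\<^sup>2 + (2 * M)\<^sup>2) * min 1 ((norm (x - y))\<^sup>2)"]
        by simp
    qed
    finally show ?thesis by simp
  qed
qed auto

lemma test_functionsD:
  fixes \<phi> :: "'a::euclidean_space \<Rightarrow> real"
  assumes "\<phi> \<in> test_functions"
  obtains R where "continuous_on UNIV \<phi>" "C_k 1 \<phi>" "{x. \<phi> x \<noteq> 0} \<subseteq> cball 0 R"
proof -
  have a: "\<And>k. C_k k \<phi>" "compact (closure {x. \<phi> x \<noteq> 0})"
    using assms by (auto simp: test_functions_def)
  hence "bounded {x. \<phi> x \<noteq> 0}" by (meson bounded_subset closure_subset compact_imp_bounded)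
  then obtain R where "\<forall>x\<in>{x. \<phi> x \<noteq> 0}. norm x \<le> R"
    unfolding bounded_iff by blast
  hence "{x. \<phi> x \<noteq> 0} \<subseteq> cball 0 R" by auto
  moreover have "continuous_on UNIV \<phi>" using a(1)[of 0] by simp
  ultimately show ?thesis using that a(1) by blast
qed

lemma continuous_supp_bounded:
  fixes \<phi> :: "'a::euclidean_space \<Rightarrow> real"
  assumes "continuous_on UNIV \<phi>" "{x. \<phi> x \<noteq> 0} \<subseteq> cball 0 R"
  obtains M where "\<And>x. \<bar>\<phi> x\<bar> \<le> M"
proof -
  have "compact (\<phi> ` cball 0 R)" using assms by (intro compact_continuous_image) (auto intro: continuous_on_subset)
  from compact_imp_bounded[OF this] obtain M where M: "\<forall>x\<in>cball 0 R. \<bar>\<phi> x\<bar> \<le> M"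
    unfolding bounded_iff by fastforce
  have "\<bar>\<phi> x\<bar> \<le> \<bar>M\<bar>" for x
  proof (cases "x \<in> cball 0 R")
    case True
    hence "\<bar>\<phi> x\<bar> \<le> M" using M by blast
    thus ?thesis by linarith
  next
    case False
    hence "\<phi> x = 0" using assms(2) by blast
    thus ?thesis by simp
  qed
  thus ?thesis using that by blast
qed

lemma finite_energy_test_function:
  fixes \<phi> :: "'a::euclidean_space \<Rightarrow> real"
  assumes s: "0 < s" "s < 1" and "\<phi> \<in> test_functions"
  shows "finite_energy s \<phi>"
proof -
  from test_functionsD[OF assms(3)] obtain R where R: "continuous_on UNIV \<phi>" "C_k 1 \<phi>" "{x. \<phi> x \<noteq> 0} \<subseteq> cball 0 R" by blast
  from continuous_supp_bounded[OF R(1,3)] obtain M where M: "\<And>x. \<bar>\<phi> x\<bar> \<le> M" by blast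
  from C_1_lipschitz_on_ball[OF R(2)] obtain L where
   "\<And>x y. x \<in> cball 0 (R+1) \<Longrightarrow> y \<in> cball 0 (R+1) \<Longrightarrow> \<bar>\<phi> x - \<phi> y\<bar> \<le> L * norm (x - y)" by metis
  from finite_energy_lipschitz[OF s R(1,3) M this] show ?thesis by blast
qed

lemma AE_pair_lborel:
  fixes P :: "'a::euclidean_space \<Rightarrow> bool"
  assumes "AE x in lborel. P x"
  shows "AE z in lborel2. P (fst z) \<and> P (snd z)"
proof -
  from AE_E[OF assms] obtain N where N: "{x. \<not> P x} \<subseteq> N" "emeasure lborel N = 0" "N \<in> sets lborel" by auto
  have "N \<times> UNIV \<in> null_sets lborel2" "UNIV \<times> N \<in> null_sets lborel2"
    using N lborel.emeasure_pair_measure_Times[of N lborel "UNIV"] lborel.emeasure_pair_measure_Times[of UNIV lborel N]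
    by (auto intro!: null_setsI)
  hence "(N \<times> UNIV) \<union> (UNIV \<times> N) \<in> null_sets lborel2" by blast
  thus ?thesis by (rule AE_I') (use N in auto)
qed

text \<open>
  Almost everywhere convergence of functions gives almost everywhere convergence of their difference
  quotients on the product space, so lower semicontinuity is Fatou's lemma.
\<close>

lemma finite_energy_Fatou:
  fixes u :: "'a::euclidean_space \<Rightarrow> real"
  assumes u [measurable]: "u \<in> borel_measurable borel"
    and fe: "\<And>n. finite_energy s (\<phi> n)"
    and lim: "AE x in lborel. (\<lambda>n. \<phi> n x) \<longlonglongrightarrow> u x"
    and bd: "\<And>n. (\<integral>z. (dq s (\<phi> n) z)\<^sup>2 \<partial>lborel2) \<le> C"
  shows "finite_energy s u"
proof (rule finite_energy_nnI[OF u])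
  note [measurable] = fe
  have "AE z in lborel2. ennreal ((dq s u z)\<^sup>2) = liminf (\<lambda>n. ennreal ((dq s (\<phi> n) z)\<^sup>2))"
    using AE_pair_lborel[OF lim]
  proof eventually_elim
    case (elim z)
    hence "(\<lambda>n. ennreal ((dq s (\<phi> n) z)\<^sup>2)) \<longlonglongrightarrow> ennreal ((dq s u z)\<^sup>2)"
      unfolding dq_def by (intro tendsto_intros) auto
    thus ?case by (rule lim_imp_Liminf[OF sequentially_bot, symmetric])
  qed
  hence "(\<integral>\<^sup>+ z. ennreal ((dq s u z)\<^sup>2) \<partial>lborel2) = (\<integral>\<^sup>+ z. liminf (\<lambda>n. ennreal ((dq s (\<phi> n) z)\<^sup>2)) \<partial>lborel2)"
    by (rule nn_integral_cong_AE)
  also have "\<dots> \<le> liminf (\<lambda>n. \<integral>\<^sup>+ z. ennreal ((dq s (\<phi> n) z)\<^sup>2) \<partial>lborel2)"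
    by (intro nn_integral_liminf) measurable
  also have "\<dots> \<le> liminf (\<lambda>n::nat. ennreal C)"
    using bd by (intro Liminf_mono always_eventually allI) (simp add: finite_energy_nnD[OF fe] ennreal_leI)
  also have "\<dots> < \<infinity>" by (simp add: Liminf_const)
  finally show "(\<integral>\<^sup>+ z. ennreal ((dq s u z)\<^sup>2) \<partial>lborel2) < \<infinity>" .
qed

text \<open>
  A Cauchy sequence is bounded, and the bound survives the almost everywhere limit.
\<close>

lemma finite_energy_D_space:
  fixes u :: "'a::euclidean_space \<Rightarrow> real"
  assumes s: "0 < s" "s < 1" and c: "0 < c" and "u \<in> D_space c s"
  shows "finite_energy s u"
proof -
  from assms(4) obtain \<phi> where u: "u \<in> borel_measurable borel" and \<phi>: "\<And>n::nat. \<phi> n \<in> test_functions"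
    and cau: "\<forall>e>0. \<exists>M. \<forall>m\<ge>M. \<forall>n\<ge>M. energy_norm c s (\<lambda>x. \<phi> m x - \<phi> n x) < e"
    and lim: "AE x in lborel. (\<lambda>n. \<phi> n x) \<longlonglongrightarrow> u x"
    unfolding D_space_def by auto
  have fe: "finite_energy s (\<phi> n)" for n using finite_energy_test_function[OF s \<phi>] .
  obtain M where M: "\<And>m n. m \<ge> M \<Longrightarrow> n \<ge> M \<Longrightarrow> energy_norm c s (\<lambda>x. \<phi> m x - \<phi> n x) < 1"
    using cau zero_less_one by meson
  let ?I = "\<lambda>v. \<integral>z. (dq s v z)\<^sup>2 \<partial>lborel2"
  have b: "?I (\<phi> (n + M)) \<le> 2 * (2 / c) + 2 * ?I (\<phi> M)" for n
  proof -
    let ?d = "\<lambda>x. \<phi> (n + M) x - \<phi> M x"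
    have fd: "finite_energy s ?d" by (intro finite_energy_diff fe)
    have "energy_norm c s ?d < 1" using M by simp
    hence "c / 2 * ?I ?d < 1" unfolding energy_norm_def energy_form_dq by (simp add: power2_eq_square)
    hence d: "?I ?d \<le> 2 / c" using c by (simp add: field_simps)
    have "?I (\<phi> (n + M)) \<le> (\<integral>z. 2 * (dq s ?d z)\<^sup>2 + 2 * (dq s (\<phi> M) z)\<^sup>2 \<partial>lborel2)"
    proof (rule integral_mono)
      fix z
      have "(a::real)\<^sup>2 \<le> 2 * (a - b)\<^sup>2 + 2 * b\<^sup>2" for a b
        using zero_le_power2[of "a - 2 * b"] by (simp add: power2_eq_square algebra_simps)
      thus "(dq s (\<phi> (n + M)) z)\<^sup>2 \<le> 2 * (dq s ?d z)\<^sup>2 + 2 * (dq s (\<phi> M) z)\<^sup>2"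
        unfolding dq_diff .
    qed (use fe fd in \<open>auto simp: finite_energy_def\<close>)
    also have "\<dots> = 2 * ?I ?d + 2 * ?I (\<phi> M)"
      using fe[of M] fd by (simp add: finite_energy_def)
    finally show ?thesis using d by linarith
  qed
  show ?thesis
    by (rule finite_energy_Fatou[OF u, of s "\<lambda>n. \<phi> (n + M)"])
       (use fe b lim in \<open>auto elim!: eventually_mono intro: LIMSEQ_ignore_initial_segment\<close>)
qed

section \<open>Smooth compactly supported approximation\<close>

text \<open>
  A bounded sequence in \<open>L\<^sup>2\<close> that converges almost everywhere converges weakly. With \<open>D = W n - V\<close>, either
  \<open>|U D| \<le> m U\<^sup>2\<close>, and dominated convergence applies to the truncation \<open>min |U D| (m U\<^sup>2)\<close>, or
  \<open>|U D| < D\<^sup>2 / m\<close>, whose integral is small for large \<open>m\<close> uniformly in \<open>n\<close>.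
\<close>

lemma tendsto_integral_mult_L2:
  fixes U V :: "'b \<Rightarrow> real" and W :: "nat \<Rightarrow> 'b \<Rightarrow> real"
  assumes [measurable]: "U \<in> borel_measurable M" "V \<in> borel_measurable M" "\<And>n. W n \<in> borel_measurable M"
    and U: "integrable M (\<lambda>x. (U x)\<^sup>2)" and V: "integrable M (\<lambda>x. (V x)\<^sup>2)"
    and W: "\<And>n. integrable M (\<lambda>x. (W n x)\<^sup>2)" and C: "\<And>n. (\<integral>x. (W n x)\<^sup>2 \<partial>M) \<le> C"
    and lim: "AE x in M. (\<lambda>n. W n x) \<longlonglongrightarrow> V x"
  shows "(\<lambda>n. \<integral>x. U x * W n x \<partial>M) \<longlonglongrightarrow> (\<integral>x. U x * V x \<partial>M)"
proof (rule LIMSEQ_I)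
  fix e :: real assume e: "0 < e"
  define D where "D n x = W n x - V x" for n x
  have [measurable]: "D n \<in> borel_measurable M" for n unfolding D_def[abs_def] by measurable
  have UV: "integrable M (\<lambda>x. U x * V x)" "\<And>n. integrable M (\<lambda>x. U x * W n x)" "\<And>n. integrable M (\<lambda>x. V x * W n x)"
    using U V W by (auto intro: integrable_mult_L2)
  have UD: "integrable M (\<lambda>x. U x * D n x)" for n using UV by (simp add: D_def algebra_simps)
  have Dle: "(D n x)\<^sup>2 \<le> 2 * (W n x)\<^sup>2 + 2 * (V x)\<^sup>2" for n x
    using zero_le_power2[of "W n x + V x"] unfolding D_def by (simp add: power2_eq_square algebra_simps)
  have Dint: "integrable M (\<lambda>x. (D n x)\<^sup>2)" for n
    by (rule Bochner_Integration.integrable_bound[of _ "\<lambda>x. 2 * (W n x)\<^sup>2 + 2 * (V x)\<^sup>2"])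
       (use W V Dle in auto)
  define K where "K = 2 * \<bar>C\<bar> + 2 * (\<integral>x. (V x)\<^sup>2 \<partial>M)"
  have DK: "(\<integral>x. (D n x)\<^sup>2 \<partial>M) \<le> K" for n
  proof -
    have "(\<integral>x. (D n x)\<^sup>2 \<partial>M) \<le> (\<integral>x. 2 * (W n x)\<^sup>2 + 2 * (V x)\<^sup>2 \<partial>M)"
      using Dint W V Dle by (intro integral_mono) auto
    also have "\<dots> \<le> K" using C[of n] W V unfolding K_def by simp
    finally show ?thesis .
  qed
  have K0: "K \<ge> 0" unfolding K_def by (simp add: integral_nonneg_AE)
  \<comment> \<open>large enough for the remainder \<open>K / m\<close> to stay below \<open>e / 2\<close>\<close>
  define m where "m = 2 * (K + 1) / e"
  have m: "m > 0" "K / m < e / 2" using e K0 by (auto simp: m_def field_simps)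
  define h where "h n x = min \<bar>U x * D n x\<bar> (m * (U x)\<^sup>2)" for n x
  have [measurable]: "h n \<in> borel_measurable M" for n unfolding h_def[abs_def] by measurable
  have h_int: "integrable M (h n)" for n
    by (rule Bochner_Integration.integrable_bound[of _ "\<lambda>x. m * (U x)\<^sup>2"]) (use U m in \<open>auto simp: h_def\<close>)
  have h0: "(\<lambda>n. \<integral>x. h n x \<partial>M) \<longlonglongrightarrow> (\<integral>x. 0 \<partial>M)"
  proof (rule integral_dominated_convergence[where w = "\<lambda>x. m * (U x)\<^sup>2"])
    show "AE x in M. (\<lambda>n. h n x) \<longlonglongrightarrow> 0"
      using lim
    proof eventually_elim
      case (elim x)
      hence "(\<lambda>n. \<bar>U x * D n x\<bar>) \<longlonglongrightarrow> \<bar>U x * (V x - V x)\<bar>"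
        unfolding D_def by (intro tendsto_intros)
      hence "(\<lambda>n. min \<bar>U x * D n x\<bar> (m * (U x)\<^sup>2)) \<longlonglongrightarrow> min 0 (m * (U x)\<^sup>2)"
        by (intro tendsto_min tendsto_const) simp
      thus ?case using m by (simp add: h_def)
    qed
  qed (use U m in \<open>auto simp: h_def\<close>)
  have pw: "\<bar>U x * D n x\<bar> \<le> h n x + (D n x)\<^sup>2 / m" for n x
  proof (cases "\<bar>D n x\<bar> \<le> m * \<bar>U x\<bar>")
    case True
    hence "\<bar>U x\<bar> * \<bar>D n x\<bar> \<le> \<bar>U x\<bar> * (m * \<bar>U x\<bar>)" by (intro mult_left_mono) auto
    hence "\<bar>U x * D n x\<bar> \<le> m * (U x)\<^sup>2" by (simp add: abs_mult power2_eq_square algebra_simps)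
    thus ?thesis using m by (simp add: h_def)
  next
    case False
    hence "\<bar>U x\<bar> \<le> \<bar>D n x\<bar> / m" using m by (simp add: field_simps)
    hence "\<bar>U x\<bar> * \<bar>D n x\<bar> \<le> \<bar>D n x\<bar> / m * \<bar>D n x\<bar>" by (intro mult_right_mono) auto
    hence "\<bar>U x * D n x\<bar> \<le> (D n x)\<^sup>2 / m" by (simp add: abs_mult power2_eq_square)
    moreover have "h n x \<ge> 0" using m by (simp add: h_def)
    ultimately show ?thesis by linarith
  qed
  from LIMSEQ_D[OF h0, of "e / 2"] e obtain N where N: "\<And>n. n \<ge> N \<Longrightarrow> \<bar>\<integral>x. h n x \<partial>M\<bar> < e / 2" by auto
  show "\<exists>no. \<forall>n\<ge>no. norm ((\<integral>x. U x * W n x \<partial>M) - (\<integral>x. U x * V x \<partial>M)) < e"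
  proof (intro exI[of _ N] allI impI)
    fix n assume n: "n \<ge> N"
    have "(\<integral>x. U x * W n x \<partial>M) - (\<integral>x. U x * V x \<partial>M) = (\<integral>x. U x * D n x \<partial>M)"
      using UV by (simp add: D_def algebra_simps)
    also have "norm \<dots> \<le> (\<integral>x. \<bar>U x * D n x\<bar> \<partial>M)" using integral_norm_bound[of M "\<lambda>x. U x * D n x"] by simp
    also have "\<dots> \<le> (\<integral>x. h n x + (D n x)\<^sup>2 / m \<partial>M)"
      using UD h_int Dint pw by (intro integral_mono) auto
    also have "\<dots> = (\<integral>x. h n x \<partial>M) + (\<integral>x. (D n x)\<^sup>2 \<partial>M) / m"
      using h_int Dint by simp
    also have "\<dots> \<le> (\<integral>x. h n x \<partial>M) + K / m" using DK m by (simp add: divide_right_mono)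
    also have "\<dots> < e" using N[OF n] m by linarith
    finally show "norm ((\<integral>x. U x * W n x \<partial>M) - (\<integral>x. U x * V x \<partial>M)) < e" .
  qed
qed

text \<open>
  The functions \<open>P(1/t) exp(-1/t)\<close>, extended by zero to \<open>t \<le> 0\<close>. They are stable under differentiation, and so
  they are smooth; \<open>expf 1\<close> is the usual building block of bump functions.
\<close>

definition expf :: "real poly \<Rightarrow> real \<Rightarrow> real" where
  "expf P t = (if 0 < t then poly P (1 / t) * exp (- (1 / t)) else 0)"

lemma poly_mult_exp_tendsto_0: "((\<lambda>y::real. y ^ n * poly P y * exp (- y)) \<longlongrightarrow> 0) at_top"
proof (induction P arbitrary: n)
  case 0 show ?case by simp
next
  case (pCons a P)
  have 1: "((\<lambda>y::real. a * (y ^ n / exp y)) \<longlongrightarrow> a * 0) at_top"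
    by (intro tendsto_mult tendsto_const tendsto_power_div_exp_0)
  from tendsto_add[OF 1 pCons.IH[of "Suc n"]] show ?case
    by (rule tendsto_eq_rhs[THEN tendsto_cong[THEN iffD1, rotated]])
       (auto simp: exp_minus field_simps)
qed

lemma expf_tendsto_0: "(expf P \<longlongrightarrow> 0) (at 0)"
  unfolding filterlim_at_split
proof
  have "\<forall>\<^sub>F t in at_left 0. expf P t = 0"
    by (simp add: expf_def eventually_at_filter)
  thus "(expf P \<longlongrightarrow> 0) (at_left 0)" by (rule tendsto_eventually)
  have "((\<lambda>t. poly P (inverse t) * exp (- inverse t)) \<longlongrightarrow> 0) (at_right 0)"
    using filterlim_compose[OF poly_mult_exp_tendsto_0[of 0 P] filterlim_inverse_at_top_right] by simp
  moreover have "\<forall>\<^sub>F t in at_right 0. poly P (inverse t) * exp (- inverse t) = expf P t"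
    by (simp add: expf_def eventually_at_filter inverse_eq_divide)
  ultimately show "(expf P \<longlongrightarrow> 0) (at_right 0)" by (rule Lim_transform_eventually)
qed

definition expf_deriv :: "real poly \<Rightarrow> real poly" where
  "expf_deriv P = [:0, 0, 1:] * (P - pderiv P)"

lemma expf_has_derivative: "(expf P has_real_derivative expf (expf_deriv P) t) (at t)"
proof -
  consider "t < 0" | "t = 0" | "t > 0" by linarith
  thus ?thesis
  proof cases
    case 1
    have "((\<lambda>_. 0::real) has_real_derivative 0) (at t)" by simp
    moreover have "\<forall>\<^sub>F x in nhds t. expf P x = 0"
      using eventually_nhds_in_open[of "{..<0}" t] 1 by (auto elim!: eventually_mono simp: expf_def)
    ultimately show ?thesis using 1 DERIV_cong_ev[of t t "expf P" "\<lambda>_. 0" 0 0] by (simp add: expf_def)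
  next
    case 2
    \<comment> \<open>dividing by \<open>h\<close> multiplies the polynomial in \<open>1 / h\<close> by its variable\<close>
    have eq: "(\<lambda>h. (expf P h - expf P 0) / (h - 0)) = expf ([:0, 1:] * P)"
      by (auto simp: expf_def fun_eq_iff)
    have "(expf P has_real_derivative 0) (at 0)"
      unfolding has_field_derivative_iff eq by (rule expf_tendsto_0)
    thus ?thesis using 2 by (simp add: expf_def)
  next
    case 3
    have "((\<lambda>t. poly P (1 / t) * exp (- (1 / t))) has_real_derivative expf (expf_deriv P) t) (at t)"
      using 3 by (auto intro!: derivative_eq_intros poly_DERIV[THEN DERIV_chain2]
          simp: expf_def expf_deriv_def field_simps power2_eq_square)
    moreover have "\<forall>\<^sub>F x in nhds t. expf P x = poly P (1 / x) * exp (- (1 / x))"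
      using eventually_nhds_in_open[of "{0<..}" t] 3 by (auto elim!: eventually_mono simp: expf_def)
    ultimately show ?thesis
      using DERIV_cong_ev[of t t "expf P" "\<lambda>t. poly P (1 / t) * exp (- (1 / t))" "expf (expf_deriv P) t" "expf (expf_deriv P) t"] by simp
  qed
qed

lemma C_k_SucI:
  assumes "\<And>x. (f has_derivative f' x) (at x)" "\<And>b. b \<in> Basis \<Longrightarrow> C_k k (\<lambda>x. f' x b)"
  shows "C_k (Suc k) f"
proof -
  have "frechet_derivative f (at x) = f' x" for x
    using frechet_derivative_at[OF assms(1)] by simp
  thus ?thesis using assms by (auto simp: differentiable_def)
qed

lemma C_k_SucD: "C_k (Suc k) f \<Longrightarrow> C_k k f"
proof (induction k arbitrary: f)
  case 0
  thus ?case by (auto intro!: differentiable_imp_continuous_on simp: differentiable_on_def intro: differentiable_at_withinI)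
qed auto

lemma C_k_const: "C_k k (\<lambda>_. a)"
proof (induction k arbitrary: a)
  case (Suc k)
  show ?case by (rule C_k_SucI[where f' = "\<lambda>_ _. 0"]) (auto intro!: Suc)
qed simp

lemma C_k_add: "C_k k f \<Longrightarrow> C_k k g \<Longrightarrow> C_k k (\<lambda>x. f x + g x)"
proof (induction k arbitrary: f g)
  case (Suc k)
  show ?case
    by (rule C_k_SucI[where f' = "\<lambda>x h. frechet_derivative f (at x) h + frechet_derivative g (at x) h"])
       (use Suc in \<open>auto intro!: has_derivative_add simp: frechet_derivative_works\<close>)
qed (auto intro: continuous_intros)

lemma C_k_mult: "C_k k f \<Longrightarrow> C_k k g \<Longrightarrow> C_k k (\<lambda>x. f x * g x)"
proof (induction k arbitrary: f g)
  case (Suc k)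
  show ?case
  proof (rule C_k_SucI[where f' = "\<lambda>x h. f x * frechet_derivative g (at x) h + frechet_derivative f (at x) h * g x"])
    show "((\<lambda>x. f x * g x) has_derivative (\<lambda>h. f x * frechet_derivative g (at x) h + frechet_derivative f (at x) h * g x)) (at x)" for x
      using Suc.prems by (intro has_derivative_mult) (auto simp: frechet_derivative_works)
    show "C_k k (\<lambda>x. f x * frechet_derivative g (at x) b + frechet_derivative f (at x) b * g x)" if "b \<in> Basis" for b
      using Suc.prems that C_k_SucD[OF Suc.prems(1)] C_k_SucD[OF Suc.prems(2)]
      by (intro C_k_add Suc.IH) auto
  qed
qed (auto intro: continuous_intros)

lemma C_k_prod: "finite I \<Longrightarrow> (\<And>i. i \<in> I \<Longrightarrow> C_k k (f i)) \<Longrightarrow> C_k k (\<lambda>x. \<Prod>i\<in>I. f i x)"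
  by (induction I rule: finite_induct) (auto intro: C_k_const C_k_mult)

lemma C_k_expf_affine:
  fixes w :: "'a::euclidean_space"
  shows "C_k k (\<lambda>x. expf P (x \<bullet> w + a))"
proof (induction k arbitrary: P)
  case 0
  have "continuous_on UNIV (expf P)"
    by (intro continuous_at_imp_continuous_on ballI DERIV_isCont[OF expf_has_derivative])
  thus ?case by (auto intro!: continuous_on_compose2[of UNIV "expf P"] continuous_intros)
next
  case (Suc k)
  show ?case
  proof (rule C_k_SucI[where f' = "\<lambda>x h. (h \<bullet> w) * expf (expf_deriv P) (x \<bullet> w + a)"])
    fix x :: 'a
    have "(expf P has_derivative (\<lambda>h. h * expf (expf_deriv P) (x \<bullet> w + a))) (at (x \<bullet> w + a))"
      using expf_has_derivative[of P "x \<bullet> w + a"] by (simp add: has_field_derivative_def mult_commute_abs)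
    moreover have "((\<lambda>x. x \<bullet> w + a) has_derivative (\<lambda>h. h \<bullet> w)) (at x)"
      by (auto intro!: derivative_eq_intros)
    ultimately show "((\<lambda>x. expf P (x \<bullet> w + a)) has_derivative (\<lambda>h. (h \<bullet> w) * expf (expf_deriv P) (x \<bullet> w + a))) (at x)"
      by (rule has_derivative_compose[rotated])
  qed (intro C_k_mult C_k_const Suc)
qed

lemma continuous_integral_zero:
  fixes f :: "'a::euclidean_space \<Rightarrow> real"
  assumes c: "continuous_on UNIV f" and nn: "\<And>x. 0 \<le> f x" and int: "integrable lborel f"
    and le: "(\<integral>x. f x \<partial>lborel) \<le> 0"
  shows "f x = 0"
proof (rule ccontr)
  assume nz: "f x \<noteq> 0"
  have "(\<integral>x. f x \<partial>lborel) = 0" using le nn by (intro antisym integral_nonneg_AE) auto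
  hence "AE x in lborel. x \<notin> {x. f x \<noteq> 0}" using integral_nonneg_eq_0_iff_AE[OF int] nn by simp
  moreover have op: "open {x. f x \<noteq> 0}" using c by (simp add: open_Collect_neq)
  ultimately have "{x. f x \<noteq> 0} \<in> null_sets lborel" by (subst (asm) AE_iff_null_sets[symmetric]) auto
  hence "negligible {x. f x \<noteq> 0}" unfolding negligible_iff_null_sets by (rule null_sets_completionI)
  thus False using open_not_negligible[OF op] nz by blast
qed

text \<open>
  The bump is a product over the coordinates of \<open>expf 1\<close> at \<open>r + x_i\<close> and at \<open>r - x_i\<close>, which vanishes
  outside the cube of half side \<open>r\<close>; with \<open>r = d / N\<close> this cube lies in the ball of radius \<open>d\<close>.
\<close>

lemma exists_mollifier:
  assumes d: "0 < (d::real)"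
  obtains \<rho> :: "'a::euclidean_space \<Rightarrow> real" where "\<And>k. C_k k \<rho>" "\<And>x. 0 \<le> \<rho> x" "{x. \<rho> x \<noteq> 0} \<subseteq> cball 0 d"
    "integrable lborel \<rho>" "(\<integral>x. \<rho> x \<partial>lborel) = 1"
proof -
  define r where "r = d / real DIM('a)"
  have r: "r > 0" using d by (simp add: r_def)
  define b :: "'a \<Rightarrow> real" where "b x = (\<Prod>i\<in>Basis. expf 1 (x \<bullet> i + r) * expf 1 (x \<bullet> (- i) + r))" for x
  have e0: "0 \<le> expf 1 t" "expf 1 t \<noteq> 0 \<longleftrightarrow> 0 < t" for t by (auto simp: expf_def)
  have smooth: "C_k k b" for k
    unfolding b_def by (intro C_k_prod C_k_mult C_k_expf_affine finite_Basis)
  have nn: "0 \<le> b x" for x unfolding b_def by (intro prod_nonneg mult_nonneg_nonneg e0)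
  have supp: "{x. b x \<noteq> 0} \<subseteq> cball 0 d"
  proof
    fix x assume "x \<in> {x. b x \<noteq> 0}"
    hence "\<bar>x \<bullet> i\<bar> \<le> r" if "i \<in> Basis" for i
      using that by (fastforce simp: b_def e0 prod_zero_iff)
    hence "(\<Sum>i\<in>Basis. \<bar>x \<bullet> i\<bar>) \<le> (\<Sum>i\<in>(Basis::'a set). r)" by (rule sum_mono)
    also have "\<dots> = d" by (simp add: r_def)
    finally show "x \<in> cball 0 d" using norm_le_l1[of x] by simp
  qed
  have cont: "continuous_on UNIV b" using smooth[of 0] by simp
  have int: "integrable lborel b"
  proof -
    have "integrable lborel (\<lambda>x. indicator (cball 0 d) x *\<^sub>R b x)"
      using borel_integrable_compact[of "cball 0 d" b] cont by (auto intro: continuous_on_subset)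
    moreover have "(\<lambda>x. indicator (cball 0 d) x *\<^sub>R b x) = b" using supp by (auto simp: indicator_def fun_eq_iff)
    ultimately show ?thesis by simp
  qed
  define I where "I = (\<integral>x. b x \<partial>lborel)"
  have "I \<noteq> 0"
  proof
    assume "I = 0"
    hence "b 0 = 0" using continuous_integral_zero[OF cont nn int] by (simp add: I_def)
    moreover have "b 0 \<noteq> 0" using r by (simp add: b_def e0)
    ultimately show False by blast
  qed
  moreover have "0 \<le> I" unfolding I_def using nn by (intro integral_nonneg_AE) auto
  ultimately have I: "I > 0" by simp
  show ?thesis
  proof (rule that[of "\<lambda>x. inverse I * b x"])
    show "C_k k (\<lambda>x. inverse I * b x)" for k by (intro C_k_mult C_k_const smooth)
  qed (use I nn supp int in \<open>auto simp: I_def\<close>)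
qed

text \<open>
  Differentiation under the integral moves all derivatives onto \<open>\<rho>\<close>.
\<close>

lemma C_k_convolution:
  fixes v \<rho> :: "'a::euclidean_space \<Rightarrow> real"
  assumes v: "continuous_on UNIV v" and "C_k k \<rho>"
  shows "C_k k (\<lambda>x. integral (cbox p q) (\<lambda>y. v y * \<rho> (x - y)))"
  using assms(2)
proof (induction k arbitrary: \<rho>)
  case 0
  have 1: "continuous_on UNIV (\<lambda>x. \<rho> x)" using 0 by simp
  have "continuous_on (UNIV \<times> cbox p q) (\<lambda>(x, y). v y * \<rho> (x - y))"
    unfolding split_beta
    by (intro continuous_intros continuous_on_compose2[OF v] continuous_on_compose2[OF 1]) auto
  from integral_continuous_on_param[OF this] show ?case by simp
next
  case (Suc k)
  have d: "\<And>x. \<rho> differentiable (at x)" and D: "\<And>b. b \<in> Basis \<Longrightarrow> C_k k (\<lambda>x. frechet_derivative \<rho> (at x) b)"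
    using Suc.prems by auto
  have cD: "continuous_on UNIV (\<lambda>x. frechet_derivative \<rho> (at x) b)" if "b \<in> Basis" for b
  proof -
    have "C_k 0 g" if "C_k k g" for g :: "'a \<Rightarrow> real" using that by (induction k) (auto dest: C_k_SucD simp del: C_k.simps)
    thus ?thesis using D[OF that] by fastforce
  qed
  have \<rho>c: "continuous_on UNIV \<rho>" using d by (auto intro!: differentiable_imp_continuous_on simp: differentiable_on_def)
  define G where "G z = Blinfun (frechet_derivative \<rho> (at z))" for z
  have G: "blinfun_apply (G z) = frechet_derivative \<rho> (at z)" for z
    unfolding G_def using d[of z] by (intro bounded_linear_Blinfun_apply) (auto simp: frechet_derivative_works intro: has_derivative_bounded_linear)
  have Gc: "continuous_on UNIV G"
    by (rule continuous_on_blinfun_componentwise) (use cD in \<open>simp add: G\<close>)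
  let ?F = "\<lambda>x t. v t *\<^sub>R G (x - t)"
  have Fc: "continuous_on (UNIV \<times> cbox p q) (\<lambda>(x, t). ?F x t)"
    unfolding split_beta
    by (intro continuous_intros continuous_on_compose2[OF v] continuous_on_compose2[OF Gc]) auto
  have Fc1: "continuous_on (cbox p q) (?F x)" for x
    by (intro continuous_intros continuous_on_compose2[OF v] continuous_on_compose2[OF Gc]) auto
  show ?case
  proof (rule C_k_SucI[where f' = "\<lambda>x. blinfun_apply (integral (cbox p q) (?F x))"])
    fix x :: 'a
    show "((\<lambda>x. integral (cbox p q) (\<lambda>y. v y * \<rho> (x - y))) has_derivative blinfun_apply (integral (cbox p q) (?F x))) (at x)"
    proof (rule leibniz_rule[where U = UNIV and fx = ?F, simplified])
      fix x t :: 'a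
      have "(\<rho> has_derivative frechet_derivative \<rho> (at (x - t))) (at (x - t))"
        using d[of "x - t"] by (simp add: frechet_derivative_works)
      moreover have "((\<lambda>x. x - t) has_derivative (\<lambda>h. h)) (at x)" by (auto intro!: derivative_eq_intros)
      ultimately have "((\<lambda>x. \<rho> (x - t)) has_derivative (\<lambda>h. frechet_derivative \<rho> (at (x - t)) h)) (at x)"
        by (rule has_derivative_compose[rotated])
      from has_derivative_mult_right[OF this, of "v t"]
      show "((\<lambda>x. v t * \<rho> (x - t)) has_derivative blinfun_apply (v t *\<^sub>R G (x - t))) (at x)"
        by (simp add: scaleR_blinfun.rep_eq G)
    next
      fix x show "(\<lambda>y. v y * \<rho> (x - y)) integrable_on cbox p q"
        by (intro integrable_continuous continuous_intros continuous_on_compose2[OF v] continuous_on_compose2[OF \<rho>c]) auto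
    qed (use Fc in \<open>simp add: split_beta\<close>)
  next
    fix b :: 'a assume b: "b \<in> Basis"
    have "blinfun_apply (integral (cbox p q) (?F x)) b = integral (cbox p q) (\<lambda>y. v y * frechet_derivative \<rho> (at (x - y)) b)" for x
      by (subst blinfun_apply_integral) (auto intro!: integrable_continuous Fc1 simp: blinfun.scaleR_left G)
    thus "C_k k (\<lambda>x. blinfun_apply (integral (cbox p q) (?F x)) b)"
      using Suc.IH[OF D[OF b]] by simp
  qed
qed

section \<open>The weak equation tested with continuous functions of finite energy\<close>

lemma integrable_continuous_supp:
  fixes f :: "'a::euclidean_space \<Rightarrow> real"
  assumes "continuous_on UNIV f" "{x. f x \<noteq> 0} \<subseteq> cball 0 R"
  shows "integrable lborel f"
proof -
  have "integrable lborel (\<lambda>x. indicator (cball 0 R) x *\<^sub>R f x)"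
    using borel_integrable_compact[of "cball 0 R" f] assms by (auto intro: continuous_on_subset)
  moreover have "(\<lambda>x. indicator (cball 0 R) x *\<^sub>R f x) = f" using assms(2) by (auto simp: indicator_def fun_eq_iff)
  ultimately show ?thesis by simp
qed

text \<open>
  The last inequality is the nonnegativity of the variance of \<open>g\<close> under the probability density \<open>\<rho>\<close>.
\<close>

lemma jensen_square:
  fixes \<rho> g :: "'a::euclidean_space \<Rightarrow> real"
  assumes \<rho>: "integrable lborel \<rho>" "\<And>x. 0 \<le> \<rho> x" "(\<integral>x. \<rho> x \<partial>lborel) = 1"
    and g [measurable]: "g \<in> borel_measurable borel" and M: "\<And>x. \<bar>g x\<bar> \<le> M"
  shows "integrable lborel (\<lambda>z. \<rho> z * g z)"
    and "integrable lborel (\<lambda>z. \<rho> z * (g z)\<^sup>2)"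
    and "(\<integral>z. \<rho> z * g z \<partial>lborel)\<^sup>2 \<le> (\<integral>z. \<rho> z * (g z)\<^sup>2 \<partial>lborel)"
proof -
  have [measurable]: "\<rho> \<in> borel_measurable borel" using \<rho>(1) by simp
  have M1: "\<rho> x * \<bar>g x\<bar> \<le> \<rho> x * \<bar>M\<bar>" for x
    using M[of x] \<rho>(2) by (intro mult_left_mono) auto
  show 1: "integrable lborel (\<lambda>z. \<rho> z * g z)"
    by (rule Bochner_Integration.integrable_bound[of _ "\<lambda>z. M * \<rho> z"])
       (use \<rho> M1 in \<open>auto simp: abs_mult mult.commute\<close>)
  have M2: "(g x)\<^sup>2 \<le> M\<^sup>2" for x using power_mono[OF M[of x], of 2] by simp
  show 2: "integrable lborel (\<lambda>z. \<rho> z * (g z)\<^sup>2)"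
    by (rule Bochner_Integration.integrable_bound[of _ "\<lambda>z. M\<^sup>2 * \<rho> z"])
       (use \<rho> M2 in \<open>auto simp: abs_mult mult.commute intro!: mult_left_mono AE_I2\<close>)
  define m where "m = (\<integral>z. \<rho> z * g z \<partial>lborel)"
  have "0 \<le> (\<integral>z. \<rho> z * (g z - m)\<^sup>2 \<partial>lborel)" using \<rho>(2) by (intro integral_nonneg_AE) auto
  also have "\<dots> = (\<integral>z. \<rho> z * (g z)\<^sup>2 - 2 * m * (\<rho> z * g z) + m\<^sup>2 * \<rho> z \<partial>lborel)"
    by (intro Bochner_Integration.integral_cong) (auto simp: power2_eq_square algebra_simps)
  also have "\<dots> = (\<integral>z. \<rho> z * (g z)\<^sup>2 \<partial>lborel) - 2 * m * m + m\<^sup>2 * 1"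
    using 1 2 \<rho> by (simp add: m_def)
  finally show "(\<integral>z. \<rho> z * g z \<partial>lborel)\<^sup>2 \<le> (\<integral>z. \<rho> z * (g z)\<^sup>2 \<partial>lborel)"
    by (simp add: m_def power2_eq_square)
qed

lemma nn_integral_pair_translate:
  fixes F :: "'a::euclidean_space \<times> 'a \<Rightarrow> ennreal"
  assumes [measurable]: "F \<in> borel_measurable lborel2"
  shows "(\<integral>\<^sup>+ w. F (fst w - z, snd w - z) \<partial>lborel2) = (\<integral>\<^sup>+ w. F w \<partial>lborel2)"
proof -
  have [measurable]: "F \<in> borel_measurable (borel \<Otimes>\<^sub>M borel)" using assms by (simp cong: measurable_cong_sets)
  have "(\<integral>\<^sup>+ w. F (fst w - z, snd w - z) \<partial>lborel2) = (\<integral>\<^sup>+ x. \<integral>\<^sup>+ y. F (x - z, y - z) \<partial>lborel \<partial>lborel)"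
    by (subst lborel.nn_integral_fst[symmetric]) auto
  also have "\<dots> = (\<integral>\<^sup>+ x. \<integral>\<^sup>+ y. F (x - z, y) \<partial>lborel \<partial>lborel)"
    by (intro nn_integral_cong nn_integral_translate(4)) measurable
  also have "\<dots> = (\<integral>\<^sup>+ x. \<integral>\<^sup>+ y. F (x, y) \<partial>lborel \<partial>lborel)"
    by (rule nn_integral_translate(4)[of "\<lambda>x. \<integral>\<^sup>+ y. F (x, y) \<partial>lborel"]) measurable
  also have "\<dots> = (\<integral>\<^sup>+ w. F w \<partial>lborel2)"
    by (subst lborel.nn_integral_fst) auto
  finally show ?thesis .
qed

text \<open>
  The energy is convex and translation invariant, so averaging translates of \<open>v\<close> cannot increase it.
\<close>

lemma finite_energy_average:
  fixes v \<rho> :: "'a::euclidean_space \<Rightarrow> real"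
  assumes v: "continuous_on UNIV v" "\<And>x. \<bar>v x\<bar> \<le> M" and fe: "finite_energy s v"
    and \<rho>: "integrable lborel \<rho>" "\<And>x. 0 \<le> \<rho> x" "(\<integral>x. \<rho> x \<partial>lborel) = 1"
    and w: "\<And>x. w x = (\<integral>z. \<rho> z * v (x - z) \<partial>lborel)" and wm [measurable]: "w \<in> borel_measurable borel"
  shows "finite_energy s w"
    and "(\<integral>z. (dq s w z)\<^sup>2 \<partial>lborel2) \<le> (\<integral>z. (dq s v z)\<^sup>2 \<partial>lborel2)"
proof -
  have [measurable]: "v \<in> borel_measurable borel" using v by (intro borel_measurable_continuous_onI)
  have [measurable]: "\<rho> \<in> borel_measurable borel" using \<rho>(1) by simp
  interpret Q: sigma_finite_measure "lborel2 :: ('a \<times> 'a) measure"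
    by (simp add: lborel_prod sigma_finite_lborel)
  interpret PP: pair_sigma_finite "lborel2 :: ('a \<times> 'a) measure" "lborel :: 'a measure" ..
  have pt: "ennreal ((dq s w p)\<^sup>2) \<le> (\<integral>\<^sup>+ z. ennreal (\<rho> z) * ennreal ((dq s v (fst p - z, snd p - z))\<^sup>2) \<partial>lborel)" for p
  proof -
    let ?g = "\<lambda>z. v (fst p - z) - v (snd p - z)"
    have g: "\<bar>?g z\<bar> \<le> 2 * M" for z using v(2)[of "fst p - z"] v(2)[of "snd p - z"] by linarith
    have J: "integrable lborel (\<lambda>z. \<rho> z * v (q - z))" for q
      by (rule jensen_square(1)[OF \<rho> _ v(2)]) measurable
    note J2 = jensen_square[OF \<rho> _ g]
    have "w (fst p) - w (snd p) = (\<integral>z. \<rho> z * ?g z \<partial>lborel)"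
      unfolding w using J by (simp add: algebra_simps)
    hence "(w (fst p) - w (snd p))\<^sup>2 \<le> (\<integral>z. \<rho> z * (?g z)\<^sup>2 \<partial>lborel)" using J2(3) by simp
    hence "(dq s w p)\<^sup>2 \<le> (\<integral>z. \<rho> z * (?g z)\<^sup>2 \<partial>lborel) * kern s (fst p - snd p)"
      unfolding dq_power2 by (intro mult_right_mono) auto
    also have "\<dots> = (\<integral>z. \<rho> z * (dq s v (fst p - z, snd p - z))\<^sup>2 \<partial>lborel)"
      unfolding dq_power2 by (subst Bochner_Integration.integral_mult_left_zero[symmetric]) (simp add: mult.assoc)
    finally have "ennreal ((dq s w p)\<^sup>2) \<le> ennreal (\<integral>z. \<rho> z * (dq s v (fst p - z, snd p - z))\<^sup>2 \<partial>lborel)"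
      by (rule ennreal_leI)
    also have "\<dots> = (\<integral>\<^sup>+ z. ennreal (\<rho> z * (dq s v (fst p - z, snd p - z))\<^sup>2) \<partial>lborel)"
    proof (rule nn_integral_eq_integral[symmetric])
      have "integrable lborel (\<lambda>z. \<rho> z * (?g z)\<^sup>2 * kern s (fst p - snd p))"
        by (intro integrable_mult_left J2(2)) measurable
      thus "integrable lborel (\<lambda>z. \<rho> z * (dq s v (fst p - z, snd p - z))\<^sup>2)"
        unfolding dq_power2 by (simp add: mult.assoc)
    qed (use \<rho> in auto)
    finally show ?thesis using \<rho>(2) by (simp add: ennreal_mult)
  qed
  have [measurable]: "(\<lambda>p. dq s v (fst (fst p) - snd p, snd (fst p) - snd p)) \<in> borel_measurable (lborel2 \<Otimes>\<^sub>M lborel)"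
    unfolding dq_def by measurable
  have "(\<integral>\<^sup>+ p. ennreal ((dq s w p)\<^sup>2) \<partial>lborel2)
     \<le> (\<integral>\<^sup>+ p. \<integral>\<^sup>+ z. ennreal (\<rho> z) * ennreal ((dq s v (fst p - z, snd p - z))\<^sup>2) \<partial>lborel \<partial>lborel2)"
    by (intro nn_integral_mono pt)
  also have "\<dots> = (\<integral>\<^sup>+ z. \<integral>\<^sup>+ p. ennreal (\<rho> z) * ennreal ((dq s v (fst p - z, snd p - z))\<^sup>2) \<partial>lborel2 \<partial>lborel)"
    by (rule PP.Fubini'[symmetric]) (simp add: split_beta')
  also have "\<dots> = (\<integral>\<^sup>+ z. ennreal (\<rho> z) * (\<integral>\<^sup>+ p. ennreal ((dq s v p)\<^sup>2) \<partial>lborel2) \<partial>lborel)"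
  proof (intro nn_integral_cong)
    fix z :: 'a
    have "(\<integral>\<^sup>+ p. ennreal (\<rho> z) * ennreal ((dq s v (fst p - z, snd p - z))\<^sup>2) \<partial>lborel2)
      = ennreal (\<rho> z) * (\<integral>\<^sup>+ p. ennreal ((dq s v (fst p - z, snd p - z))\<^sup>2) \<partial>lborel2)"
      by (intro nn_integral_cmult) (unfold dq_def, measurable)
    also have "(\<integral>\<^sup>+ p. ennreal ((dq s v (fst p - z, snd p - z))\<^sup>2) \<partial>lborel2) = (\<integral>\<^sup>+ p. ennreal ((dq s v p)\<^sup>2) \<partial>lborel2)"
      by (rule nn_integral_pair_translate[of "\<lambda>p. ennreal ((dq s v p)\<^sup>2)"]) measurable
    finally show "(\<integral>\<^sup>+ p. ennreal (\<rho> z) * ennreal ((dq s v (fst p - z, snd p - z))\<^sup>2) \<partial>lborel2) = ennreal (\<rho> z) * (\<integral>\<^sup>+ p. ennreal ((dq s v p)\<^sup>2) \<partial>lborel2)" .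
  qed
  also have "\<dots> = (\<integral>\<^sup>+ z. ennreal (\<rho> z) \<partial>lborel) * (\<integral>\<^sup>+ p. ennreal ((dq s v p)\<^sup>2) \<partial>lborel2)"
    by (simp add: nn_integral_multc)
  also have "(\<integral>\<^sup>+ z. ennreal (\<rho> z) \<partial>lborel) = 1"
    using \<rho> by (simp add: nn_integral_eq_integral)
  finally have le: "(\<integral>\<^sup>+ p. ennreal ((dq s w p)\<^sup>2) \<partial>lborel2) \<le> ennreal (\<integral>p. (dq s v p)\<^sup>2 \<partial>lborel2)"
    by (simp add: finite_energy_nnD[OF fe])
  show w: "finite_energy s w"
    by (rule finite_energy_nnI[OF wm]) (use le in \<open>simp add: le_less_trans\<close>)
  show "(\<integral>z. (dq s w z)\<^sup>2 \<partial>lborel2) \<le> (\<integral>z. (dq s v z)\<^sup>2 \<partial>lborel2)"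
    using le unfolding finite_energy_nnD[OF w] by (subst (asm) ennreal_le_iff) (auto intro: integral_nonneg_AE)
qed

text \<open>
  The last conclusion measures the distance of \<open>w\<close> from \<open>v\<close> by the oscillation of \<open>v\<close> at scale \<open>d\<close>; it gives
  pointwise convergence as \<open>d\<close> tends to zero.
\<close>

lemma exists_smoothing:
  fixes v :: "'a::euclidean_space \<Rightarrow> real"
  assumes v: "continuous_on UNIV v" "{x. v x \<noteq> 0} \<subseteq> cball 0 R" "\<And>x. \<bar>v x\<bar> \<le> M"
    and fe: "finite_energy s v" and d: "0 < d" "d \<le> 1"
  obtains w where "w \<in> test_functions" "{x. w x \<noteq> 0} \<subseteq> cball 0 (R + 1)" "\<And>x. \<bar>w x\<bar> \<le> M" "finite_energy s w"
    "(\<integral>z. (dq s w z)\<^sup>2 \<partial>lborel2) \<le> (\<integral>z. (dq s v z)\<^sup>2 \<partial>lborel2)"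
    "\<And>x e. (\<And>z. norm z \<le> d \<Longrightarrow> \<bar>v (x - z) - v x\<bar> \<le> e) \<Longrightarrow> \<bar>w x - v x\<bar> \<le> e"
proof -
  obtain \<rho> :: "'a \<Rightarrow> real" where \<rho>: "\<And>k. C_k k \<rho>" "\<And>x. 0 \<le> \<rho> x" "{x. \<rho> x \<noteq> 0} \<subseteq> cball 0 d"
    "integrable lborel \<rho>" "(\<integral>x. \<rho> x \<partial>lborel) = 1"
    using exists_mollifier[OF d(1)] by blast
  have \<rho>c: "continuous_on UNIV \<rho>" using \<rho>(1)[of 0] by simp
  have vm [measurable]: "v \<in> borel_measurable borel" using v by (intro borel_measurable_continuous_onI)
  have \<rho>m [measurable]: "\<rho> \<in> borel_measurable borel" using \<rho>(4) by simp
  define w where "w x = (\<integral>z. \<rho> z * v (x - z) \<partial>lborel)" for x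
  note J = jensen_square(1)[OF \<rho>(4,2,5)]
  obtain q where q: "cball (0::'a) R \<subseteq> cbox (- q) q"
    using bounded_subset_cbox_symmetric[OF bounded_cball] by blast
  have weq: "w x = integral (cbox (- q) q) (\<lambda>y. v y * \<rho> (x - y))" for x
  proof -
    have "w x = (\<integral>y. \<rho> (x - y) * v (x - (x - y)) \<partial>lborel)"
      unfolding w_def by (subst integral_translate(2)[of "\<lambda>z. \<rho> z * v (x - z)" x]) auto
    also have "\<dots> = (\<integral>y. v y * \<rho> (x - y) \<partial>lborel)" by (simp add: mult.commute)
    also have "\<dots> = integral UNIV (\<lambda>y. v y * \<rho> (x - y))"
    proof (rule integral_lborel[symmetric])
      have c: "continuous_on UNIV (\<lambda>y. v y * \<rho> (x - y))"
        by (intro continuous_intros v(1) continuous_on_compose2[OF \<rho>c]) auto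
      show "integrable lborel (\<lambda>y. v y * \<rho> (x - y))"
        by (rule integrable_continuous_supp[OF c, of R]) (use v(2) in auto)
    qed
    also have "\<dots> = integral (cbox (- q) q) (\<lambda>y. v y * \<rho> (x - y))"
    proof -
      have "(\<lambda>y. if y \<in> cbox (- q) q then v y * \<rho> (x - y) else 0) = (\<lambda>y. v y * \<rho> (x - y))"
        using v(2) q by (fastforce simp: fun_eq_iff)
      thus ?thesis using integral_restrict_UNIV[of "cbox (- q) q" "\<lambda>y. v y * \<rho> (x - y)"] by simp
    qed
    finally show ?thesis .
  qed
  have smooth: "C_k k w" for k
    unfolding weq[abs_def] by (rule C_k_convolution[OF v(1) \<rho>(1)])
  have supp: "{x. w x \<noteq> 0} \<subseteq> cball 0 (R + 1)"
  proof (rule ccontr)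
    assume "\<not> ?thesis"
    then obtain x where x: "w x \<noteq> 0" "norm x > R + 1" by force
    have "\<rho> z * v (x - z) = 0" for z
    proof (rule ccontr)
      assume "\<rho> z * v (x - z) \<noteq> 0"
      hence "norm z \<le> d" "norm (x - z) \<le> R" using \<rho>(3) v(2) by auto
      thus False using x(2) d norm_triangle_sub[of x z] by simp
    qed
    hence "(\<lambda>z. \<rho> z * v (x - z)) = (\<lambda>_. 0)" by (rule ext)
    thus False using x(1) unfolding w_def by simp
  qed
  have wm: "w \<in> borel_measurable borel" using smooth[of 0] by (intro borel_measurable_continuous_onI) simp
  note E = finite_energy_average[OF v(1,3) fe \<rho>(4,2,5) w_def wm]
  show ?thesis
  proof (rule that[of w])
    show "w \<in> test_functions"
      unfolding test_functions_def using smooth bounded_subset[OF bounded_cball supp] by simp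
    show "\<bar>w x\<bar> \<le> M" for x
    proof -
      have "\<bar>w x\<bar> \<le> (\<integral>z. M * \<rho> z \<partial>lborel)"
        unfolding w_def using J[of "\<lambda>z. v (x - z)" M] v(3) \<rho>
        by (intro integral_abs_bound_integral) (auto simp: abs_mult mult.commute[of M] intro!: mult_left_mono)
      thus ?thesis using \<rho> by simp
    qed
    show "\<bar>w x - v x\<bar> \<le> e" if z: "\<And>z. norm z \<le> d \<Longrightarrow> \<bar>v (x - z) - v x\<bar> \<le> e" for x e
    proof -
      have 1: "integrable lborel (\<lambda>z. \<rho> z * v (x - z))" using J[of "\<lambda>z. v (x - z)" M] v(3) by simp
      have "w x - v x = (\<integral>z. \<rho> z * (v (x - z) - v x) \<partial>lborel)"
        unfolding w_def right_diff_distrib using 1 \<rho> by simp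
      also have "\<bar>\<dots>\<bar> \<le> (\<integral>z. e * \<rho> z \<partial>lborel)"
      proof (rule integral_abs_bound_integral)
        show "integrable lborel (\<lambda>z. \<rho> z * (v (x - z) - v x))"
          unfolding right_diff_distrib using 1 \<rho> by simp
        fix y show "\<bar>\<rho> y * (v (x - y) - v x)\<bar> \<le> e * \<rho> y"
        proof (cases "\<rho> y = 0")
          case False
          hence "norm y \<le> d" using \<rho>(3) by auto
          from mult_left_mono[OF z[OF this] \<rho>(2)[of y]] show ?thesis using \<rho>(2)[of y] by (simp add: abs_mult mult.commute)
        qed simp
      qed (use \<rho> in auto)
      finally show ?thesis using \<rho> by simp
    qed
  qed (use supp E in auto)
qed

text \<open>
  Mollifications of \<open>v\<close> are admissible test functions of bounded energy which converge pointwise to \<open>v\<close>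
  and have supports in a common ball. So the left-hand side passes to the limit by weak convergence of the
  difference quotients and the right-hand side by dominated convergence.
\<close>

lemma weak_solution_test_continuous:
  fixes u v :: "'a::euclidean_space \<Rightarrow> real"
  assumes ws: "weak_solution c s f u" and u: "continuous_on UNIV u" "finite_energy s u" and f: "continuous_on UNIV f"
    and v: "continuous_on UNIV v" "{x. v x \<noteq> 0} \<subseteq> cball 0 R" and fe: "finite_energy s v"
  shows "energy_form c s u v = (\<integral>x. f (u x) * v x \<partial>lborel)"
proof -
  obtain M where M: "\<And>x. \<bar>v x\<bar> \<le> M" using continuous_supp_bounded[OF v] by blast
  have "\<exists>w. w \<in> test_functions \<and> {x. w x \<noteq> 0} \<subseteq> cball 0 (R + 1) \<and> (\<forall>x. \<bar>w x\<bar> \<le> M) \<and> finite_energy s w \<and>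
    (\<integral>z. (dq s w z)\<^sup>2 \<partial>lborel2) \<le> (\<integral>z. (dq s v z)\<^sup>2 \<partial>lborel2) \<and>
    (\<forall>x e. (\<forall>z. norm z \<le> 1 / real (Suc n) \<longrightarrow> \<bar>v (x - z) - v x\<bar> \<le> e) \<longrightarrow> \<bar>w x - v x\<bar> \<le> e)" for n
    using exists_smoothing[OF v M fe, of "1 / real (Suc n)"] by (metis divide_le_eq_1_pos of_nat_0_less_iff of_nat_1 of_nat_le_iff zero_less_Suc zero_less_divide_1_iff Suc_le_eq One_nat_def)
  then obtain w where w: "\<And>n::nat. w n \<in> test_functions" "\<And>n. {x. w n x \<noteq> 0} \<subseteq> cball 0 (R + 1)" "\<And>n x. \<bar>w n x\<bar> \<le> M"
     "\<And>n. finite_energy s (w n)"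
    "\<And>n. (\<integral>z. (dq s (w n) z)\<^sup>2 \<partial>lborel2) \<le> (\<integral>z. (dq s v z)\<^sup>2 \<partial>lborel2)"
    "\<And>n x e. (\<And>z. norm z \<le> 1 / real (Suc n) \<Longrightarrow> \<bar>v (x - z) - v x\<bar> \<le> e) \<Longrightarrow> \<bar>w n x - v x\<bar> \<le> e"
    by metis
  note [measurable] = u(2) fe w(4)
  have lim: "(\<lambda>n. w n x) \<longlonglongrightarrow> v x" for x
  proof (rule LIMSEQ_I)
    fix e :: real assume e: "0 < e"
    have "continuous (at x) v" using v(1) by (simp add: continuous_on_eq_continuous_at)
    then obtain d where d: "d > 0" "\<And>y. dist y x < d \<Longrightarrow> dist (v y) (v x) < e / 2"
      unfolding continuous_at_eps_delta using e by (metis half_gt_zero)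
    obtain N where N: "inverse (real (Suc N)) < d" using reals_Archimedean[OF d(1)] by blast
    show "\<exists>no. \<forall>n\<ge>no. norm (w n x - v x) < e"
    proof (intro exI[of _ N] allI impI)
      fix n assume n: "N \<le> n"
      have "\<bar>w n x - v x\<bar> \<le> e / 2"
      proof (rule w(6))
        fix z :: 'a assume "norm z \<le> 1 / real (Suc n)"
        also have "\<dots> \<le> 1 / real (Suc N)" using n by (intro divide_left_mono) auto
        also have "\<dots> < d" using N by (simp add: inverse_eq_divide)
        finally have "dist (x - z) x < d" by (simp add: dist_norm)
        from d(2)[OF this] show "\<bar>v (x - z) - v x\<bar> \<le> e / 2" by (simp add: dist_real_def)
      qed
      thus "norm (w n x - v x) < e" using e by simp
    qed
  qed
  have "(\<lambda>n. \<integral>z. dq s u z * dq s (w n) z \<partial>lborel2) \<longlonglongrightarrow> (\<integral>z. dq s u z * dq s v z \<partial>lborel2)"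
  proof (rule tendsto_integral_mult_L2)
    show "AE z in lborel2. (\<lambda>n. dq s (w n) z) \<longlonglongrightarrow> dq s v z"
      unfolding dq_def by (intro AE_I2 tendsto_intros lim)
  qed (use w u fe in \<open>auto simp: finite_energy_def\<close>)
  hence L1: "(\<lambda>n. energy_form c s u (w n)) \<longlonglongrightarrow> energy_form c s u v"
    unfolding energy_form_dq by (intro tendsto_intros)
  have fu: "continuous_on UNIV (\<lambda>x. f (u x))" by (rule continuous_on_compose2[OF f u(1)]) auto
  hence [measurable]: "(\<lambda>x. f (u x)) \<in> borel_measurable borel" by (intro borel_measurable_continuous_onI)
  have "compact ((\<lambda>x. f (u x)) ` cball 0 (R + 1))" using fu by (intro compact_continuous_image) (auto intro: continuous_on_subset)
  from compact_imp_bounded[OF this] obtain F where F: "\<And>x. x \<in> cball 0 (R + 1) \<Longrightarrow> \<bar>f (u x)\<bar> \<le> F"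
    unfolding bounded_iff by fastforce
  have "(\<lambda>n. \<integral>x. f (u x) * w n x \<partial>lborel) \<longlonglongrightarrow> (\<integral>x. f (u x) * v x \<partial>lborel)"
  proof (rule integral_dominated_convergence[where w = "\<lambda>x. F * M * indicator (cball 0 (R + 1)) x"])
    show "integrable lborel (\<lambda>x. F * M * indicator (cball 0 (R + 1)) (x::'a))"
      using emeasure_bounded_finite[OF bounded_cball, of "0::'a" "R + 1"]
      by (intro integrable_mult_right integrable_real_indicator) auto
    show "AE x in lborel. norm (f (u x) * w n x) \<le> F * M * indicator (cball 0 (R + 1)) x" for n
    proof (intro AE_I2)
      fix x show "norm (f (u x) * w n x) \<le> F * M * indicator (cball 0 (R + 1)) x"
      proof (cases "x \<in> cball 0 (R + 1)")
        case True
        have "\<bar>f (u x)\<bar> * \<bar>w n x\<bar> \<le> F * M"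
          using F[OF True] w(3)[of n x] by (intro mult_mono) auto
        thus ?thesis using True by (simp add: abs_mult)
      next
        case False
        hence "w n x = 0" using w(2)[of n] by blast
        thus ?thesis using False by simp
      qed
    qed
  qed (auto intro!: AE_I2 tendsto_intros lim)
  moreover have "energy_form c s u (w n) = (\<integral>x. f (u x) * w n x \<partial>lborel)" for n
    using ws w(1) by (simp add: weak_solution_def)
  ultimately have "(\<lambda>n. energy_form c s u (w n)) \<longlonglongrightarrow> (\<integral>x. f (u x) * v x \<partial>lborel)" by simp
  from LIMSEQ_unique[OF L1 this] show ?thesis .
qed

section \<open>Reflections and the folded energy\<close>

definition reflect :: "'a::euclidean_space \<Rightarrow> real \<Rightarrow> 'a \<Rightarrow> 'a" where
  "reflect e l x = x + (2 * (l - x \<bullet> e)) *\<^sub>R e"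

lemma norm_one_inner: "norm e = 1 \<Longrightarrow> e \<bullet> e = (1::real)"
  by (simp add: dot_square_norm)

lemma abs_inner_le_norm: "norm e = 1 \<Longrightarrow> \<bar>x \<bullet> e\<bar> \<le> norm x"
  using Cauchy_Schwarz_ineq2[of x e] by simp

lemma reflect_inner: "norm e = 1 \<Longrightarrow> reflect e l x \<bullet> e = 2 * l - x \<bullet> e"
  by (simp add: reflect_def inner_left_distrib norm_one_inner)

lemma reflect_refl [simp]: "norm e = 1 \<Longrightarrow> reflect e l (reflect e l x) = x"
  by (simp add: reflect_def inner_left_distrib norm_one_inner algebra_simps flip: scaleR_add_left)

lemma reflect_fixed: "x \<bullet> e = l \<Longrightarrow> reflect e l x = x"
  by (simp add: reflect_def)

text \<open>
  Two points on the same side of the hyperplane are closer to each other than to the mirror images of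
  each other. This identity is the geometric fact behind the moving plane method.
\<close>

lemma norm_reflect_diff_cross:
  assumes "norm e = 1"
  shows "(norm (x - reflect e l y))\<^sup>2 = (norm (x - y))\<^sup>2 + 4 * (x \<bullet> e - l) * (y \<bullet> e - l)"
  unfolding power2_norm_eq_inner reflect_def using norm_one_inner[OF assms]
  by (simp add: inner_diff_left inner_diff_right inner_add_left inner_add_right inner_commute algebra_simps)

lemma norm_reflect_diff:
  assumes "norm e = 1"
  shows "norm (reflect e l x - reflect e l y) = norm (x - y)"
proof -
  have "(norm (reflect e l x - reflect e l y))\<^sup>2 = (norm (x - y))\<^sup>2"
    unfolding power2_norm_eq_inner reflect_def using norm_one_inner[OF assms]
    by (simp add: inner_diff_left inner_diff_right inner_add_left inner_add_right inner_commute algebra_simps)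
  thus ?thesis by (simp add: power2_eq_iff_nonneg)
qed

lemma norm_reflect_swap:
  assumes "norm e = 1"
  shows "norm (reflect e l x - y) = norm (x - reflect e l y)"
  using norm_reflect_diff[OF assms, of l x "reflect e l y"] assms by simp

lemma norm_reflect_ge:
  assumes "norm e = 1" "l \<le> x \<bullet> e" "l \<le> y \<bullet> e"
  shows "norm (x - y) \<le> norm (x - reflect e l y)"
proof (rule power2_le_imp_le)
  show "(norm (x - y))\<^sup>2 \<le> (norm (x - reflect e l y))\<^sup>2"
    unfolding norm_reflect_diff_cross[OF assms(1)] using assms by simp
qed simp

lemma kern_cong: "norm (x::'a::euclidean_space) = norm (y::'a) \<Longrightarrow> kern s x = kern s y"
  by (simp add: kern_def)

lemma continuous_on_reflect [continuous_intros]: "continuous_on A (reflect e l)"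
  unfolding reflect_def by (intro continuous_intros)

lemma reflect_measurable [measurable]: "reflect e l \<in> borel_measurable borel"
  by (intro borel_measurable_continuous_onI continuous_intros)

text \<open>
  For the image measure \<open>\<mu>\<close> of Lebesgue measure \<open>\<lambda>\<close> under the reflection, Fubini's theorem applied to
  \<open>1_A(x) 1_B(x + y)\<close> and the translation invariance of \<open>\<mu>\<close> give \<open>\<mu>(A) \<lambda>(B) = \<mu>(B) \<lambda>(A)\<close>. For \<open>A\<close> a ball
  centred on the hyperplane, \<open>\<mu>(A) = \<lambda>(A)\<close>, and so \<open>\<mu>(B) = \<lambda>(B)\<close>.
\<close>

lemma distr_reflect:
  fixes e :: "'a::euclidean_space"
  assumes e: "norm e = 1"
  shows "distr lborel borel (reflect e l) = lborel"
proof (rule measure_eqI)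
  fix B assume "B \<in> sets (distr lborel borel (reflect e l))"
  hence B [measurable]: "B \<in> sets borel" by simp
  define A where "A = ball (l *\<^sub>R e) 1"
  have [measurable]: "A \<in> sets borel" by (simp add: A_def)
  let ?T = "reflect e l"
  have fix_c: "reflect e l (l *\<^sub>R e) = l *\<^sub>R e" using norm_one_inner[OF e] by (simp add: reflect_fixed)
  have TA: "indicator A (?T x) = (indicator A x :: ennreal)" for x
    using norm_reflect_diff[OF e, of l "l *\<^sub>R e" x] unfolding fix_c by (simp add: A_def indicator_def dist_norm)
  \<comment> \<open>\<open>reflect e 0\<close> is the linear part of the reflection\<close>
  have shift: "?T (x + reflect e 0 y) = ?T x + y" for x y
    by (simp add: reflect_def inner_left_distrib norm_one_inner[OF e] algebra_simps flip: scaleR_add_left)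
  have "emeasure lborel A * emeasure lborel B = (\<integral>\<^sup>+ x. indicator A (?T x) * emeasure lborel B \<partial>lborel)"
    by (simp add: TA nn_integral_multc)
  also have "\<dots> = (\<integral>\<^sup>+ x. indicator A (?T x) * (\<integral>\<^sup>+ y. indicator B (?T x + y) \<partial>lborel) \<partial>lborel)"
    by (subst nn_integral_translate(1)) simp_all
  also have "\<dots> = (\<integral>\<^sup>+ x. \<integral>\<^sup>+ y. indicator A (?T x) * indicator B (?T x + y) \<partial>lborel \<partial>lborel)"
    by (subst nn_integral_cmult) simp_all
  also have "\<dots> = (\<integral>\<^sup>+ y. \<integral>\<^sup>+ x. indicator A (?T x) * indicator B (?T x + y) \<partial>lborel \<partial>lborel)"
    by (rule lborel_pair.Fubini'[symmetric]) measurable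
  also have "\<dots> = (\<integral>\<^sup>+ y. \<integral>\<^sup>+ x. indicator A (?T x - y) * indicator B (?T x) \<partial>lborel \<partial>lborel)"
  proof (rule nn_integral_cong)
    fix y :: 'a
    have "(\<integral>\<^sup>+ x. indicator A (?T x - y) * indicator B (?T x) \<partial>lborel)
      = (\<integral>\<^sup>+ x. indicator A (?T (x + reflect e 0 y) - y) * indicator B (?T (x + reflect e 0 y)) \<partial>lborel)"
      by (rule nn_integral_translate(2)[symmetric]) measurable
    thus "(\<integral>\<^sup>+ x. indicator A (?T x) * indicator B (?T x + y) \<partial>lborel) = (\<integral>\<^sup>+ x. indicator A (?T x - y) * indicator B (?T x) \<partial>lborel)"
      by (simp add: shift)
  qed
  also have "\<dots> = (\<integral>\<^sup>+ x. \<integral>\<^sup>+ y. indicator A (?T x - y) * indicator B (?T x) \<partial>lborel \<partial>lborel)"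
    by (rule lborel_pair.Fubini') measurable
  also have "\<dots> = (\<integral>\<^sup>+ x. (\<integral>\<^sup>+ y. indicator A (?T x - y) \<partial>lborel) * indicator B (?T x) \<partial>lborel)"
    by (subst nn_integral_multc) simp_all
  also have "\<dots> = (\<integral>\<^sup>+ x. emeasure lborel A * indicator B (?T x) \<partial>lborel)"
    by (subst nn_integral_translate(3)) simp_all
  also have "\<dots> = emeasure lborel A * (\<integral>\<^sup>+ x. indicator B (?T x) \<partial>lborel)"
    by (rule nn_integral_cmult) measurable
  also have "(\<integral>\<^sup>+ x. indicator B (?T x) \<partial>lborel) = (\<integral>\<^sup>+ x. indicator B x \<partial>(distr lborel borel ?T))"
    by (subst nn_integral_distr) simp_all
  also have "\<dots> = emeasure (distr lborel borel ?T) B" by simp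
  finally have "emeasure lborel A * emeasure lborel B = emeasure lborel A * emeasure (distr lborel borel ?T) B" .
  moreover have "emeasure lborel A \<noteq> \<infinity>" "emeasure lborel A \<noteq> 0"
    using emeasure_lborel_ball_finite[of "l *\<^sub>R e" 1] content_ball_pos[of 1 "l *\<^sub>R e"]
    by (auto simp: A_def measure_def)
  ultimately show "emeasure (distr lborel borel ?T) B = emeasure lborel B"
    by (simp add: ennreal_mult_cancel_left)
qed simp

lemma integral_reflect_eq:
  fixes f :: "'a::euclidean_space \<Rightarrow> real"
  assumes e: "norm e = 1" and f: "f \<in> borel_measurable borel"
  shows "(\<integral>x. f (reflect e l x) \<partial>lborel) = (\<integral>x. f x \<partial>lborel)"
  using integral_distr[of "reflect e l" lborel borel f] f by (simp add: distr_reflect[OF e])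

lemma distr_pair_reflect:
  fixes e :: "'a::euclidean_space"
  assumes e: "norm e = 1"
  shows "distr lborel2 lborel2 (\<lambda>z::'a \<times> 'a. (reflect e l (fst z), snd z)) = (lborel2 :: ('a \<times> 'a) measure)"
    and "distr lborel2 lborel2 (\<lambda>z::'a \<times> 'a. (fst z, reflect e l (snd z))) = (lborel2 :: ('a \<times> 'a) measure)"
proof -
  have id: "distr lborel borel (\<lambda>x::'a. x) = lborel" by (rule distr_id2) simp
  have c: "distr lborel2 (borel \<Otimes>\<^sub>M borel) h = distr lborel2 lborel2 h" for h :: "'a \<times> 'a \<Rightarrow> 'a \<times> 'a"
    by (intro distr_cong) (auto cong: sets_pair_measure_cong)
  have "distr lborel borel (reflect e l) \<Otimes>\<^sub>M distr lborel borel (\<lambda>x::'a. x) = distr lborel2 (borel \<Otimes>\<^sub>M borel) (\<lambda>(x, y). (reflect e l x, y))"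
    by (rule pair_measure_distr) (simp_all add: id sigma_finite_lborel)
  thus "distr lborel2 lborel2 (\<lambda>z::'a \<times> 'a. (reflect e l (fst z), snd z)) = (lborel2 :: ('a \<times> 'a) measure)"
    unfolding id distr_reflect[OF e] c split_beta' by (rule sym)
  have "distr lborel borel (\<lambda>x::'a. x) \<Otimes>\<^sub>M distr lborel borel (reflect e l) = distr lborel2 (borel \<Otimes>\<^sub>M borel) (\<lambda>(x, y). (x, reflect e l y))"
    by (rule pair_measure_distr) (simp_all add: distr_reflect[OF e] sigma_finite_lborel)
  thus "distr lborel2 lborel2 (\<lambda>z::'a \<times> 'a. (fst z, reflect e l (snd z))) = (lborel2 :: ('a \<times> 'a) measure)"
    unfolding id distr_reflect[OF e] c split_beta' by (rule sym)
qed

lemma pair_reflect_integral: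
  fixes F :: "'a::euclidean_space \<times> 'a \<Rightarrow> real"
  assumes e: "norm e = 1" and F: "integrable lborel2 F"
  shows "integrable lborel2 (\<lambda>z. F (reflect e l (fst z), snd z))"
    and "(\<integral>z. F (reflect e l (fst z), snd z) \<partial>lborel2) = (\<integral>z. F z \<partial>lborel2)"
    and "integrable lborel2 (\<lambda>z. F (fst z, reflect e l (snd z)))"
    and "(\<integral>z. F (fst z, reflect e l (snd z)) \<partial>lborel2) = (\<integral>z. F z \<partial>lborel2)"
proof -
  have *: "integrable lborel2 (\<lambda>z. F (h z)) \<and> (\<integral>z. F (h z) \<partial>lborel2) = (\<integral>z. F z \<partial>lborel2)"
    if h: "h \<in> measurable lborel2 lborel2" "distr lborel2 lborel2 h = lborel2"
    for h :: "'a \<times> 'a \<Rightarrow> 'a \<times> 'a"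
  proof -
    have Fm: "F \<in> borel_measurable lborel2" using F by simp
    show ?thesis
      using integrable_distr[OF h(1), of F] integral_distr[OF h(1) Fm] F unfolding h(2) by auto
  qed
  have m: "(\<lambda>z. (reflect e l (fst z), snd z)) \<in> measurable lborel2 lborel2"
    "(\<lambda>z. (fst z, reflect e l (snd z))) \<in> measurable lborel2 lborel2"
    by measurable
  show "integrable lborel2 (\<lambda>z. F (reflect e l (fst z), snd z))"
    and "(\<integral>z. F (reflect e l (fst z), snd z) \<partial>lborel2) = (\<integral>z. F z \<partial>lborel2)"
    using *[OF m(1) distr_pair_reflect(1)[OF e]] by auto
  show "integrable lborel2 (\<lambda>z. F (fst z, reflect e l (snd z)))"
    and "(\<integral>z. F (fst z, reflect e l (snd z)) \<partial>lborel2) = (\<integral>z. F z \<partial>lborel2)"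
    using *[OF m(2) distr_pair_reflect(2)[OF e]] by auto
qed

lemma dq_reflect:
  assumes "norm e = 1"
  shows "dq s (\<lambda>x. u (reflect e l x)) z = dq s u (reflect e l (fst z), reflect e l (snd z))"
  unfolding dq_def using kern_cong[OF norm_reflect_diff[OF assms]] by simp

lemma finite_energy_reflect:
  assumes e: "norm e = 1" and u: "finite_energy s u"
  shows "finite_energy s (\<lambda>x. u (reflect e l x))"
proof -
  note [measurable] = u
  have "integrable lborel2 (\<lambda>z. (dq s u z)\<^sup>2)" using u by (simp add: finite_energy_def)
  from pair_reflect_integral(1)[OF e pair_reflect_integral(3)[OF e this, of l], of l]
  show ?thesis unfolding finite_energy_def dq_reflect[OF e]
    by (simp add: measurable_compose[OF reflect_measurable finite_energy_measurable[OF u]])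
qed

lemma energy_form_reflect:
  fixes u v :: "'a::euclidean_space \<Rightarrow> real"
  assumes e: "norm e = 1" and u: "finite_energy s u" and v: "finite_energy s v"
  shows "energy_form c s (\<lambda>x. u (reflect e l x)) v = energy_form c s u (\<lambda>x. v (reflect e l x))"
proof -
  have i: "integrable lborel2 (\<lambda>z. dq s u z * dq s (\<lambda>x. v (reflect e l x)) z)"
    using u finite_energy_reflect[OF e v] by (rule finite_energy_integrable_mult)
  have "(\<integral>z. dq s u z * dq s (\<lambda>x. v (reflect e l x)) z \<partial>lborel2)
      = (\<integral>z. dq s (\<lambda>x. u (reflect e l x)) z * dq s v z \<partial>lborel2)"
    using pair_reflect_integral(2)[OF e pair_reflect_integral(3)[OF e i, of l], of l] pair_reflect_integral(4)[OF e i, of l] e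
    unfolding dq_reflect[OF e] by simp
  thus ?thesis unfolding energy_form_dq by simp
qed

definition reflect_odd :: "'a::euclidean_space \<Rightarrow> real \<Rightarrow> ('a \<Rightarrow> real) \<Rightarrow> bool" where
  "reflect_odd e l g \<longleftrightarrow> (\<forall>x. g (reflect e l x) = - g x)"

lemma reflect_oddD: "reflect_odd e l g \<Longrightarrow> g (reflect e l x) = - g x"
  by (simp add: reflect_odd_def)

text \<open>
  For \<open>\<epsilon> > 0\<close> and \<open>g\<close> continuous, odd and vanishing at infinity, the part of \<open>g\<close> above \<open>\<epsilon>\<close> in the open
  half-space is a continuous function with compact support inside that half-space. This makes it an
  admissible test function, which the positive part of \<open>g\<close> itself need not be.
\<close>

definition excess :: "'a::euclidean_space \<Rightarrow> real \<Rightarrow> real \<Rightarrow> ('a \<Rightarrow> real) \<Rightarrow> 'a \<Rightarrow> real" where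
  "excess e l \<epsilon> g x = (if l < x \<bullet> e then max 0 (g x - \<epsilon>) else 0)"

lemma excess_nonneg [simp]: "0 \<le> excess e l \<epsilon> g x"
  by (simp add: excess_def)

lemma antisym_zero_on_plane:
  assumes "norm e = 1" "reflect_odd e l g" "x \<bullet> e = l"
  shows "g x = (0::real)"
  using reflect_oddD[OF assms(2), of x] reflect_fixed[OF assms(3)] by simp

lemma excess_closed_half:
  assumes "norm e = 1" "reflect_odd e l g" "0 < \<epsilon>" "l \<le> x \<bullet> e"
  shows "excess e l \<epsilon> g x = max 0 (g x - \<epsilon>)"
  using antisym_zero_on_plane[OF assms(1,2), of x] assms(3,4) by (auto simp: excess_def)

lemma excess_reflect_zero:
  assumes "norm e = 1" "l \<le> x \<bullet> e"
  shows "excess e l \<epsilon> g (reflect e l x) = 0"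
  using assms by (simp add: excess_def reflect_inner)

text \<open>
  Since \<open>g\<close> vanishes on the hyperplane and at infinity, the set where \<open>g \<ge> \<epsilon>\<close> in the half-space is compact
  and has positive distance to the hyperplane.
\<close>

lemma excess_support:
  fixes g :: "'a::euclidean_space \<Rightarrow> real"
  assumes e: "norm e = 1" and anti: "reflect_odd e l g" and eps: "0 < \<epsilon>"
    and c: "continuous_on UNIV g" and lim: "(g \<longlongrightarrow> 0) at_infinity"
  obtains R d where "0 < d" "\<And>x. excess e l \<epsilon> g x \<noteq> 0 \<Longrightarrow> norm x \<le> R \<and> l + d \<le> x \<bullet> e"
proof -
  define K where "K = {x. l \<le> x \<bullet> e} \<inter> {x. \<epsilon> \<le> g x}"
  have sub: "x \<in> K" if "excess e l \<epsilon> g x \<noteq> 0" for x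
    using that by (auto simp: excess_def K_def max_def split: if_splits)
  have "\<forall>\<^sub>F x in at_infinity. dist (g x) 0 < \<epsilon>" using lim eps by (rule tendstoD)
  then obtain R where R: "\<And>x. R \<le> norm x \<Longrightarrow> dist (g x) 0 < \<epsilon>" unfolding eventually_at_infinity by blast
  have KR: "norm x \<le> R" if "x \<in> K" for x using R[of x] that by (force simp: K_def)
  have cl: "closed {x. l \<le> x \<bullet> e}" "closed {x. \<epsilon> \<le> g x}"
    by (intro closed_Collect_le continuous_intros c)+
  have "compact K"
    unfolding compact_eq_bounded_closed K_def using cl KR by (auto simp: bounded_iff K_def intro!: exI[of _ R])
  show ?thesis
  proof (cases "K = {}")
    case True thus ?thesis using sub by (intro that[of 1 0]) auto
  next
    case False
    obtain x0 where x0: "x0 \<in> K" "\<And>x. x \<in> K \<Longrightarrow> x0 \<bullet> e \<le> x \<bullet> e"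
      using continuous_attains_inf[OF \<open>compact K\<close> False continuous_on_inner[OF continuous_on_id continuous_on_const[of _ e]]] by auto
    have "x0 \<bullet> e \<noteq> l" using x0(1) antisym_zero_on_plane[OF e anti, of x0] eps by (auto simp: K_def)
    hence "0 < x0 \<bullet> e - l" using x0(1) by (simp add: K_def)
    thus ?thesis using that[of "x0 \<bullet> e - l" R] sub KR x0(2) by auto
  qed
qed

lemma excess_continuous:
  fixes g :: "'a::euclidean_space \<Rightarrow> real"
  assumes e: "norm e = 1" and anti: "reflect_odd e l g" and eps: "0 < \<epsilon>"
    and c: "continuous_on UNIV g"
  shows "continuous_on UNIV (excess e l \<epsilon> g)"
proof -
  have "continuous_on ({x. l \<le> x \<bullet> e} \<union> {x. x \<bullet> e \<le> l}) (excess e l \<epsilon> g)"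
  proof (rule continuous_on_closed_Un)
    show "closed {x. l \<le> x \<bullet> e}" "closed {x. x \<bullet> e \<le> l}"
      by (intro closed_Collect_le continuous_intros)+
    have "continuous_on {x. l \<le> x \<bullet> e} (\<lambda>x. max 0 (g x - \<epsilon>))"
      using c by (intro continuous_intros) (auto intro: continuous_on_subset)
    thus "continuous_on {x. l \<le> x \<bullet> e} (excess e l \<epsilon> g)"
      by (rule continuous_on_eq) (simp add: excess_closed_half[OF e anti eps])
    have "continuous_on {x. x \<bullet> e \<le> l} (\<lambda>x. 0::real)" by simp
    thus "continuous_on {x. x \<bullet> e \<le> l} (excess e l \<epsilon> g)"
      by (rule continuous_on_eq) (simp add: excess_def)
  qed
  moreover have "{x. l \<le> x \<bullet> e} \<union> {x. x \<bullet> e \<le> l} = UNIV" by auto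
  ultimately show ?thesis by simp
qed

text \<open>
  Within each half-space the differences of the excess are controlled by those of \<open>g\<close>. Across the
  hyperplane the support keeps a positive distance \<open>d\<close>, so that the singularity of the kernel does not matter.
\<close>

lemma finite_energy_excess:
  fixes g :: "'a::euclidean_space \<Rightarrow> real"
  assumes s: "0 < s" "s < 1" and e: "norm e = 1" and anti: "reflect_odd e l g" and eps: "0 < \<epsilon>"
    and c: "continuous_on UNIV g" and lim: "(g \<longlongrightarrow> 0) at_infinity" and fe: "finite_energy s g"
  shows "finite_energy s (excess e l \<epsilon> g)"
proof -
  let ?\<phi> = "excess e l \<epsilon> g"
  obtain R d where Rd: "0 < d" "\<And>x. ?\<phi> x \<noteq> 0 \<Longrightarrow> norm x \<le> R \<and> l + d \<le> x \<bullet> e"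
    by (rule excess_support[OF e anti eps c lim]) (rule that; assumption)
  have cc: "continuous_on UNIV ?\<phi>" by (rule excess_continuous[OF e anti eps c])
  obtain M where M: "\<And>x. \<bar>?\<phi> x\<bar> \<le> M"
    by (rule continuous_supp_bounded[OF cc, of R]) (use Rd(2) in auto)
  define m where "m = min 1 (d\<^sup>2)"
  have m: "0 < m" using Rd(1) by (simp add: m_def)
  define C where "C = M\<^sup>2 / m"
  have C0: "0 \<le> C" using m by (simp add: C_def)
  have mixed: "(?\<phi> x)\<^sup>2 \<le> C * min 1 ((norm (x - y))\<^sup>2) * indicator (cball 0 R) x" if xy: "y \<bullet> e \<le> l" for x y
  proof (cases "?\<phi> x = 0")
    case True thus ?thesis using C0 by simp
  next
    case False
    have "d \<le> (x - y) \<bullet> e" using Rd(2)[OF False] xy by (simp add: inner_diff_left)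
    also have "\<dots> \<le> norm (x - y)" using norm_cauchy_schwarz[of "x - y" e] e by simp
    finally have "d\<^sup>2 \<le> (norm (x - y))\<^sup>2" using Rd(1) by (intro power_mono) auto
    hence "m \<le> min 1 ((norm (x - y))\<^sup>2)" by (auto simp: m_def)
    hence "C * m \<le> C * min 1 ((norm (x - y))\<^sup>2)" using C0 by (rule mult_left_mono)
    moreover have "(?\<phi> x)\<^sup>2 \<le> M\<^sup>2" using power_mono[OF M[of x], of 2] by simp
    moreover have "C * m = M\<^sup>2" using m by (simp add: C_def)
    moreover have "x \<in> cball 0 R" using Rd(2)[OF False] by simp
    ultimately show ?thesis by simp
  qed
  show ?thesis
  proof (rule finite_energy_compare[OF s _ fe bounded_cball[of 0 R] _ C0])
    show "?\<phi> \<in> borel_measurable borel" by (rule borel_measurable_continuous_onI[OF cc])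
    fix x y :: 'a
    let ?m = "min 1 ((norm (x - y))\<^sup>2)" and ?i = "indicator (cball 0 R) :: 'a \<Rightarrow> real"
    have i0: "0 \<le> C * ?m * ?i q" for q using C0 by simp
    consider "l \<le> x \<bullet> e" "l \<le> y \<bullet> e" | "l \<le> x \<bullet> e" "y \<bullet> e \<le> l" | "x \<bullet> e \<le> l" "l \<le> y \<bullet> e" | "x \<bullet> e \<le> l" "y \<bullet> e \<le> l"
      by linarith
    thus "(?\<phi> x - ?\<phi> y)\<^sup>2 \<le> (g x - g y)\<^sup>2 + C * ?m * (?i x + ?i y)"
    proof cases
      case 1
      have "\<bar>max 0 (g x - \<epsilon>) - max 0 (g y - \<epsilon>)\<bar> \<le> \<bar>g x - g y\<bar>" by linarith
      hence "\<bar>?\<phi> x - ?\<phi> y\<bar> \<le> \<bar>g x - g y\<bar>" using 1 by (simp add: excess_closed_half[OF e anti eps])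
      hence "(?\<phi> x - ?\<phi> y)\<^sup>2 \<le> (g x - g y)\<^sup>2" by (simp add: abs_le_square_iff)
      thus ?thesis using i0[of x] i0[of y] by (simp add: distrib_left)
    next
      case 2
      hence "?\<phi> y = 0" by (simp add: excess_def)
      hence "(?\<phi> x - ?\<phi> y)\<^sup>2 = (?\<phi> x)\<^sup>2" by simp
      thus ?thesis using mixed[OF 2(2), of x] i0[of y] zero_le_power2[of "g x - g y"]
        unfolding distrib_left by linarith
    next
      case 3
      hence "?\<phi> x = 0" by (simp add: excess_def)
      hence "(?\<phi> x - ?\<phi> y)\<^sup>2 = (?\<phi> y)\<^sup>2" by simp
      thus ?thesis using mixed[OF 3(1), of y, unfolded norm_minus_commute[of y x]] i0[of x] zero_le_power2[of "g x - g y"]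
        unfolding distrib_left by linarith
    next
      case 4
      hence "?\<phi> x = 0" "?\<phi> y = 0" by (simp_all add: excess_def)
      thus ?thesis using i0[of x] i0[of y] by (simp add: distrib_left)
    qed
  qed simp
qed

text \<open>
  The excess is a nondecreasing function of \<open>g\<close> on the closed half-space, and the direct kernel
  dominates the reflected one there.
\<close>

lemma excess_interaction_nonneg:
  fixes g :: "'a::euclidean_space \<Rightarrow> real"
  assumes s: "0 < s" and e: "norm e = 1" and anti: "reflect_odd e l g" and eps: "0 < \<epsilon>"
    and xy: "l \<le> x \<bullet> e" "l \<le> y \<bullet> e"
  shows "0 \<le> (g x - g y) * (excess e l \<epsilon> g x - excess e l \<epsilon> g y) * (kern s (x - y) - kern s (x - reflect e l y))"
proof (cases "x = y")
  case False
  have "0 \<le> (g x - g y) * (excess e l \<epsilon> g x - excess e l \<epsilon> g y)"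
    unfolding excess_closed_half[OF e anti eps xy(1)] excess_closed_half[OF e anti eps xy(2)]
    by (cases "g x \<le> g y") (auto intro: mult_nonneg_nonneg mult_nonpos_nonpos)
  moreover have "0 \<le> kern s (x - y) - kern s (x - reflect e l y)"
    using False kern_mono[OF s, of "x - y" "x - reflect e l y"] norm_reflect_ge[OF e xy] by simp
  ultimately show ?thesis by (rule mult_nonneg_nonneg)
qed simp

lemma mult_excess_nonneg: "0 < \<epsilon> \<Longrightarrow> 0 \<le> g x * excess e l \<epsilon> g x"
  by (auto simp: excess_def max_def)

lemma excess_reflected_nonneg:
  assumes "0 < \<epsilon>"
  shows "0 \<le> 2 * (g x * excess e l \<epsilon> g x + g y * excess e l \<epsilon> g y) * kern s z"
  using mult_excess_nonneg[OF assms, of g x e l] mult_excess_nonneg[OF assms, of g y e l]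
  by (intro mult_nonneg_nonneg) simp_all

text \<open>
  Replacing \<open>x\<close> or \<open>y\<close> by its mirror image does not change the integral of \<open>G\<close>, the energy density, so
  the integral of \<open>G\<close> is a quarter of that of its orbit sum \<open>S\<close>. On pairs of points of the closed
  half-space, oddness of \<open>g\<close> turns \<open>S\<close> into the right-hand side of the last hypothesis, which is
  nonnegative; by invariance \<open>S\<close> is then nonnegative everywhere. Hence every nonnegative \<open>F\<close> below \<open>S\<close> on such
  pairs, and zero elsewhere, bounds the energy from below.
\<close>

lemma energy_excess_lower_bound:
  fixes g :: "'a::euclidean_space \<Rightarrow> real" and F :: "'a \<times> 'a \<Rightarrow> real"
  assumes s: "0 < s" and cp: "0 < c" and e: "norm e = 1" and anti: "reflect_odd e l g" and eps: "0 < \<epsilon>"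
    and fe: "finite_energy s g" and fc: "finite_energy s (excess e l \<epsilon> g)"
    and Fm: "F \<in> borel_measurable lborel2" and F0: "\<And>z. 0 \<le> F z"
    and Fout: "\<And>x y. x \<bullet> e < l \<or> y \<bullet> e < l \<Longrightarrow> F (x, y) = 0"
    and F: "\<And>x y. l \<le> x \<bullet> e \<Longrightarrow> l \<le> y \<bullet> e \<Longrightarrow>
       F (x, y) \<le> (g x - g y) * (excess e l \<epsilon> g x - excess e l \<epsilon> g y) * (kern s (x - y) - kern s (x - reflect e l y))
         + 2 * (g x * excess e l \<epsilon> g x + g y * excess e l \<epsilon> g y) * kern s (x - reflect e l y)"
  shows "integrable lborel2 F \<and>
    c / 8 * (\<integral>z. F z \<partial>lborel2) \<le> energy_form c s g (excess e l \<epsilon> g)"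
proof -
  let ?\<phi> = "excess e l \<epsilon> g" and ?R = "reflect e l"
  define G where "G z = dq s g z * dq s ?\<phi> z" for z
  have G: "G (x, y) = (g x - g y) * (?\<phi> x - ?\<phi> y) * kern s (x - y)" for x y
    unfolding G_def dq_mult by simp
  have Gi: "integrable lborel2 G" unfolding G_def using fe fc by (rule finite_energy_integrable_mult)
  define S where "S z = G z + G (?R (fst z), snd z) + G (fst z, ?R (snd z)) + G (?R (fst z), ?R (snd z))" for z
  note i1 = pair_reflect_integral(1,2)[OF e Gi, of l] and i2 = pair_reflect_integral(3,4)[OF e Gi, of l]
  have i3: "integrable lborel2 (\<lambda>z. G (?R (fst z), ?R (snd z)))"
    "(\<integral>z. G (?R (fst z), ?R (snd z)) \<partial>lborel2) = (\<integral>z. G z \<partial>lborel2)"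
    using pair_reflect_integral(1,2)[OF e i2(1), of l] i2(2) by simp_all
  have Si: "integrable lborel2 S" unfolding S_def using Gi i1(1) i2(1) i3(1) by auto
  have Sint: "(\<integral>z. S z \<partial>lborel2) = 4 * (\<integral>z. G z \<partial>lborel2)"
    unfolding S_def using Gi i1 i2 i3 by simp
  have SR1: "S (?R x, y) = S (x, y)" and SR2: "S (x, ?R y) = S (x, y)" for x y
    using e by (simp_all add: S_def)
  have Sid: "S (x, y) = (g x - g y) * (?\<phi> x - ?\<phi> y) * (kern s (x - y) - kern s (x - ?R y))
         + 2 * (g x * ?\<phi> x + g y * ?\<phi> y) * kern s (x - ?R y)" if xy: "l \<le> x \<bullet> e" "l \<le> y \<bullet> e" for x y
  proof -
    have k: "kern s (?R x - y) = kern s (x - ?R y)" "kern s (?R x - ?R y) = kern s (x - y)"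
      by (intro kern_cong norm_reflect_swap[OF e] norm_reflect_diff[OF e])+
    have z: "?\<phi> (?R x) = 0" "?\<phi> (?R y) = 0" using xy by (simp_all add: excess_reflect_zero[OF e])
    show ?thesis unfolding S_def fst_conv snd_conv G k z reflect_oddD[OF anti] by (simp add: algebra_simps)
  qed
  have Spos: "0 \<le> S (x, y)" if xy: "l \<le> x \<bullet> e" "l \<le> y \<bullet> e" for x y
  proof -
    have "0 \<le> 2 * (g x * ?\<phi> x + g y * ?\<phi> y) * kern s (x - ?R y)"
      by (rule excess_reflected_nonneg[OF eps])
    thus ?thesis unfolding Sid[OF xy] using excess_interaction_nonneg[OF s e anti eps xy] by simp
  qed
  have FS: "F z \<le> S z" for z
  proof -
    obtain x y where z: "z = (x, y)" by (cases z)
    \<comment> \<open>representatives in the closed half-space of the orbits of \<open>x\<close> and \<open>y\<close>\<close>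
    define x' y' where "x' = (if l \<le> x \<bullet> e then x else ?R x)" and "y' = (if l \<le> y \<bullet> e then y else ?R y)"
    have h: "l \<le> x' \<bullet> e" "l \<le> y' \<bullet> e" by (simp_all add: x'_def y'_def reflect_inner[OF e])
    have S': "S (x', y') = S (x, y)" by (simp add: x'_def y'_def SR1 SR2)
    show ?thesis
    proof (cases "l \<le> x \<bullet> e \<and> l \<le> y \<bullet> e")
      case True
      thus ?thesis using F[of x y] Sid[of x y] z by simp
    next
      case False
      hence "F (x, y) = 0" using Fout[of x y] by auto
      thus ?thesis using Spos[OF h] S' z by simp
    qed
  qed
  have Fi: "integrable lborel2 F"
  proof (rule Bochner_Integration.integrable_bound[OF Si Fm], rule AE_I2)
    fix z show "norm (F z) \<le> norm (S z)" using FS[of z] F0[of z] by simp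
  qed
  have "(\<integral>z. F z \<partial>lborel2) \<le> (\<integral>z. S z \<partial>lborel2)"
    by (rule integral_mono[OF Fi Si FS])
  hence "c / 8 * (\<integral>z. F z \<partial>lborel2) \<le> c / 8 * (4 * (\<integral>z. G z \<partial>lborel2))"
    unfolding Sint using cp by (intro mult_left_mono) auto
  with Fi show ?thesis unfolding energy_form_dq G_def[symmetric] by simp
qed

section \<open>The maximum principle in narrow regions\<close>

lemma tendsto_at_infinity_reflect:
  fixes u :: "'a::euclidean_space \<Rightarrow> real"
  assumes e: "norm e = 1" and u: "(u \<longlongrightarrow> 0) at_infinity"
  shows "((\<lambda>x. u (reflect e l x)) \<longlongrightarrow> 0) at_infinity"
proof (rule tendstoI)
  fix \<epsilon> :: real assume "0 < \<epsilon>"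
  from tendstoD[OF u this] obtain R where R: "\<And>x. R \<le> norm x \<Longrightarrow> dist (u x) 0 < \<epsilon>"
    unfolding eventually_at_infinity by blast
  have "R \<le> norm (reflect e l x)" if "R + norm (reflect e l 0) \<le> norm x" for x
    using norm_reflect_diff[OF e, of l x 0] norm_triangle_ineq4[of "reflect e l x" "reflect e l 0"] that by simp
  thus "\<forall>\<^sub>F x in at_infinity. dist (u (reflect e l x)) 0 < \<epsilon>"
    unfolding eventually_at_infinity using R by blast
qed

text \<open>
  The solution with the properties that the moving plane argument uses. The constant \<open>L\<close> is a Lipschitz
  constant of \<open>f\<close> on the range of values of \<open>u\<close>.
\<close>

locale fractional_solution =
  fixes c s :: real and f :: "real \<Rightarrow> real" and u :: "'a::euclidean_space \<Rightarrow> real" and t0 M L :: real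
  assumes c: "0 < c" and s: "0 < s" "s < 1"
    and u_cont: "continuous_on UNIV u" and u_nonneg: "\<And>x. 0 \<le> u x" and u_le: "\<And>x. u x \<le> M"
    and u_lim: "(u \<longlongrightarrow> 0) at_infinity" and u_energy: "finite_energy s u"
    and weak: "\<And>v R. continuous_on UNIV v \<Longrightarrow> {x. v x \<noteq> 0} \<subseteq> cball 0 R \<Longrightarrow> finite_energy s v \<Longrightarrow>
        energy_form c s u v = (\<integral>x. f (u x) * v x \<partial>lborel)"
    and f_cont: "continuous_on UNIV f" and L_nonneg: "0 \<le> L"
    and f_lip: "\<And>a b. a \<in> {0..M} \<Longrightarrow> b \<in> {0..M} \<Longrightarrow> \<bar>f a - f b\<bar> \<le> L * \<bar>a - b\<bar>"
    and f_mono: "\<And>a b. 0 \<le> a \<Longrightarrow> a \<le> b \<Longrightarrow> b \<le> t0 \<Longrightarrow> f b \<le> f a"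
    and t0: "0 < t0" and u_nonzero: "\<exists>x. u x \<noteq> 0"
begin

definition gap :: "'a \<Rightarrow> real \<Rightarrow> 'a \<Rightarrow> real" where
  "gap e l x = u x - u (reflect e l x)"

lemma u_reflect_cont: "continuous_on UNIV (\<lambda>x. u (reflect e l x))"
  by (rule continuous_on_compose2[OF u_cont]) (auto intro: continuous_intros)

lemma gap_cont: "continuous_on UNIV (gap e l)"
  unfolding gap_def by (intro continuous_intros u_cont u_reflect_cont)

lemma gap_odd: "norm e = 1 \<Longrightarrow> reflect_odd e l (gap e l)"
  by (simp add: reflect_odd_def gap_def)

lemma gap_lim: "norm e = 1 \<Longrightarrow> (gap e l \<longlongrightarrow> 0) at_infinity"
  unfolding gap_def using tendsto_diff[OF u_lim tendsto_at_infinity_reflect[OF _ u_lim]] by simp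

lemma gap_energy: "norm e = 1 \<Longrightarrow> finite_energy s (gap e l)"
  unfolding gap_def by (intro finite_energy_diff u_energy finite_energy_reflect)

lemma gap_equation:
  assumes e: "norm e = 1" and v: "continuous_on UNIV v" "{x. v x \<noteq> 0} \<subseteq> cball 0 R" "finite_energy s v"
  shows "energy_form c s (gap e l) v = (\<integral>x. (f (u x) - f (u (reflect e l x))) * v x \<partial>lborel)"
    and "integrable lborel (\<lambda>x. (f (u x) - f (u (reflect e l x))) * v x)"
proof -
  let ?R = "reflect e l"
  have fu: "continuous_on UNIV (\<lambda>x. f (u x))" "continuous_on UNIV (\<lambda>x. f (u (?R x)))"
    by (rule continuous_on_compose2[OF f_cont u_cont] continuous_on_compose2[OF f_cont u_reflect_cont]; simp)+
  have i: "integrable lborel (\<lambda>x. f (u x) * v x)" "integrable lborel (\<lambda>x. f (u (?R x)) * v x)"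
    by (rule integrable_continuous_supp[of _ R]; use v fu in \<open>auto intro!: continuous_intros\<close>)+
  have "energy_form c s (\<lambda>x. u (?R x)) v = energy_form c s u (\<lambda>x. v (?R x))"
    by (rule energy_form_reflect[OF e u_energy v(3)])
  also have "\<dots> = (\<integral>x. f (u x) * v (?R x) \<partial>lborel)"
  proof (rule weak)
    show "continuous_on UNIV (\<lambda>x. v (?R x))"
      by (rule continuous_on_compose2[OF v(1)]) (auto intro: continuous_intros)
    show "{x. v (?R x) \<noteq> 0} \<subseteq> cball 0 (R + norm (?R 0))"
    proof
      fix x assume "x \<in> {x. v (?R x) \<noteq> 0}"
      hence "norm (?R x) \<le> R" using v(2) by auto
      thus "x \<in> cball 0 (R + norm (?R 0))"
        using norm_reflect_diff[OF e, of l x 0] norm_triangle_ineq4[of "?R x" "?R 0"] by simp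
    qed
    show "finite_energy s (\<lambda>x. v (?R x))" by (rule finite_energy_reflect[OF e v(3)])
  qed
  also have "\<dots> = (\<integral>x. f (u (?R x)) * v x \<partial>lborel)"
  proof -
    have "(\<lambda>x. f (u (?R x)) * v x) \<in> borel_measurable borel"
      using fu v by (intro borel_measurable_continuous_onI continuous_intros)
    from integral_reflect_eq[OF e this, of l] show ?thesis using e by simp
  qed
  finally have 1: "energy_form c s (\<lambda>x. u (?R x)) v = (\<integral>x. f (u (?R x)) * v x \<partial>lborel)" .
  have "energy_form c s (gap e l) v = energy_form c s u v - energy_form c s (\<lambda>x. u (?R x)) v"
    unfolding gap_def by (intro energy_form_diff_left u_energy finite_energy_reflect e v)
  also have "\<dots> = (\<integral>x. f (u x) * v x \<partial>lborel) - (\<integral>x. f (u (?R x)) * v x \<partial>lborel)"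
    using weak[OF v] 1 by simp
  also have "\<dots> = (\<integral>x. (f (u x) - f (u (?R x))) * v x \<partial>lborel)"
    using i by (simp add: left_diff_distrib)
  finally show "energy_form c s (gap e l) v = (\<integral>x. (f (u x) - f (u (?R x))) * v x \<partial>lborel)" .
  show "integrable lborel (\<lambda>x. (f (u x) - f (u (reflect e l x))) * v x)"
    using i by (simp add: left_diff_distrib)
qed

end

text \<open>
  The coercivity constant of the energy on a strip of width \<open>\<delta>\<close> along the hyperplane; by scaling it is a
  constant times \<open>\<delta> powr (- 2 * s)\<close>. The first argument only fixes the space, hence its dimension.
\<close>

definition strip_rate :: "'a::euclidean_space itself \<Rightarrow> real \<Rightarrow> real \<Rightarrow> real \<Rightarrow> real" where
  "strip_rate T c s \<delta> = c / 4 * measure lborel (ball (0::'a) \<delta>) / (8 * \<delta>) powr (real DIM('a) + 2 * s)"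

lemma strip_rate_pos: "0 < c \<Longrightarrow> 0 < \<delta> \<Longrightarrow> 0 < strip_rate TYPE('a::euclidean_space) c s \<delta>"
  unfolding strip_rate_def by (intro divide_pos_pos mult_pos_pos) (auto simp: content_ball_pos)

lemma strip_rate_large:
  assumes c: "0 < c" and s: "0 < s"
  obtains \<delta> where "0 < \<delta>" "L < strip_rate TYPE('a::euclidean_space) c s \<delta>"
proof -
  define n where "n = real DIM('a)"
  define a where "a = c / 4 * unit_ball_vol n / 8 powr (n + 2 * s)"
  have a: "0 < a" using c by (simp add: a_def n_def)
  have rate: "strip_rate TYPE('a) c s \<delta> = a / \<delta> powr (2 * s)" if d: "0 < \<delta>" for \<delta>
  proof -
    have "measure lborel (ball (0::'a) \<delta>) = unit_ball_vol n * \<delta> powr n"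
      using d by (simp add: content_ball n_def powr_realpow)
    thus ?thesis using d unfolding strip_rate_def a_def n_def[symmetric]
      by (simp add: powr_mult powr_add field_simps)
  qed
  define b where "b = \<bar>L\<bar> + 1"
  have b: "0 < b" "L < b" by (auto simp: b_def)
  define \<delta> where "\<delta> = (a / b) powr (1 / (2 * s))"
  have d: "0 < \<delta>" using a b by (simp add: \<delta>_def)
  have "\<delta> powr (2 * s) = a / b" using a b s by (simp add: \<delta>_def powr_powr)
  hence "strip_rate TYPE('a) c s \<delta> = b" using rate[OF d] a b by simp
  thus ?thesis using that[OF d] b by simp
qed

text \<open>
  A point \<open>x\<close> of the strip sees the ball \<open>B(x + \<delta> e, \<delta>)\<close>, which lies in the half-space, and the mirror
  image of every point of this ball is at distance at most \<open>8 \<delta>\<close> from \<open>x\<close>. The reflected kernel in the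
  folded energy therefore contributes a zero-order term with a coefficient of size \<open>\<delta> powr (- 2 * s)\<close>.
\<close>

lemma strip_energy_bound:
  fixes g :: "'a::euclidean_space \<Rightarrow> real"
  assumes s: "0 < s" "s < 1" and c: "0 < c" and e: "norm e = 1" and odd: "reflect_odd e l g" and eps: "0 < \<epsilon>"
    and cont: "continuous_on UNIV g" and lim: "(g \<longlongrightarrow> 0) at_infinity" and fe: "finite_energy s g" and d: "0 < \<delta>"
  shows "strip_rate TYPE('a) c s \<delta> * (\<integral>x. g x * excess e l \<epsilon> g x * indicator {x. x \<bullet> e < l + \<delta>} x \<partial>lborel)
    \<le> energy_form c s g (excess e l \<epsilon> g)"
proof -
  let ?\<phi> = "excess e l \<epsilon> g"
  define k where "k = 1 / (8 * \<delta>) powr (real DIM('a) + 2 * s)"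
  have k0: "0 \<le> k" by (simp add: k_def)
  define q where "q x = g x * ?\<phi> x * indicator {x. x \<bullet> e < l + \<delta>} x" for x
  have q0: "0 \<le> q x" for x unfolding q_def by (rule mult_nonneg_nonneg[OF mult_excess_nonneg[OF eps]]) simp
  have fc: "finite_energy s ?\<phi>" by (rule finite_energy_excess[OF s e odd eps cont lim fe])
  note [measurable] = fe fc
  have [measurable]: "q \<in> borel_measurable borel" unfolding q_def by measurable
  define near :: "'a \<times> 'a \<Rightarrow> real" where "near z = (if norm (snd z - (fst z + \<delta> *\<^sub>R e)) < \<delta> then 1 else 0)" for z
  define F where "F z = 2 * k * q (fst z) * near z" for z
  have near_inner: "x \<bullet> e < y \<bullet> e \<and> y \<bullet> e < x \<bullet> e + 2 * \<delta> \<and> norm (x - reflect e l y) \<le> 8 * \<delta>"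
    if "near (x, y) \<noteq> 0" "l \<le> x \<bullet> e" "x \<bullet> e < l + \<delta>" for x y
  proof -
    define v where "v = y - (x + \<delta> *\<^sub>R e)"
    have v: "norm v < \<delta>" "y = x + \<delta> *\<^sub>R e + v" using that by (auto simp: near_def v_def split: if_splits)
    have "\<bar>v \<bullet> e\<bar> \<le> norm v" by (rule abs_inner_le_norm[OF e])
    hence ve: "\<bar>v \<bullet> e\<bar> < \<delta>" using v by simp
    have ye: "y \<bullet> e = x \<bullet> e + \<delta> + v \<bullet> e" unfolding v(2) by (simp add: inner_add_left norm_one_inner[OF e])
    have "x - reflect e l y = (2 * (y \<bullet> e - l) - \<delta>) *\<^sub>R e - v"
      by (simp add: reflect_def v(2) algebra_simps)
    hence "norm (x - reflect e l y) \<le> \<bar>2 * (y \<bullet> e - l) - \<delta>\<bar> + norm v"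
      using norm_triangle_ineq4[of "(2 * (y \<bullet> e - l) - \<delta>) *\<^sub>R e" v] e by simp
    thus ?thesis using ye ve v(1) that(2,3) by auto
  qed
  have "integrable lborel2 F \<and> c / 8 * (\<integral>z. F z \<partial>lborel2) \<le> energy_form c s g ?\<phi>"
  proof (rule energy_excess_lower_bound[OF s(1) c e odd eps fe fc])
    show "F \<in> borel_measurable lborel2" unfolding F_def near_def by measurable
    show "0 \<le> F z" for z unfolding F_def using k0 q0 by (simp add: near_def)
    show "F (x, y) = 0" if "x \<bullet> e < l \<or> y \<bullet> e < l" for x y
    proof (rule ccontr)
      assume nz: "F (x, y) \<noteq> 0"
      hence "?\<phi> x \<noteq> 0" "x \<bullet> e < l + \<delta>" "near (x, y) \<noteq> 0" by (auto simp: F_def q_def indicator_def split: if_splits)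
      moreover from this have "l < x \<bullet> e" by (auto simp: excess_def split: if_splits)
      ultimately show False using near_inner[of x y] that by auto
    qed
    show "F (x, y) \<le> (g x - g y) * (?\<phi> x - ?\<phi> y) * (kern s (x - y) - kern s (x - reflect e l y))
         + 2 * (g x * ?\<phi> x + g y * ?\<phi> y) * kern s (x - reflect e l y)" if xy: "l \<le> x \<bullet> e" "l \<le> y \<bullet> e" for x y
    proof -
      have "F (x, y) \<le> 2 * (g x * ?\<phi> x + g y * ?\<phi> y) * kern s (x - reflect e l y)"
      proof (cases "F (x, y) = 0")
        case True
        have "0 \<le> 2 * (g x * ?\<phi> x + g y * ?\<phi> y) * kern s (x - reflect e l y)"
          by (rule excess_reflected_nonneg[OF eps])
        thus ?thesis using True by simp
      next
        case False
        hence st: "x \<bullet> e < l + \<delta>" "near (x, y) \<noteq> 0" by (auto simp: F_def q_def indicator_def split: if_splits)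
        note n = near_inner[OF st(2) xy(1) st(1)]
        have ne: "x - reflect e l y \<noteq> 0"
        proof
          assume "x - reflect e l y = 0"
          hence "x \<bullet> e = 2 * l - y \<bullet> e" by (simp add: reflect_inner[OF e])
          thus False using n xy by linarith
        qed
        have "k \<le> kern s (x - reflect e l y)"
          unfolding k_def kern_def using ne n s by (intro divide_left_mono powr_mono2 mult_pos_pos) auto
        hence "(2 * (g x * ?\<phi> x)) * k \<le> (2 * (g x * ?\<phi> x + g y * ?\<phi> y)) * kern s (x - reflect e l y)"
          using k0 mult_excess_nonneg[OF eps, of g x e l] mult_excess_nonneg[OF eps, of g y e l] by (intro mult_mono) simp_all
        moreover have "F (x, y) = 2 * (g x * ?\<phi> x) * k" using st by (simp add: F_def q_def near_def split: if_splits)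
        ultimately show ?thesis by simp
      qed
      thus ?thesis using excess_interaction_nonneg[OF s(1) e odd eps xy] by linarith
    qed
  qed
  hence Fi: "integrable lborel2 F" and le: "c / 8 * (\<integral>z. F z \<partial>lborel2) \<le> energy_form c s g ?\<phi>"
    by auto
  have "(\<integral>z. F z \<partial>lborel2) = (\<integral>x. \<integral>y. F (x, y) \<partial>lborel \<partial>lborel)"
    by (rule lborel_pair.integral_fst'[OF Fi, symmetric])
  also have "\<dots> = (\<integral>x. 2 * k * measure lborel (ball (0::'a) \<delta>) * q x \<partial>lborel)"
  proof (rule Bochner_Integration.integral_cong[OF HOL.refl])
    fix x :: 'a
    have "(\<integral>y. F (x, y) \<partial>lborel) = 2 * k * q x * (\<integral>y. indicator (ball (x + \<delta> *\<^sub>R e) \<delta>) y \<partial>lborel)"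
      unfolding F_def fst_conv
      by (subst Bochner_Integration.integral_mult_right_zero[symmetric], rule Bochner_Integration.integral_cong)
         (auto simp: near_def indicator_def dist_norm norm_minus_commute)
    also have "(\<integral>y. indicator (ball (x + \<delta> *\<^sub>R e) \<delta>) y \<partial>lborel) = measure lborel (ball (x + \<delta> *\<^sub>R e) \<delta>)" by simp
    also have "\<dots> = measure lborel (ball (0::'a) \<delta>)" using d by (simp add: content_ball)
    finally show "(\<integral>y. F (x, y) \<partial>lborel) = 2 * k * measure lborel (ball (0::'a) \<delta>) * q x" by simp
  qed
  also have "\<dots> = 2 * k * measure lborel (ball (0::'a) \<delta>) * (\<integral>x. q x \<partial>lborel)" by simp
  finally show ?thesis using le unfolding strip_rate_def k_def q_def by simp
qed

context fractional_solution
begin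

text \<open>
  Test the equation of the gap with its excess. Where \<open>u \<le> t0\<close> the monotonicity of \<open>f\<close> makes the right-hand
  side nonpositive, and elsewhere the point lies in the strip, where \<open>L\<close> is smaller than the coercivity
  constant. So the excess vanishes on the strip, hence the energy is nonpositive, and then the same
  coercivity on a strip that contains the whole support shows that the excess vanishes.
\<close>

lemma gap_nonpos_narrow:
  assumes e: "norm e = 1" and d: "0 < \<delta>" and rate: "L < strip_rate TYPE('a) c s \<delta>"
    and narrow: "\<And>x. l < x \<bullet> e \<Longrightarrow> u (reflect e l x) < u x \<Longrightarrow> u x \<le> t0 \<or> x \<bullet> e < l + \<delta>"
    and x: "l < x \<bullet> e"
  shows "u x \<le> u (reflect e l x)"
proof (rule field_le_epsilon)
  fix \<epsilon> :: real assume eps: "0 < \<epsilon>"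
  let ?w = "gap e l"
  let ?\<phi> = "excess e l \<epsilon> ?w"
  note gap_facts = gap_odd[OF e, of l] eps gap_cont[of e l] gap_lim[OF e, of l]
  have fc: "finite_energy s ?\<phi>" by (rule finite_energy_excess[OF s e gap_facts gap_energy[OF e]])
  have cc: "continuous_on UNIV ?\<phi>" by (rule excess_continuous[OF e gap_facts(1-3)])
  obtain R D where R: "\<And>x. ?\<phi> x \<noteq> 0 \<Longrightarrow> norm x \<le> R"
    by (rule excess_support[OF e gap_facts]) (use that in blast)
  have supp: "{x. ?\<phi> x \<noteq> 0} \<subseteq> cball 0 R" using R by auto
  define q where "q x = ?w x * ?\<phi> x" for x
  have q0: "0 \<le> q x" for x unfolding q_def by (rule mult_excess_nonneg[OF eps])
  have qc: "continuous_on UNIV q" unfolding q_def by (intro continuous_intros gap_cont cc)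
  have qi: "integrable lborel q" by (rule integrable_continuous_supp[OF qc, of R]) (use supp in \<open>auto simp: q_def\<close>)
  define I where "I \<delta> = (\<integral>x. q x * indicator {x. x \<bullet> e < l + \<delta>} x \<partial>lborel)" for \<delta>
  have I0: "0 \<le> I \<delta>" for \<delta> unfolding I_def using q0 by (intro integral_nonneg_AE) auto
  have Ii: "integrable lborel (\<lambda>x. q x * indicator {x. x \<bullet> e < l + \<delta>} x)" for \<delta>
    by (rule integrable_real_mult_indicator[OF _ qi]) measurable
  have lower: "strip_rate TYPE('a) c s \<eta> * I \<eta> \<le> energy_form c s ?w ?\<phi>" if "0 < \<eta>" for \<eta>
    unfolding I_def q_def by (rule strip_energy_bound[OF s c e gap_facts gap_energy[OF e] that])
  have upper: "energy_form c s ?w ?\<phi> \<le> L * I \<delta>"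
  proof -
    have "(\<integral>x. (f (u x) - f (u (reflect e l x))) * ?\<phi> x \<partial>lborel)
       \<le> (\<integral>x. L * (q x * indicator {x. x \<bullet> e < l + \<delta>} x) \<partial>lborel)"
    proof (rule integral_mono)
      fix y
      have rhs: "0 \<le> L * (q y * indicator {x. x \<bullet> e < l + \<delta>} y)" using L_nonneg q0 by simp
      show "(f (u y) - f (u (reflect e l y))) * ?\<phi> y \<le> L * (q y * indicator {x. x \<bullet> e < l + \<delta>} y)"
      proof (cases "?\<phi> y = 0")
        case False
        hence y: "l < y \<bullet> e" "\<epsilon> < ?w y" by (auto simp: excess_def max_def split: if_splits)
        hence lt: "u (reflect e l y) < u y" using eps by (simp add: gap_def)
        consider "u y \<le> t0" | "y \<bullet> e < l + \<delta>" using narrow[OF y(1) lt] by blast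
        thus ?thesis
        proof cases
          case 1
          hence "f (u y) \<le> f (u (reflect e l y))" using lt u_nonneg by (intro f_mono) auto
          hence "(f (u y) - f (u (reflect e l y))) * ?\<phi> y \<le> 0" by (simp add: mult_nonpos_nonneg)
          thus ?thesis using rhs by linarith
        next
          case 2
          have "f (u y) - f (u (reflect e l y)) \<le> L * ?w y"
            using f_lip[of "u y" "u (reflect e l y)"] u_nonneg u_le lt by (simp add: gap_def)
          hence "(f (u y) - f (u (reflect e l y))) * ?\<phi> y \<le> L * ?w y * ?\<phi> y" by (intro mult_right_mono) auto
          thus ?thesis using 2 by (simp add: q_def)
        qed
      qed (use rhs in simp)
    qed (use Ii gap_equation(2)[OF e cc supp fc] in auto)
    thus ?thesis unfolding gap_equation(1)[OF e cc supp fc] I_def by simp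
  qed
  have "(strip_rate TYPE('a) c s \<delta> - L) * I \<delta> \<le> 0" using lower[OF d] upper by (simp add: left_diff_distrib)
  hence "I \<delta> \<le> 0" using rate by (simp add: mult_le_0_iff)
  hence "I \<delta> = 0" using I0[of \<delta>] by simp
  hence E: "energy_form c s ?w ?\<phi> \<le> 0" using upper by simp
  \<comment> \<open>a strip of this width contains the support of the excess\<close>
  define W where "W = \<bar>R\<bar> + \<bar>l\<bar> + 1"
  have W: "0 < W" by (simp add: W_def)
  have "q x * indicator {x. x \<bullet> e < l + W} x = q x" for x
  proof (cases "q x = 0")
    case False
    hence "norm x \<le> R" using R[of x] by (auto simp: q_def)
    moreover have "x \<bullet> e \<le> norm x" using norm_cauchy_schwarz[of x e] e by simp
    ultimately show ?thesis by (simp add: W_def)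
  qed simp
  hence "(\<lambda>x. q x * indicator {x. x \<bullet> e < l + W} x) = q" by (rule ext)
  hence IW: "I W = (\<integral>x. q x \<partial>lborel)" by (simp only: I_def)
  have "strip_rate TYPE('a) c s W * I W \<le> 0" using lower[OF W] E by linarith
  hence "I W \<le> 0" using strip_rate_pos[OF c W, where 'a = 'a, of s] by (simp add: mult_le_0_iff)
  hence "q x = 0" unfolding IW by (rule continuous_integral_zero[OF qc q0 qi])
  hence "?w x \<le> \<epsilon>" using x eps by (auto simp: q_def excess_def max_def split: if_splits)
  thus "u x \<le> u (reflect e l x) + \<epsilon>" by (simp add: gap_def)
qed

end

section \<open>The strong maximum principle\<close>

lemma distr_shear:
  "distr lborel2 lborel2 (\<lambda>z::'a::euclidean_space \<times> 'a. (fst z, fst z + snd z))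
     = (lborel2 :: ('a \<times> 'a) measure)"
proof (rule measure_eqI)
  let ?T = "\<lambda>z::'a \<times> 'a. (fst z, fst z + snd z)"
  have Tm: "?T \<in> measurable lborel2 lborel2" by measurable
  fix A assume "A \<in> sets (distr lborel2 lborel2 ?T)"
  hence A: "A \<in> sets (lborel2 :: ('a \<times> 'a) measure)" by simp
  hence A' [measurable]: "A \<in> sets (borel \<Otimes>\<^sub>M borel)" by (simp cong: sets_pair_measure_cong)
  have "emeasure (distr lborel2 lborel2 ?T) A
     = (\<integral>\<^sup>+ z. indicator A (?T z) \<partial>lborel2)"
    using A Tm by (subst nn_integral_indicator[symmetric], simp, subst nn_integral_distr) auto
  also have "\<dots> = (\<integral>\<^sup>+ x. \<integral>\<^sup>+ h. indicator A (x, x + h) \<partial>lborel \<partial>lborel)"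
    by (subst lborel.nn_integral_fst[symmetric]) auto
  also have "\<dots> = (\<integral>\<^sup>+ x. \<integral>\<^sup>+ y. indicator A (x, y) \<partial>lborel \<partial>lborel)"
    by (rule nn_integral_cong, rule nn_integral_translate(1)) measurable
  also have "\<dots> = (\<integral>\<^sup>+ z. indicator A z \<partial>lborel2)"
    using A by (subst lborel.nn_integral_fst) auto
  finally show "emeasure (distr lborel2 lborel2 ?T) A = emeasure lborel2 A"
    using A by simp
qed simp

text \<open>
  Shearing to \<open>y = x + h\<close> and translating the terms with \<open>\<phi> (x + h)\<close> back turns the inner integral, for fixed
  \<open>h\<close>, into \<open>\<phi>\<close> against \<open>2 \<psi>(x) - \<psi>(x + h) - \<psi>(x - h)\<close>. An upper bound of order \<open>|h|\<^sup>2\<close> for it makes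
  the remaining integral against the kernel finite.
\<close>

lemma energy_form_semiconvex:
  fixes \<psi> \<phi> :: "'a::euclidean_space \<Rightarrow> real"
  assumes s: "0 < s" "s < 1" and c: "0 < c"
    and \<psi>: "continuous_on UNIV \<psi>" "finite_energy s \<psi>"
    and \<phi>: "continuous_on UNIV \<phi>" "finite_energy s \<phi>" "{x. \<phi> x \<noteq> 0} \<subseteq> cball 0 R" "\<And>x. 0 \<le> \<phi> x"
    and C: "\<And>x h. \<phi> x \<noteq> 0 \<Longrightarrow> 2 * \<psi> x - \<psi> (x + h) - \<psi> (x - h) \<le> C * min 1 ((norm h)\<^sup>2)"
  shows "energy_form c s \<psi> \<phi> \<le> c / 2 * (C * (\<integral>h. min 1 ((norm (h::'a))\<^sup>2) * kern s h \<partial>lborel)) * (\<integral>x. \<phi> x \<partial>lborel)"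
proof -
  define J where "J = (\<integral>h. min 1 ((norm (h::'a))\<^sup>2) * kern s h \<partial>lborel)"
  define P where "P = (\<integral>x. \<phi> x \<partial>lborel)"
  let ?T = "\<lambda>z::'a \<times> 'a. (fst z, fst z + snd z)"
  have Tm: "?T \<in> measurable lborel2 lborel2" by measurable
  define G where "G z = dq s \<psi> z * dq s \<phi> z" for z
  have Gi: "integrable lborel2 G" unfolding G_def by (rule finite_energy_integrable_mult[OF \<psi>(2) \<phi>(2)])
  have GTi: "integrable lborel2 (\<lambda>z. G (?T z))"
    using integrable_distr[OF Tm, of G] Gi by (simp add: distr_shear)
  have GTi': "integrable lborel2 (\<lambda>(x, h). G (x, x + h))" using GTi by (simp add: split_beta')
  have GT: "G (x, x + h) = (\<psi> x - \<psi> (x + h)) * (\<phi> x - \<phi> (x + h)) * kern s h" for x h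
    unfolding G_def dq_mult by simp
  have "(\<integral>z. G z \<partial>lborel2) = (\<integral>z. G (?T z) \<partial>lborel2)"
    using integral_distr[OF Tm, of G] Gi by (simp add: distr_shear)
  also have "\<dots> = (\<integral>h. \<integral>x. G (x, x + h) \<partial>lborel \<partial>lborel)"
    using lborel_pair.integral_snd[OF GTi'] by (simp add: split_beta')
  also have "\<dots> \<le> (\<integral>h. C * P * (min 1 ((norm (h::'a))\<^sup>2) * kern s h) \<partial>lborel)"
  proof (rule integral_mono)
    show "integrable lborel (\<lambda>h. \<integral>x. G (x, x + h) \<partial>lborel)" by (rule lborel_pair.integrable_snd[OF GTi'])
    show "integrable lborel (\<lambda>h::'a. C * P * (min 1 ((norm h)\<^sup>2) * kern s h))"
      by (intro integrable_mult_right kern_integrable[OF s])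
    fix h :: 'a
    have sh: "continuous_on UNIV (\<lambda>x. \<psi> (x + a))" "continuous_on UNIV (\<lambda>x. \<phi> (x + a))" for a
      by (rule continuous_on_compose2[OF \<psi>(1)] continuous_on_compose2[OF \<phi>(1)]; auto intro: continuous_intros)+
    have c1: "continuous_on UNIV (\<lambda>x. (\<psi> x - \<psi> (x + h)) * \<phi> x)" using sh \<psi>(1) \<phi>(1) by (intro continuous_intros)
    have i1: "integrable lborel (\<lambda>x. (\<psi> x - \<psi> (x + h)) * \<phi> x)"
      by (rule integrable_continuous_supp[OF c1, of R]) (use \<phi>(3) in auto)
    have c2: "continuous_on UNIV (\<lambda>x. (\<psi> (x - h) - \<psi> x) * \<phi> x)"
      using sh(1)[of "- h"] \<psi>(1) \<phi>(1) by (intro continuous_intros) simp_all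
    have i2: "integrable lborel (\<lambda>x. (\<psi> (x - h) - \<psi> x) * \<phi> x)"
      by (rule integrable_continuous_supp[OF c2, of R]) (use \<phi>(3) in auto)
    have i3: "integrable lborel (\<lambda>x. (\<psi> x - \<psi> (x + h)) * \<phi> (x + h))"
      using integrable_translate(1)[OF i2, of h] by simp
    have e3: "(\<integral>x. (\<psi> x - \<psi> (x + h)) * \<phi> (x + h) \<partial>lborel) = (\<integral>x. (\<psi> (x - h) - \<psi> x) * \<phi> x \<partial>lborel)"
      using integral_translate(1)[of "\<lambda>x. (\<psi> (x - h) - \<psi> x) * \<phi> x" h] i2 by simp
    have "(\<integral>x. G (x, x + h) \<partial>lborel) = (\<integral>x. (\<psi> x - \<psi> (x + h)) * \<phi> x - (\<psi> x - \<psi> (x + h)) * \<phi> (x + h) \<partial>lborel) * kern s h"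
      unfolding GT by (simp add: right_diff_distrib)
    also have "(\<integral>x. (\<psi> x - \<psi> (x + h)) * \<phi> x - (\<psi> x - \<psi> (x + h)) * \<phi> (x + h) \<partial>lborel)
       = (\<integral>x. (\<psi> x - \<psi> (x + h)) * \<phi> x \<partial>lborel) - (\<integral>x. (\<psi> (x - h) - \<psi> x) * \<phi> x \<partial>lborel)"
      using i1 i3 e3 by simp
    also have "\<dots> = (\<integral>x. (2 * \<psi> x - \<psi> (x + h) - \<psi> (x - h)) * \<phi> x \<partial>lborel)"
      using i1 i2 by (simp flip: Bochner_Integration.integral_diff) (simp add: algebra_simps)
    also have "\<dots> \<le> (\<integral>x. C * min 1 ((norm h)\<^sup>2) * \<phi> x \<partial>lborel)"
    proof (rule integral_mono)
      have "(\<lambda>x. (2 * \<psi> x - \<psi> (x + h) - \<psi> (x - h)) * \<phi> x) = (\<lambda>x. (\<psi> x - \<psi> (x + h)) * \<phi> x - (\<psi> (x - h) - \<psi> x) * \<phi> x)"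
        by (simp add: algebra_simps)
      thus "integrable lborel (\<lambda>x. (2 * \<psi> x - \<psi> (x + h) - \<psi> (x - h)) * \<phi> x)" using i1 i2 by simp
      show "integrable lborel (\<lambda>x. C * min 1 ((norm h)\<^sup>2) * \<phi> x)"
        by (intro integrable_mult_right integrable_continuous_supp[OF \<phi>(1,3)])
      show "(2 * \<psi> x - \<psi> (x + h) - \<psi> (x - h)) * \<phi> x \<le> C * min 1 ((norm h)\<^sup>2) * \<phi> x" for x
        using C[of x h] \<phi>(4)[of x] by (cases "\<phi> x = 0") (auto intro: mult_right_mono)
    qed
    also have "\<dots> = C * min 1 ((norm h)\<^sup>2) * P" by (simp add: P_def)
    finally show "(\<integral>x. G (x, x + h) \<partial>lborel) \<le> C * P * (min 1 ((norm h)\<^sup>2) * kern s h)"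
      by (simp add: mult_right_mono algebra_simps)
  qed
  also have "\<dots> = C * P * J" by (simp add: J_def)
  finally have "(\<integral>z. G z \<partial>lborel2) \<le> C * P * J" .
  hence "c / 2 * (\<integral>z. G z \<partial>lborel2) \<le> c / 2 * (C * P * J)" using c by (intro mult_left_mono) auto
  thus ?thesis unfolding energy_form_dq G_def[symmetric] J_def[symmetric] P_def[symmetric] by (simp add: mult.assoc mult.left_commute mult.commute[of P])
qed

text \<open>
  A truncated paraboloid: as a maximum of two functions whose second differences are bounded below by
  \<open>- C |h|\<^sup>2\<close>, it has the same one-sided bound.
\<close>

definition tent :: "'a::euclidean_space \<Rightarrow> real \<Rightarrow> 'a \<Rightarrow> real" where
  "tent a r x = max 0 (1 - (norm (x - a) / r)\<^sup>2)"

lemma tent_range: "0 \<le> tent a r x" "tent a r x \<le> 1"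
  by (simp_all add: tent_def)

lemma tent_center: "tent a r a = 1"
  by (simp add: tent_def)

lemma tent_support: "0 < r \<Longrightarrow> tent a r x \<noteq> 0 \<Longrightarrow> x \<in> ball a r"
proof -
  assume r: "0 < r" and "tent a r x \<noteq> 0"
  hence "(norm (x - a) / r)\<^sup>2 < 1" by (auto simp: tent_def max_def split: if_splits)
  hence "norm (x - a) / r < 1" using r by (simp add: power2_eq_square abs_square_less_1 flip: power2_eq_square)
  thus "x \<in> ball a r" using r by (simp add: dist_norm norm_minus_commute)
qed

lemma tent_cont: "continuous_on UNIV (tent a r)"
  unfolding tent_def divide_inverse by (intro continuous_intros)

lemma tent_energy:
  fixes a :: "'a::euclidean_space"
  assumes s: "0 < s" "s < 1" and r: "0 < r"
  shows "finite_energy s (tent a r)"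
proof (rule finite_energy_lipschitz[OF s tent_cont])
  let ?R = "norm a + r"
  show "{x. tent a r x \<noteq> 0} \<subseteq> cball 0 ?R"
  proof
    fix x assume "x \<in> {x. tent a r x \<noteq> 0}"
    hence "norm (x - a) < r" using tent_support[OF r, of a x] by (simp add: dist_norm norm_minus_commute)
    thus "x \<in> cball 0 ?R" using norm_triangle_sub[of x a] by simp
  qed
  show "\<bar>tent a r x\<bar> \<le> 1" for x using tent_range[of a r x] by simp
  fix x y :: 'a assume xy: "x \<in> cball 0 (?R + 1)" "y \<in> cball 0 (?R + 1)"
  let ?K = "2 * norm a + r + 1"
  have b: "norm (x - a) \<le> ?K" "norm (y - a) \<le> ?K" using xy norm_triangle_ineq4[of x a] norm_triangle_ineq4[of y a] by auto
  have "\<bar>tent a r x - tent a r y\<bar> \<le> \<bar>(norm (x - a) / r)\<^sup>2 - (norm (y - a) / r)\<^sup>2\<bar>"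
    unfolding tent_def by linarith
  also have "(norm (x - a) / r)\<^sup>2 - (norm (y - a) / r)\<^sup>2 = (norm (x - a) + norm (y - a)) * (norm (x - a) - norm (y - a)) / r\<^sup>2"
    by (simp add: power2_eq_square algebra_simps diff_divide_distrib)
  also have "\<bar>\<dots>\<bar> = (norm (x - a) + norm (y - a)) * \<bar>norm (x - a) - norm (y - a)\<bar> / r\<^sup>2"
    by (simp add: abs_mult)
  also have "\<dots> \<le> (2 * ?K) * norm (x - y) / r\<^sup>2"
  proof (intro divide_right_mono mult_mono)
    show "\<bar>norm (x - a) - norm (y - a)\<bar> \<le> norm (x - y)" using norm_triangle_ineq3[of "x - a" "y - a"] by simp
  qed (use b r norm_ge_zero[of a] in \<open>linarith | simp\<close>)+
  finally show "\<bar>tent a r x - tent a r y\<bar> \<le> (2 * ?K / r\<^sup>2) * norm (x - y)" by simp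
qed

text \<open>
  Where the tent is positive it equals the paraboloid, for which the left-hand side is \<open>2 |h|\<^sup>2 / r\<^sup>2\<close> by
  the parallelogram law, and the tent lies above the paraboloid at \<open>x + h\<close> and \<open>x - h\<close>. Where it is zero, the left-hand side is
  nonpositive.
\<close>

lemma tent_semiconvex:
  fixes a :: "'a::euclidean_space"
  assumes r: "0 < r"
  shows "2 * tent a r x - tent a r (x + h) - tent a r (x - h) \<le> (2 + 2 / r\<^sup>2) * min 1 ((norm h)\<^sup>2)"
proof -
  have 1: "2 * tent a r x - tent a r (x + h) - tent a r (x - h) \<le> 2"
    using tent_range[of a r x] tent_range[of a r "x + h"] tent_range[of a r "x - h"] by linarith
  have 2: "2 * tent a r x - tent a r (x + h) - tent a r (x - h) \<le> 2 / r\<^sup>2 * (norm h)\<^sup>2"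
  proof (cases "tent a r x = 0")
    case True
    have "0 \<le> 2 / r\<^sup>2 * (norm h)\<^sup>2" by simp
    thus ?thesis using True tent_range[of a r "x + h"] tent_range[of a r "x - h"] by linarith
  next
    case False
    have par: "(norm (x + h - a))\<^sup>2 + (norm (x - h - a))\<^sup>2 = 2 * (norm (x - a))\<^sup>2 + 2 * (norm h)\<^sup>2"
      unfolding power2_norm_eq_inner by (simp add: inner_diff_left inner_diff_right inner_add_left inner_add_right inner_commute algebra_simps)
    have "tent a r x = 1 - (norm (x - a))\<^sup>2 / r\<^sup>2" using False by (auto simp: tent_def max_def power_divide split: if_splits)
    moreover have "1 - (norm (x + h - a))\<^sup>2 / r\<^sup>2 \<le> tent a r (x + h)" "1 - (norm (x - h - a))\<^sup>2 / r\<^sup>2 \<le> tent a r (x - h)"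
      by (auto simp: tent_def power_divide)
    moreover have "(norm (x + h - a))\<^sup>2 / r\<^sup>2 + (norm (x - h - a))\<^sup>2 / r\<^sup>2 = 2 * ((norm (x - a))\<^sup>2 / r\<^sup>2) + 2 / r\<^sup>2 * (norm h)\<^sup>2"
      unfolding add_divide_distrib[symmetric] par by (simp add: add_divide_distrib)
    ultimately show ?thesis by linarith
  qed
  show ?thesis
  proof (cases "1 \<le> (norm h)\<^sup>2")
    case True
    hence eq: "min 1 ((norm h)\<^sup>2) = 1" by (rule min_absorb1)
    have "0 \<le> 2 / r\<^sup>2" by simp
    thus ?thesis unfolding eq mult_1_right using 1 by linarith
  next
    case False
    hence mn: "min 1 ((norm h)\<^sup>2) = (norm h)\<^sup>2" by simp
    show ?thesis unfolding mn distrib_right by (rule order_trans[OF 2]) simp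
  qed
qed

definition odd_tent :: "'a::euclidean_space \<Rightarrow> real \<Rightarrow> 'a \<Rightarrow> real \<Rightarrow> 'a \<Rightarrow> real" where
  "odd_tent e l a r x = tent a r x - tent a r (reflect e l x)"

lemma tent_reflect_zero:
  assumes e: "norm e = 1" and r: "0 < r" "r < a \<bullet> e - l" and x: "tent a r (reflect e l x) \<noteq> 0"
  shows "x \<bullet> e < l - (a \<bullet> e - l - r)"
proof -
  have "norm (reflect e l x - a) < r" using tent_support[OF r(1) x] by (simp add: dist_norm norm_minus_commute)
  moreover have "\<bar>(reflect e l x - a) \<bullet> e\<bar> \<le> norm (reflect e l x - a)" by (rule abs_inner_le_norm[OF e])
  moreover have "(reflect e l x - a) \<bullet> e = 2 * l - x \<bullet> e - a \<bullet> e" by (simp add: inner_diff_left reflect_inner[OF e])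
  ultimately show ?thesis by linarith
qed

text \<open>
  At points of the ball the mirror image of the tent vanishes, and it is reached only by increments \<open>h\<close> whose
  length is bounded below, where \<open>min 1 ((norm h)\<^sup>2)\<close> is bounded below as well.
\<close>

lemma odd_tent_semiconvex:
  fixes a :: "'a::euclidean_space"
  assumes e: "norm e = 1" and r: "0 < r" "r < a \<bullet> e - l"
  obtains C where "\<And>x h. x \<in> ball a r \<Longrightarrow>
      2 * odd_tent e l a r x - odd_tent e l a r (x + h) - odd_tent e l a r (x - h) \<le> C * min 1 ((norm h)\<^sup>2)"
proof -
  define d where "d = a \<bullet> e - l - r"
  have d: "0 < d" using r by (simp add: d_def)
  define m where "m = min 1 (d\<^sup>2)"
  have m: "0 < m" using d by (simp add: m_def)
  have img: "tent a r (reflect e l (x + h)) \<le> 1 / m * min 1 ((norm h)\<^sup>2)" if x: "x \<in> ball a r" for x h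
  proof (cases "tent a r (reflect e l (x + h)) = 0")
    case True thus ?thesis using m by simp
  next
    case False
    have "\<bar>(a - x) \<bullet> e\<bar> \<le> norm (a - x)" "\<bar>h \<bullet> e\<bar> \<le> norm h"
      using Cauchy_Schwarz_ineq2[of "a - x" e] Cauchy_Schwarz_ineq2[of h e] e by simp_all
    moreover have "norm (a - x) < r" using x by (simp add: dist_norm)
    moreover have "(x + h) \<bullet> e < l - d" using tent_reflect_zero[OF e r False] by (simp add: d_def)
    ultimately have "d \<le> norm h" using d by (simp add: inner_diff_left inner_add_left d_def)
    hence "d\<^sup>2 \<le> (norm h)\<^sup>2" using d by (intro power_mono) auto
    hence "m \<le> min 1 ((norm h)\<^sup>2)" by (auto simp: m_def)
    hence "1 \<le> 1 / m * min 1 ((norm h)\<^sup>2)" using m by (simp add: field_simps)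
    thus ?thesis using tent_range(2)[of a r "reflect e l (x + h)"] by linarith
  qed
  show ?thesis
  proof (rule that[of "2 + 2 / r\<^sup>2 + 2 / m"])
    fix x h :: 'a assume x: "x \<in> ball a r"
    have "tent a r (reflect e l (x - h)) \<le> 1 / m * min 1 ((norm h)\<^sup>2)" using img[OF x, of "- h"] by simp
    thus "2 * odd_tent e l a r x - odd_tent e l a r (x + h) - odd_tent e l a r (x - h) \<le> (2 + 2 / r\<^sup>2 + 2 / m) * min 1 ((norm h)\<^sup>2)"
      using img[OF x, of h] tent_semiconvex[OF r(1), of a x h] tent_range(1)[of a r "reflect e l x"]
      unfolding odd_tent_def by (simp add: distrib_right)
  qed
qed

lemma kern_strict_mono:
  fixes x y :: "'a::euclidean_space"
  assumes "0 < s" "x \<noteq> 0" "norm x < norm y"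
  shows "kern s y < kern s x"
  using assms unfolding kern_def by (intro divide_strict_left_mono powr_less_mono2 mult_pos_pos) (auto simp: add_pos_pos)

lemma continuous_on_kern:
  fixes g :: "'b::topological_space \<Rightarrow> 'a::euclidean_space"
  assumes "continuous_on S g" "\<And>x. x \<in> S \<Longrightarrow> g x \<noteq> 0"
  shows "continuous_on S (\<lambda>x. kern s (g x))"
  unfolding kern_def using assms by (intro continuous_intros) auto

text \<open>
  The two balls lie in the open half-space and are disjoint, so the difference of the kernels is continuous
  and positive on the compact product of the closed balls.
\<close>

lemma kern_gap_lower_bound:
  fixes a b :: "'a::euclidean_space"
  assumes s: "0 < s" and e: "norm e = 1" and r: "0 < r" "r < a \<bullet> e - l" "r < b \<bullet> e - l" "2 * r < dist a b"
  obtains k where "0 < k" "\<And>x y. x \<in> cball a r \<Longrightarrow> y \<in> cball b r \<Longrightarrow> k \<le> kern s (x - y) - kern s (x - reflect e l y)"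
proof -
  let ?K = "cball a r \<times> cball b r"
  let ?h = "\<lambda>z. kern s (fst z - snd z) - kern s (fst z - reflect e l (snd z))"
  have half: "l < x \<bullet> e" if "x \<in> cball q r" "r < q \<bullet> e - l" for x q
  proof -
    have "\<bar>(q - x) \<bullet> e\<bar> \<le> norm (q - x)" by (rule abs_inner_le_norm[OF e])
    moreover have "norm (q - x) \<le> r" using that by (simp add: dist_norm)
    ultimately show ?thesis using that(2) by (simp add: inner_diff_left)
  qed
  have lt: "norm (x - y) < norm (x - reflect e l y)" if "l < x \<bullet> e" "l < y \<bullet> e" for x y
  proof (rule power2_less_imp_less)
    show "(norm (x - y))\<^sup>2 < (norm (x - reflect e l y))\<^sup>2"
      unfolding norm_reflect_diff_cross[OF e] using that by simp
  qed simp
  have ne: "x \<noteq> y" if "x \<in> cball a r" "y \<in> cball b r" for x y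
  proof
    assume "x = y"
    thus False using that r(4) dist_triangle[of a b x] by (simp add: dist_commute)
  qed
  have "continuous_on ?K ?h"
  proof (rule continuous_on_diff; rule continuous_on_kern)
    show "continuous_on ?K (\<lambda>z. fst z - reflect e l (snd z))"
      unfolding reflect_def by (intro continuous_intros)
    fix z assume "z \<in> ?K"
    hence z: "fst z \<in> cball a r" "snd z \<in> cball b r" by auto
    show "fst z - snd z \<noteq> 0" using ne[OF z] by simp
    have "0 < norm (fst z - reflect e l (snd z))"
      by (rule le_less_trans[OF norm_ge_zero lt[OF half[OF z(1) r(2)] half[OF z(2) r(3)]]])
    thus "fst z - reflect e l (snd z) \<noteq> 0" by simp
  qed (intro continuous_intros)
  moreover have "compact ?K" by (intro compact_Times compact_cball)
  moreover have "?K \<noteq> {}" using r(1) by simp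
  ultimately obtain z where z: "z \<in> ?K" "\<And>w. w \<in> ?K \<Longrightarrow> ?h z \<le> ?h w"
    using continuous_attains_inf[of ?K ?h] by blast
  have "fst z \<in> cball a r" "snd z \<in> cball b r" using z(1) by auto
  then have "0 < ?h z" using kern_strict_mono[OF s, of "fst z - snd z" "fst z - reflect e l (snd z)"] ne lt half r by simp
  moreover have "?h z \<le> kern s (x - y) - kern s (x - reflect e l y)" if "x \<in> cball a r" "y \<in> cball b r" for x y
    using z(2)[of "(x, y)"] that by simp
  ultimately show ?thesis by (rule that)
qed

context fractional_solution
begin

text \<open>
  Suppose the gap vanishes at \<open>a\<close> and is at most \<open>- m\<close> on a ball around \<open>b\<close>. Lift it by a small multiple \<open>\<delta>\<close>
  of the odd tent at \<open>a\<close> and test with the excess \<open>\<phi>\<close> of the sum, which is supported near \<open>a\<close>. The nonlocal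
  interaction with the ball around \<open>b\<close> makes the energy at least \<open>Y\<close> times the integral of \<open>\<phi>\<close>, with \<open>Y\<close>
  independent of \<open>\<delta>\<close>. The tent and the equation of the gap make it at most \<open>\<delta> X\<close> times that integral. For small
  \<open>\<delta>\<close> the excess vanishes, although it equals \<open>\<delta> / 2\<close> at \<open>a\<close>.
\<close>

lemma gap_strict:
  assumes e: "norm e = 1" and le: "\<And>x. l < x \<bullet> e \<Longrightarrow> u x \<le> u (reflect e l x)"
    and a: "l < a \<bullet> e" "u a = u (reflect e l a)" and b: "l < b \<bullet> e"
  shows "u b = u (reflect e l b)"
proof (rule ccontr)
  assume "u b \<noteq> u (reflect e l b)"
  hence bneg: "gap e l b < 0" using le[OF b] by (simp add: gap_def)
  define m where "m = - gap e l b / 2"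
  have m: "0 < m" using bneg by (simp add: m_def)
  have "a \<noteq> b" using a(2) bneg by (auto simp: gap_def)
  hence dab: "0 < dist a b" by simp
  have "continuous (at b) (gap e l)" using gap_cont[of e l] by (simp add: continuous_on_eq_continuous_at)
  then obtain d where d: "0 < d" "\<And>y. dist y b < d \<Longrightarrow> dist (gap e l y) (gap e l b) < m"
    unfolding continuous_at_eps_delta using m by metis
  \<comment> \<open>the balls of radius \<open>r\<close> around \<open>a\<close> and \<open>b\<close> are disjoint and stay inside the half-space\<close>
  define r where "r = Min {d, (a \<bullet> e - l), (b \<bullet> e - l), dist a b} / 4"
  have r: "0 < r" "r < a \<bullet> e - l" "r < b \<bullet> e - l" "2 * r < dist a b" "r < d"
    using d(1) a(1) b dab by (auto simp: r_def min_def)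
  have wb: "gap e l y \<le> - m" if "y \<in> ball b r" for y
  proof -
    have "dist (gap e l y) (gap e l b) < m" using that r(5) by (intro d(2)) (auto simp: dist_commute)
    thus ?thesis by (simp add: dist_real_def m_def)
  qed
  obtain k where k: "0 < k" "\<And>x y. x \<in> cball a r \<Longrightarrow> y \<in> cball b r \<Longrightarrow> k \<le> kern s (x - y) - kern s (x - reflect e l y)"
    using kern_gap_lower_bound[OF s(1) e r(1-4)] by blast
  obtain C where C: "\<And>x h. x \<in> ball a r \<Longrightarrow>
      2 * odd_tent e l a r x - odd_tent e l a r (x + h) - odd_tent e l a r (x - h) \<le> C * min 1 ((norm h)\<^sup>2)"
    using odd_tent_semiconvex[OF e r(1,2)] by blast
  define J where "J = (\<integral>h. min 1 ((norm (h::'a))\<^sup>2) * kern s h \<partial>lborel)"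
  define X where "X = \<bar>c / 2 * (C * J)\<bar> + L"
  define Y where "Y = c / 8 * (m * k * measure lborel (ball b r))"
  have Y: "0 < Y" unfolding Y_def using c m k(1) content_ball_pos[OF r(1), of b] by simp
  have X: "0 \<le> X" using L_nonneg by (simp add: X_def)
  define \<delta> where "\<delta> = Y / (2 * (X + 1))"
  have \<delta>: "0 < \<delta>" using X Y by (simp add: \<delta>_def)
  have "\<delta> * X < Y" using X Y by (simp add: \<delta>_def field_simps add_strict_increasing)
  let ?\<psi> = "odd_tent e l a r"
  define g where "g x = \<delta> * ?\<psi> x + gap e l x" for x
  have tr_cont: "continuous_on UNIV (\<lambda>x. tent a r (reflect e l x))"
    by (rule continuous_on_compose2[OF tent_cont]) (auto intro: continuous_intros)
  have \<psi>_cont: "continuous_on UNIV ?\<psi>" unfolding odd_tent_def by (intro continuous_intros tent_cont tr_cont)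
  have \<psi>_energy: "finite_energy s ?\<psi>"
    unfolding odd_tent_def by (intro finite_energy_diff finite_energy_reflect tent_energy s r e)
  have tent_lim: "(tent a r \<longlongrightarrow> 0) at_infinity"
  proof (rule tendsto_eventually)
    have "tent a r x = 0" if "norm a + r \<le> norm x" for x
    proof (rule ccontr)
      assume "tent a r x \<noteq> 0"
      from tent_support[OF r(1) this] have "norm (x - a) < r" by (simp add: dist_norm norm_minus_commute)
      thus False using that norm_triangle_sub[of x a] by simp
    qed
    thus "\<forall>\<^sub>F x in at_infinity. tent a r x = 0" unfolding eventually_at_infinity by blast
  qed
  have \<psi>_lim: "(?\<psi> \<longlongrightarrow> 0) at_infinity"
    unfolding odd_tent_def using tendsto_diff[OF tent_lim tendsto_at_infinity_reflect[OF e tent_lim]] by simp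
  have g_odd: "reflect_odd e l g"
    using reflect_oddD[OF gap_odd[OF e]] e by (simp add: reflect_odd_def g_def odd_tent_def right_diff_distrib)
  have g_cont: "continuous_on UNIV g" unfolding g_def by (intro continuous_intros \<psi>_cont gap_cont)
  have g_lim: "(g \<longlongrightarrow> 0) at_infinity"
    unfolding g_def using tendsto_add[OF tendsto_mult_right_zero[OF \<psi>_lim] gap_lim[OF e]] by simp
  have \<delta>\<psi>_energy: "finite_energy s (\<lambda>x. \<delta> * ?\<psi> x)" by (rule finite_energy_cmult[OF \<psi>_energy])
  have g_energy: "finite_energy s g" unfolding g_def by (rule finite_energy_add[OF \<delta>\<psi>_energy gap_energy[OF e]])
  have eps: "0 < \<delta> / 2" using \<delta> by simp
  let ?\<phi> = "excess e l (\<delta> / 2) g"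
  have fc: "finite_energy s ?\<phi>" by (rule finite_energy_excess[OF s e g_odd eps g_cont g_lim g_energy])
  have cc: "continuous_on UNIV ?\<phi>" by (rule excess_continuous[OF e g_odd eps g_cont])
  obtain R D where "\<And>x. ?\<phi> x \<noteq> 0 \<Longrightarrow> norm x \<le> R"
    by (rule excess_support[OF e g_odd eps g_cont g_lim]) (use that in blast)
  hence supp: "{x. ?\<phi> x \<noteq> 0} \<subseteq> cball 0 R" by auto
  have int: "integrable lborel ?\<phi>" by (rule integrable_continuous_supp[OF cc supp])
  note [measurable] = fc
  have \<psi>_half: "?\<psi> x = tent a r x" if "l \<le> x \<bullet> e" for x
    using tent_reflect_zero[OF e r(1,2), of x] that r by (fastforce simp: odd_tent_def)
  have on_supp: "l < x \<bullet> e" "x \<in> ball a r" "- gap e l x \<le> \<delta>" "gap e l x \<le> 0" "0 < g x" if "?\<phi> x \<noteq> 0" for x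
  proof -
    show xl: "l < x \<bullet> e" and g0: "0 < g x" using that \<delta> by (auto simp: excess_def max_def split: if_splits)
    show g1: "gap e l x \<le> 0" using le[OF xl] by (simp add: gap_def)
    have p: "- gap e l x < \<delta> * tent a r x" using g0 \<psi>_half[of x] xl by (simp add: g_def)
    hence "tent a r x \<noteq> 0" using g1 by auto
    thus "x \<in> ball a r" by (rule tent_support[OF r(1)])
    have "\<delta> * tent a r x \<le> \<delta> * 1" using tent_range(2) \<delta> by (intro mult_left_mono) auto
    thus "- gap e l x \<le> \<delta>" using p by simp
  qed
  have b_half: "l < y \<bullet> e" if "y \<in> ball b r" for y
  proof -
    have "\<bar>(b - y) \<bullet> e\<bar> \<le> norm (b - y)" by (rule abs_inner_le_norm[OF e])
    moreover have "norm (b - y) < r" using that by (simp add: dist_norm)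
    ultimately show ?thesis using r(3) by (simp add: inner_diff_left)
  qed
  have gb: "g y \<le> - m" if y: "y \<in> ball b r" for y
  proof -
    have "y \<notin> ball a r"
    proof
      assume "y \<in> ball a r"
      thus False using y r(4) dist_triangle[of a b y] by (simp add: dist_commute)
    qed
    hence "?\<psi> y = 0" using \<psi>_half[of y] b_half[OF y] tent_support[OF r(1), of a y] by force
    thus ?thesis using wb[OF y] by (simp add: g_def)
  qed
  define P where "P = (\<integral>x. ?\<phi> x \<partial>lborel)"
  have P0: "0 \<le> P" unfolding P_def by (intro integral_nonneg_AE) auto
  have lower: "Y * P \<le> energy_form c s g ?\<phi>"
  proof -
    define F :: "'a \<times> 'a \<Rightarrow> real" where "F z = m * k * (?\<phi> (fst z) * indicator (ball b r) (snd z))" for z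
    have "integrable lborel2 F \<and> c / 8 * (\<integral>z. F z \<partial>lborel2) \<le> energy_form c s g ?\<phi>"
    proof (rule energy_excess_lower_bound[OF s(1) c e g_odd eps g_energy fc])
      have [measurable]: "?\<phi> \<in> borel_measurable borel" "ball b r \<in> sets borel"
        by (simp_all add: finite_energy_measurable[OF fc])
      show "F \<in> borel_measurable lborel2" unfolding F_def by measurable
      show "0 \<le> F z" for z unfolding F_def using m k(1) by simp
      show "F (x, y) = 0" if "x \<bullet> e < l \<or> y \<bullet> e < l" for x y
      proof (rule ccontr)
        assume "F (x, y) \<noteq> 0"
        hence "?\<phi> x \<noteq> 0" "y \<in> ball b r" by (auto simp: F_def indicator_def split: if_splits)
        thus False using on_supp(1)[of x] b_half[of y] that by auto
      qed
      show "F (x, y) \<le> (g x - g y) * (?\<phi> x - ?\<phi> y) * (kern s (x - y) - kern s (x - reflect e l y))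
         + 2 * (g x * ?\<phi> x + g y * ?\<phi> y) * kern s (x - reflect e l y)" if xy: "l \<le> x \<bullet> e" "l \<le> y \<bullet> e" for x y
      proof -
        have n2: "0 \<le> 2 * (g x * ?\<phi> x + g y * ?\<phi> y) * kern s (x - reflect e l y)"
          by (rule excess_reflected_nonneg[OF eps])
        have "F (x, y) \<le> (g x - g y) * (?\<phi> x - ?\<phi> y) * (kern s (x - y) - kern s (x - reflect e l y))"
        proof (cases "F (x, y) = 0")
          case True
          thus ?thesis using excess_interaction_nonneg[OF s(1) e g_odd eps xy] by simp
        next
          case False
          hence xy': "?\<phi> x \<noteq> 0" "y \<in> ball b r" by (auto simp: F_def indicator_def split: if_splits)
          have gy: "g y \<le> - m" by (rule gb[OF xy'(2)])
          have py: "?\<phi> y = 0" using gy m \<delta> by (simp add: excess_def max_def)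
          have kk: "k \<le> kern s (x - y) - kern s (x - reflect e l y)"
            using on_supp(2)[OF xy'(1)] xy'(2) by (intro k(2)) auto
          have "m \<le> g x - g y" using on_supp(5)[OF xy'(1)] gy by simp
          hence "m * ?\<phi> x * k \<le> (g x - g y) * ?\<phi> x * (kern s (x - y) - kern s (x - reflect e l y))"
            using kk m k(1) by (intro mult_mono) auto
          thus ?thesis using xy'(2) py by (simp add: F_def mult.assoc mult.left_commute mult.commute)
        qed
        thus ?thesis using n2 by linarith
      qed
    qed
    hence Fi: "integrable lborel2 F" and Fle: "c / 8 * (\<integral>z. F z \<partial>lborel2) \<le> energy_form c s g ?\<phi>"
      by auto
    have "(\<integral>z. F z \<partial>lborel2) = (\<integral>x. \<integral>y. F (x, y) \<partial>lborel \<partial>lborel)"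
      by (rule lborel_pair.integral_fst'[OF Fi, symmetric])
    also have "\<dots> = (\<integral>x. m * k * measure lborel (ball b r) * ?\<phi> x \<partial>lborel)"
      by (simp add: F_def mult.assoc mult.commute[of "?\<phi> _"])
    also have "\<dots> = m * k * measure lborel (ball b r) * P" by (simp add: P_def)
    finally show ?thesis using Fle by (simp add: Y_def mult.assoc)
  qed
  have "energy_form c s ?\<psi> ?\<phi> \<le> c / 2 * (C * J) * P"
    unfolding J_def P_def
    by (rule energy_form_semiconvex[OF s c \<psi>_cont \<psi>_energy cc fc supp]) (use C on_supp(2) in auto)
  also have "\<dots> \<le> \<bar>c / 2 * (C * J)\<bar> * P" using P0 by (intro mult_right_mono) auto
  finally have up1: "\<delta> * energy_form c s ?\<psi> ?\<phi> \<le> \<delta> * (\<bar>c / 2 * (C * J)\<bar> * P)" using \<delta> by (intro mult_left_mono) auto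
  have up2: "energy_form c s (gap e l) ?\<phi> \<le> L * \<delta> * P"
  proof -
    have "(\<integral>x. (f (u x) - f (u (reflect e l x))) * ?\<phi> x \<partial>lborel) \<le> (\<integral>x. L * \<delta> * ?\<phi> x \<partial>lborel)"
    proof (rule integral_mono)
      fix x
      show "(f (u x) - f (u (reflect e l x))) * ?\<phi> x \<le> L * \<delta> * ?\<phi> x"
      proof (cases "?\<phi> x = 0")
        case False
        have "f (u x) - f (u (reflect e l x)) \<le> L * \<bar>u x - u (reflect e l x)\<bar>"
          using f_lip[of "u x" "u (reflect e l x)"] u_nonneg u_le by auto
        also have "\<dots> \<le> L * \<delta>" using on_supp(3,4)[OF False] L_nonneg by (intro mult_left_mono) (auto simp: gap_def)
        finally show ?thesis by (intro mult_right_mono) auto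
      qed simp
    qed (use int gap_equation(2)[OF e cc supp fc] in auto)
    thus ?thesis unfolding gap_equation(1)[OF e cc supp fc] P_def by simp
  qed
  have "energy_form c s g ?\<phi> = \<delta> * energy_form c s ?\<psi> ?\<phi> + energy_form c s (gap e l) ?\<phi>"
    unfolding g_def using energy_form_add_left[OF \<delta>\<psi>_energy gap_energy[OF e] fc[unfolded g_def], of c] by (simp add: energy_form_cmult_left)
  hence "Y * P \<le> \<delta> * X * P" using lower up1 up2 by (simp add: X_def algebra_simps)
  hence "(Y - \<delta> * X) * P \<le> 0" by (simp add: left_diff_distrib)
  hence "P \<le> 0" using \<open>\<delta> * X < Y\<close> by (simp add: mult_le_0_iff)
  hence "?\<phi> a = 0" unfolding P_def using continuous_integral_zero[OF cc _ int] by simp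
  moreover have "g a = \<delta>" using \<psi>_half[of a] a by (simp add: g_def gap_def tent_center)
  ultimately show False using a(1) \<delta> by (simp add: excess_def)
qed

end

section \<open>Moving the plane\<close>

context fractional_solution
begin

definition dominated :: "'a \<Rightarrow> real \<Rightarrow> bool" where
  "dominated e l \<longleftrightarrow> (\<forall>x. l < x \<bullet> e \<longrightarrow> u x \<le> u (reflect e l x))"

lemma u_small_outside: 
  assumes "0 < t"
  obtains R where "0 \<le> R" "\<And>x. R \<le> norm x \<Longrightarrow> u x < t"
proof -
  from tendstoD[OF u_lim assms] obtain R where R: "\<And>x. R \<le> norm x \<Longrightarrow> dist (u x) 0 < t"
    unfolding eventually_at_infinity by blast
  show ?thesis
    by (rule that[of "max 0 R"]) (use R u_nonneg in \<open>auto simp: dist_real_def\<close>)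
qed

text \<open>
  Beyond a large ball \<open>u < t0\<close>, so the narrow region principle applies with no points left in the strip
  to be checked.
\<close>

lemma dominated_far:
  assumes e: "norm e = 1"
  obtains R where "\<And>l. R \<le> l \<Longrightarrow> dominated e l"
proof -
  obtain R where R: "0 \<le> R" "\<And>x. R \<le> norm x \<Longrightarrow> u x < t0" using u_small_outside[OF t0] by blast
  obtain \<delta> where \<delta>: "0 < \<delta>" "L < strip_rate TYPE('a) c s \<delta>" using strip_rate_large[OF c s(1)] by blast
  show ?thesis
  proof (rule that[of R])
    fix l assume l: "R \<le> l"
    show "dominated e l" unfolding dominated_def
    proof (intro allI impI)
      fix x assume x: "l < x \<bullet> e"
      show "u x \<le> u (reflect e l x)"
      proof (rule gap_nonpos_narrow[OF e \<delta> _ x])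
        fix y assume "l < y \<bullet> e"
        hence "R \<le> norm y" using l norm_cauchy_schwarz[of y e] e by simp
        thus "u y \<le> t0 \<or> y \<bullet> e < l + \<delta>" using R(2) by (simp add: less_imp_le)
      qed
    qed
  qed
qed

lemma not_dominated_low:
  assumes e: "norm e = 1"
  obtains l where "\<not> dominated e l"
proof -
  obtain x where x: "0 < u x" using u_nonzero u_nonneg by (metis less_eq_real_def)
  obtain R where R: "0 \<le> R" "\<And>y. R \<le> norm y \<Longrightarrow> u y < u x" using u_small_outside[OF x] by blast
  \<comment> \<open>so low a plane reflects \<open>x\<close> to a point at distance at least \<open>R\<close> from the origin\<close>
  define l where "l = - (R + norm x + 1)"
  have xe: "\<bar>x \<bullet> e\<bar> \<le> norm x" by (rule abs_inner_le_norm[OF e])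
  have "reflect e l x \<bullet> e = 2 * l - x \<bullet> e" by (rule reflect_inner[OF e])
  hence "R \<le> \<bar>reflect e l x \<bullet> e\<bar>" using xe R(1) by (simp add: l_def)
  also have "\<dots> \<le> norm (reflect e l x)" by (rule abs_inner_le_norm[OF e])
  finally have "u (reflect e l x) < u x" by (rule R(2))
  moreover have "l < x \<bullet> e" using xe R(1) by (simp add: l_def)
  ultimately have "\<not> dominated e l" unfolding dominated_def by (metis not_le)
  thus ?thesis by (rule that)
qed

lemma dominated_limit:
  assumes e: "norm e = 1" and l: "\<And>m. l < m \<Longrightarrow> dominated e m"
  shows "dominated e l"
  unfolding dominated_def
proof (intro allI impI)
  fix x assume x: "l < x \<bullet> e"
  have "continuous_on UNIV (\<lambda>m. u (reflect e m x))"
    by (rule continuous_on_compose2[OF u_cont]) (auto simp: reflect_def intro!: continuous_intros)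
  hence "isCont (\<lambda>m. u (reflect e m x)) l" by (simp add: continuous_on_eq_continuous_at)
  hence "((\<lambda>m. u (reflect e m x)) \<longlongrightarrow> u (reflect e l x)) (at_right l)"
    unfolding isCont_def by (rule tendsto_within_subset) simp
  moreover have "\<forall>\<^sub>F m in at_right l. u x \<le> u (reflect e m x)"
    using eventually_at_right_less[of l] eventually_at_right_real[OF x]
    by eventually_elim (use l in \<open>auto simp: dominated_def\<close>)
  ultimately show "u x \<le> u (reflect e l x)"
    by (rule tendsto_lowerbound) simp
qed

text \<open>
  Outside a large ball \<open>u < t0\<close>; in the part \<open>K\<close> of the ball away from the hyperplane the strict inequality is
  stable by compactness; and what remains is a strip so narrow that the narrow region principle applies.
\<close>

lemma dominated_extend:
  assumes e: "norm e = 1" and dom: "dominated e l" and strict: "\<And>x. l < x \<bullet> e \<Longrightarrow> u x < u (reflect e l x)"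
  obtains \<eta> where "0 < \<eta>" "\<And>m. l - \<eta> < m \<Longrightarrow> m \<le> l \<Longrightarrow> dominated e m"
proof -
  obtain R where R: "0 \<le> R" "\<And>x. R \<le> norm x \<Longrightarrow> u x < t0" using u_small_outside[OF t0] by blast
  obtain \<delta> where \<delta>: "0 < \<delta>" "L < strip_rate TYPE('a) c s \<delta>" using strip_rate_large[OF c s(1)] by blast
  define K where "K = cball 0 R \<inter> {x. l + \<delta> / 2 \<le> x \<bullet> e}"
  have K: "compact K" unfolding K_def by (intro compact_Int_closed compact_cball closed_Collect_le continuous_intros)
  \<comment> \<open>the gap as a function of the level and the point\<close>
  define h where "h p = u (snd p) - u (reflect e (fst p) (snd p))" for p
  have hc: "continuous_on ({l - 1..l} \<times> K) h"
    unfolding h_def reflect_def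
    by (intro continuous_intros continuous_on_compose2[OF u_cont]) auto
  have "\<exists>\<eta>>0. \<eta> \<le> 1 \<and> (\<forall>m x. l - \<eta> < m \<and> m \<le> l \<and> x \<in> K \<longrightarrow> u x < u (reflect e m x))"
  proof (cases "K = {}")
    case True thus ?thesis by (intro exI[of _ 1]) auto
  next
    case False
    have "continuous_on K (gap e l)" by (rule continuous_on_subset[OF gap_cont]) simp
    from continuous_attains_sup[OF K False this] obtain x0 where x0: "x0 \<in> K" "\<And>x. x \<in> K \<Longrightarrow> gap e l x \<le> gap e l x0" by blast
    define m0 where "m0 = - gap e l x0"
    have m0: "0 < m0" using strict[of x0] x0(1) \<delta>(1) by (simp add: m0_def gap_def K_def)
    have "uniformly_continuous_on ({l - 1..l} \<times> K) h"
      by (intro compact_uniformly_continuous[OF hc] compact_Times K compact_Icc)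
    then obtain \<eta> where \<eta>: "0 < \<eta>" "\<And>p q. p \<in> {l - 1..l} \<times> K \<Longrightarrow> q \<in> {l - 1..l} \<times> K \<Longrightarrow> dist q p < \<eta> \<Longrightarrow> dist (h q) (h p) < m0"
      unfolding uniformly_continuous_on_def using m0 by metis
    show ?thesis
    proof (intro exI[of _ "min 1 \<eta>"] conjI allI impI)
      fix m x assume a: "l - min 1 \<eta> < m \<and> m \<le> l \<and> x \<in> K"
      have "dist (h (m, x)) (h (l, x)) < m0"
        by (rule \<eta>(2)) (use a in \<open>auto simp: dist_Pair_Pair dist_real_def\<close>)
      moreover have "h (l, x) \<le> - m0" using x0(2)[of x] a by (simp add: h_def gap_def m0_def)
      ultimately have "h (m, x) < 0" by (simp add: dist_real_def)
      thus "u x < u (reflect e m x)" by (simp add: h_def)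
    qed (use \<eta>(1) in auto)
  qed
  then obtain \<eta> where \<eta>: "0 < \<eta>" "\<And>m x. l - \<eta> < m \<Longrightarrow> m \<le> l \<Longrightarrow> x \<in> K \<Longrightarrow> u x < u (reflect e m x)" by blast
  show ?thesis
  proof (rule that[of "min \<eta> (\<delta> / 2)"])
    fix m assume m: "l - min \<eta> (\<delta> / 2) < m" "m \<le> l"
    show "dominated e m" unfolding dominated_def
    proof (intro allI impI)
      fix x assume x: "m < x \<bullet> e"
      show "u x \<le> u (reflect e m x)"
      proof (rule gap_nonpos_narrow[OF e \<delta> _ x])
        fix y assume y: "m < y \<bullet> e" "u (reflect e m y) < u y"
        show "u y \<le> t0 \<or> y \<bullet> e < m + \<delta>"
        proof (rule ccontr)
          assume "\<not> ?thesis"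
          hence n: "t0 < u y" "m + \<delta> \<le> y \<bullet> e" by auto
          have "norm y \<le> R" using R(2)[of y] n(1) by linarith
          hence "y \<in> K" using n(2) m by (auto simp: K_def)
          moreover have "l - \<eta> < m" using m(1) by linarith
          ultimately show False using \<eta>(2)[OF _ m(2)] y(2) by fastforce
        qed
      qed
    qed
  qed (use \<eta>(1) \<delta>(1) in auto)
qed

lemma symmetric_all:
  assumes e: "norm e = 1" and sym: "\<And>x. l < x \<bullet> e \<Longrightarrow> u x = u (reflect e l x)"
  shows "u (reflect e l x) = u x"
proof -
  consider "l < x \<bullet> e" | "x \<bullet> e = l" | "x \<bullet> e < l" by linarith
  thus ?thesis
  proof cases
    case 3
    hence "l < reflect e l x \<bullet> e" by (simp add: reflect_inner[OF e])
    from sym[OF this] show ?thesis using e by simp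
  next
    case 2
    thus ?thesis by (simp add: reflect_fixed)
  qed (simp add: sym)
qed

lemma not_periodic:
  assumes v: "v \<noteq> 0"
  shows "\<exists>x. u (x + v) \<noteq> u x"
proof (rule ccontr)
  assume "\<not> ?thesis"
  hence p: "\<And>x. u (x + v) = u x" by auto
  have pn: "u (x + real n *\<^sub>R v) = u x" for n x
  proof (induction n)
    case (Suc n)
    have "x + real (Suc n) *\<^sub>R v = (x + real n *\<^sub>R v) + v" by (simp add: algebra_simps)
    thus ?case using p[of "x + real n *\<^sub>R v"] Suc by (simp only:)
  qed simp
  obtain x where x: "0 < u x" using u_nonzero u_nonneg by (metis less_eq_real_def)
  obtain R where R: "0 \<le> R" "\<And>y. R \<le> norm y \<Longrightarrow> u y < u x" using u_small_outside[OF x] by blast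
  obtain n :: nat where n: "R + norm x < real n * norm v"
    using reals_Archimedean3[of "norm v"] v by auto
  have "norm (real n *\<^sub>R v) \<le> norm (x + real n *\<^sub>R v) + norm x"
    using norm_triangle_ineq4[of "x + real n *\<^sub>R v" x] by simp
  hence "R \<le> norm (x + real n *\<^sub>R v)" using n by simp
  from R(2)[OF this] show False using pn[of x n] by simp
qed

text \<open>
  Let \<open>l0\<close> be the least level such that all planes above it are dominated. By the strong maximum principle, at
  each level \<open>l \<ge> l0\<close> domination is strict or \<open>u\<close> is symmetric. It cannot be strict at \<open>l0\<close>, or else the plane
  could move further. It is strict above \<open>l0\<close>, since two parallel planes of symmetry would make \<open>u\<close> periodic.
\<close>

lemma symmetry_plane:
  assumes e: "norm e = 1"
  obtains l where "\<And>x. u (reflect e l x) = u x"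
    "\<And>m x. l < m \<Longrightarrow> m < x \<bullet> e \<Longrightarrow> u x < u (reflect e m x)"
proof -
  define A where "A = {l. \<forall>m\<ge>l. dominated e m}"
  define l0 where "l0 = Inf A"
  obtain R where "\<And>l. R \<le> l \<Longrightarrow> dominated e l" using dominated_far[OF e] by blast
  hence RA: "R \<in> A" by (simp add: A_def)
  obtain b where b: "\<not> dominated e b" using not_dominated_low[OF e] by blast
  have bA: "b \<le> l" if "l \<in> A" for l using b that unfolding A_def by (metis mem_Collect_eq linear)
  hence bdd: "bdd_below A" by (rule bdd_belowI)
  have above: "dominated e m" if "l0 < m" for m
  proof -
    have "\<exists>l\<in>A. l < m" using that RA unfolding l0_def by (intro cInf_lessD) auto
    then obtain l where "l \<in> A" "l < m" by blast
    thus ?thesis by (simp add: A_def)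
  qed
  have at: "dominated e l0" by (rule dominated_limit[OF e above])
  have dom: "dominated e m" if "l0 \<le> m" for m using that above at by (cases "m = l0") auto
  have dich: "(\<forall>x. l < x \<bullet> e \<longrightarrow> u x < u (reflect e l x)) \<or> (\<forall>x. u (reflect e l x) = u x)" if "l0 \<le> l" for l
  proof (cases "\<exists>a. l < a \<bullet> e \<and> u a = u (reflect e l a)")
    case True
    then obtain a where a: "l < a \<bullet> e" "u a = u (reflect e l a)" by blast
    have "u x = u (reflect e l x)" if "l < x \<bullet> e" for x
      using gap_strict[OF e _ a that] dom[OF \<open>l0 \<le> l\<close>] by (simp add: dominated_def)
    thus ?thesis using symmetric_all[OF e] by blast
  next
    case False
    thus ?thesis using dom[OF that] unfolding dominated_def by (metis less_le)
  qed
  have sym: "u (reflect e l0 x) = u x" for x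
  proof (rule ccontr)
    assume "u (reflect e l0 x) \<noteq> u x"
    hence "\<And>x. l0 < x \<bullet> e \<Longrightarrow> u x < u (reflect e l0 x)" using dich[of l0] by blast
    from dominated_extend[OF e at this] obtain \<eta> where \<eta>: "0 < \<eta>" "\<And>m. l0 - \<eta> < m \<Longrightarrow> m \<le> l0 \<Longrightarrow> dominated e m" by blast
    have "l0 - \<eta> / 2 \<in> A"
      unfolding A_def
    proof (intro CollectI allI impI)
      fix m assume "l0 - \<eta> / 2 \<le> m"
      thus "dominated e m" using \<eta> dom[of m] by (cases "m \<le> l0") auto
    qed
    hence "l0 \<le> l0 - \<eta> / 2" unfolding l0_def by (rule cInf_lower[OF _ bdd])
    thus False using \<eta>(1) by simp
  qed
  have strict: "u x < u (reflect e m x)" if m: "l0 < m" "m < x \<bullet> e" for m x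
  proof (rule ccontr)
    assume "\<not> ?thesis"
    hence symm: "\<And>x. u (reflect e m x) = u x" using dich[of m] m by fastforce
    have "u (x + (2 * (m - l0)) *\<^sub>R e) = u x" for x
    proof -
      have "reflect e m (reflect e l0 x) = x + (2 * (m - l0)) *\<^sub>R e"
        by (simp add: reflect_def inner_left_distrib norm_one_inner[OF e] algebra_simps flip: scaleR_add_left)
      thus ?thesis using symm[of "reflect e l0 x"] sym[of x] by simp
    qed
    moreover have "(2 * (m - l0)) *\<^sub>R e \<noteq> 0" using m e by auto
    ultimately show False using not_periodic by blast
  qed
  show ?thesis using that sym strict by blast
qed

section \<open>Radial symmetry\<close>

lemma attains_max:
  obtains p where "\<And>x. u x \<le> u p"
proof -
  obtain x0 where x0: "0 < u x0" using u_nonzero u_nonneg by (metis less_eq_real_def)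
  obtain R where R: "0 \<le> R" "\<And>y. R \<le> norm y \<Longrightarrow> u y < u x0" using u_small_outside[OF x0] by blast
  have "continuous_on (cball 0 R) u" by (rule continuous_on_subset[OF u_cont]) simp
  moreover have "cball (0::'a) R \<noteq> {}" using R(1) by simp
  ultimately have "\<exists>p\<in>cball 0 R. \<forall>x\<in>cball 0 R. u x \<le> u p"
    by (intro continuous_attains_sup compact_cball)
  then obtain p where p: "\<And>x. x \<in> cball 0 R \<Longrightarrow> u x \<le> u p" by blast
  have "x0 \<in> cball 0 R" using R(2)[of x0] by force
  hence "u x0 \<le> u p" by (rule p)
  hence "u x \<le> u p" for x using p[of x] R(2)[of x] by (cases "norm x \<le> R") auto
  thus ?thesis by (rule that)
qed

text \<open>
  Strict monotonicity beyond the symmetry plane forces a maximum point \<open>p\<close> of \<open>u\<close> onto the plane, for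
  every direction. So all symmetry planes pass through \<open>p\<close>, and two points at equal distance from \<open>p\<close> are mirror
  images in one of them.
\<close>

lemma radially_decreasing: "\<exists>x0. radially_decreasing_about x0 u"
proof -
  obtain p where p: "\<And>x. u x \<le> u p" using attains_max by blast
  have plane: "(\<forall>x. u (reflect e (p \<bullet> e) x) = u x) \<and> (\<forall>m x. p \<bullet> e < m \<longrightarrow> m < x \<bullet> e \<longrightarrow> u x < u (reflect e m x))"
    if e: "norm e = 1" for e
  proof -
    obtain l where l: "\<And>x. u (reflect e l x) = u x" "\<And>m x. l < m \<Longrightarrow> m < x \<bullet> e \<Longrightarrow> u x < u (reflect e m x)"
      using symmetry_plane[OF e] by blast
    have no: "\<not> l < q \<bullet> e" if q: "\<And>x. u x \<le> u q" for q
    proof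
      assume "l < q \<bullet> e"
      hence "u q < u (reflect e ((l + q \<bullet> e) / 2) q)" by (intro l(2)) auto
      thus False using q by (metis not_le)
    qed
    have "\<And>x. u x \<le> u (reflect e l p)" using p l(1) by simp
    from no[OF this] no[OF p] have "p \<bullet> e = l" by (simp add: reflect_inner[OF e])
    thus ?thesis using l by simp
  qed
  have radial: "u x = u y" if xy: "norm (x - p) = norm (y - p)" for x y
  proof (cases "x = y")
    case False
    define e where "e = (1 / norm (x - y)) *\<^sub>R (x - y)"
    have e: "norm e = 1" using False by (simp add: e_def)
    have "(norm (x - p))\<^sup>2 = (norm (y - p))\<^sup>2" using xy by simp
    hence "2 * (p \<bullet> (x - y) - x \<bullet> (x - y)) = - ((x - y) \<bullet> (x - y))"
      unfolding power2_norm_eq_inner by (simp add: inner_diff_left inner_diff_right inner_commute algebra_simps)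
    moreover have "p \<bullet> (x - y) = norm (x - y) * (p \<bullet> e)" "x \<bullet> (x - y) = norm (x - y) * (x \<bullet> e)"
      using False by (simp_all add: e_def)
    ultimately have "norm (x - y) * (2 * (p \<bullet> e - x \<bullet> e) + norm (x - y)) = 0"
      unfolding dot_square_norm by (simp add: algebra_simps power2_eq_square)
    hence "2 * (p \<bullet> e - x \<bullet> e) = - norm (x - y)" using False by simp
    hence "reflect e (p \<bullet> e) x = y" using False by (simp add: reflect_def) (simp add: e_def)
    thus ?thesis using plane[OF e] by metis
  qed simp
  define b where "b = (SOME b::'a. b \<in> Basis)"
  have b: "norm b = 1" unfolding b_def by (simp add: some_in_eq)
  define g where "g r = u (p + r *\<^sub>R b)" for r
  have "u x = g (norm (x - p))" for x unfolding g_def by (rule radial) (simp add: b)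
  moreover have "strict_antimono_on {0..} g"
  proof (rule monotone_onI)
    fix r1 r2 :: real assume r: "r1 \<in> {0..}" "r2 \<in> {0..}" "r1 < r2"
    \<comment> \<open>the plane that exchanges \<open>p + r1 b\<close> and \<open>p + r2 b\<close>\<close>
    define m where "m = p \<bullet> b + (r1 + r2) / 2"
    have xb: "(p + r2 *\<^sub>R b) \<bullet> b = p \<bullet> b + r2" by (simp add: inner_add_left norm_one_inner[OF b])
    have shift: "2 * (m - (p \<bullet> b + r2)) = r1 - r2" by (simp add: m_def field_simps)
    have "p \<bullet> b < m" "m < (p + r2 *\<^sub>R b) \<bullet> b" unfolding xb using r by (auto simp: m_def)
    hence "u (p + r2 *\<^sub>R b) < u (reflect b m (p + r2 *\<^sub>R b))" using plane[OF b] by blast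
    also have "reflect b m (p + r2 *\<^sub>R b) = p + r1 *\<^sub>R b"
      unfolding reflect_def xb shift by (simp add: algebra_simps flip: scaleR_add_left)
    finally show "g r2 < g r1" by (simp add: g_def)
  qed
  ultimately show ?thesis unfolding radially_decreasing_about_def by blast
qed

end

theorem corollary1p13:
  fixes c s :: real and f :: "real \<Rightarrow> real" and u :: "real ^ 'n \<Rightarrow> real"
  assumes "c > 0"
    and "0 < s" and "s < 1"
    and "local_lipschitz (UNIV :: real set) UNIV (\<lambda>_. f)"
    and "\<exists>t0>0. antimono_on {0..t0} f"
    and "weak_solution c s f u"
    and "continuous_on UNIV u"
    and "\<forall>x. 0 \<le> u x"
    and "bounded (range u)"
    and "\<exists>x. u x \<noteq> 0"
    and "(u \<longlongrightarrow> 0) at_infinity"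
  shows "\<exists>x0. radially_decreasing_about x0 u"
proof -
  have f_cont: "continuous_on UNIV f"
    using local_lipschitz_continuous_on[OF assms(4), of 0] by simp
  obtain t0 where t0: "0 < t0" "antimono_on {0..t0} f" using assms(5) by blast
  obtain M where M: "\<And>x. \<bar>u x\<bar> \<le> M" using assms(9) unfolding bounded_iff by auto
  have "local_lipschitz {0::real} {0..M} (\<lambda>_. f)" by (rule local_lipschitz_subset[OF assms(4)]) auto
  from local_lipschitz_compact_implies_lipschitz[OF this compact_Icc compact_sing continuous_on_const]
  obtain L where L: "L-lipschitz_on {0..M} f" by blast
  have u_energy: "finite_energy s u"
    by (rule finite_energy_D_space[OF assms(2,3,1)]) (use assms(6) in \<open>simp add: weak_solution_def\<close>)
  interpret fractional_solution c s f u t0 M L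
  proof
    show "energy_form c s u v = (\<integral>x. f (u x) * v x \<partial>lborel)"
      if "continuous_on UNIV v" "{x. v x \<noteq> 0} \<subseteq> cball 0 R" "finite_energy s v" for v R
      by (rule weak_solution_test_continuous[OF assms(6,7) u_energy f_cont that])
    show "\<bar>f a - f b\<bar> \<le> L * \<bar>a - b\<bar>" if "a \<in> {0..M}" "b \<in> {0..M}" for a b
      using lipschitz_onD[OF L that] by (simp add: dist_real_def)
    show "f b \<le> f a" if "0 \<le> a" "a \<le> b" "b \<le> t0" for a b
      using monotone_onD[OF t0(2), of a b] that by simp
    show "u x \<le> M" for x using M[of x] by simp
  qed (use assms t0 f_cont u_energy lipschitz_on_nonneg[OF L] in auto)
  show ?thesis by (rule radially_decreasing)
qed

end
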